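(* Let $m,n\ge1$ and let $M$ be a connected space-like $m$-dimensional submanifold of the pseudo-Euclidean space $\mathbb{R}^{m+n}_n$ of index $n$. Assume that $M$ is closed with respect to the Euclidean topology (i.e. $M$ is a closed subset of $\mathbb{R}^{m+n}$) and that its mean curvature is parallel. Then $M$ is complete with respect to the Riemannian metric induced from the ambient space $\mathbb{R}^{m+n}_n$.
   Context: $\mathbb{R}^{m+n}_n$ is $\mathbb{R}^{m+n}$ with coordinates $(x_1,\dots,x_m;y_1,\dots,y_n)$ and the inner product $\langle\cdot,\cdot\rangle$ with quadratic form $\sum_i x_i^2-\sum_s y_s^2$. A smooth $m$-dimensional submanifold $M\subset\mathbb{R}^{m+n}_n$ is space-like if $\langle\cdot,\cdot\rangle$ is positive definite on every tangent space $T_xM$; the restriction is the induced Riemannian metric of $M$. With the flat connection $\nabla$ of $\mathbb{R}^{m+n}$, the second fundamental form is $B(V,W)=(\nabla_V W)^{\perp}$ (component in the normal bundle $NM=(TM)^\perp$) for tangent fields $V,W$; the mean curvature vector is $H=\frac1m\sum_{i=1}^m B(e_i,e_i)$ for any local orthonormal tangent frame. The normal connection is $D_V\nu=(\nabla_V\nu)^\perp$ for normal fields $\nu$, and the mean curvature is parallel if $DH\equiv0$. *)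

theory Defs
  imports "HOL-Analysis.Analysis"
begin

type_synonym ('m, 'n) pseudo = "(real ^ 'm) \<times> (real ^ 'n)"

definition pinner :: "('m::finite, 'n::finite) pseudo \<Rightarrow> ('m, 'n) pseudo \<Rightarrow> real" where
  "pinner u v = fst u \<bullet> fst v - snd u \<bullet> snd v"

subsection \<open>Smooth maps and embedded submanifolds\<close>

text \<open>These are only used on open sets \<open>S\<close>.\<close>

primrec Ck_on :: "nat \<Rightarrow> 'a::real_normed_vector set \<Rightarrow> ('a \<Rightarrow> 'b::real_normed_vector) \<Rightarrow> bool" where
  "Ck_on 0 S f \<longleftrightarrow> continuous_on S f"
| "Ck_on (Suc k) S f \<longleftrightarrow>
     (\<forall>x\<in>S. f differentiable (at x)) \<and>
     (\<forall>v. Ck_on k S (\<lambda>x. frechet_derivative f (at x) v))"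

definition smooth_on :: "'a::real_normed_vector set \<Rightarrow> ('a \<Rightarrow> 'b::real_normed_vector) \<Rightarrow> bool" where
  "smooth_on S f \<longleftrightarrow> (\<forall>k. Ck_on k S f)"

text \<open>Embedded submanifolds, via slice charts: around each point, a diffeomorphism \<open>\<Phi>\<close> of open
  subsets of the ambient space takes \<open>M\<close> to the slice \<open>y = 0\<close>.  Hence the dimension of \<open>M\<close> is the
  number \<open>CARD('m)\<close> of positive directions of the ambient form.\<close>

definition smooth_submanifold :: "('m::finite, 'n::finite) pseudo set \<Rightarrow> bool" where
  "smooth_submanifold M \<longleftrightarrow>
     (\<forall>p\<in>M. \<exists>U V \<Phi> \<Psi>.
        open U \<and> p \<in> U \<and> open (V :: ('m, 'n) pseudo set) \<and>
        homeomorphism U V \<Phi> \<Psi> \<and> smooth_on U \<Phi> \<and> smooth_on V \<Psi> \<and>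
        \<Phi> ` (M \<inter> U) = {z \<in> V. snd z = 0})"

definition curve_at ::
  "('m::finite, 'n::finite) pseudo set \<Rightarrow> ('m, 'n) pseudo \<Rightarrow> ('m, 'n) pseudo \<Rightarrow>
   (real \<Rightarrow> ('m, 'n) pseudo) \<Rightarrow> bool" where
  "curve_at M p v \<gamma> \<longleftrightarrow>
     \<gamma> 0 = p \<and> (\<gamma> has_vector_derivative v) (at 0) \<and>
     (\<exists>\<epsilon>>0. smooth_on {-\<epsilon><..<\<epsilon>} \<gamma> \<and> \<gamma> ` {-\<epsilon><..<\<epsilon>} \<subseteq> M)"

definition tangent_space ::
  "('m::finite, 'n::finite) pseudo set \<Rightarrow> ('m, 'n) pseudo \<Rightarrow> ('m, 'n) pseudo set" where
  "tangent_space M p = {v. \<exists>\<gamma>. curve_at M p v \<gamma>}"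

definition normal_space ::
  "('m::finite, 'n::finite) pseudo set \<Rightarrow> ('m, 'n) pseudo \<Rightarrow> ('m, 'n) pseudo set" where
  "normal_space M p = {\<nu>. \<forall>v\<in>tangent_space M p. pinner \<nu> v = 0}"

definition spacelike :: "('m::finite, 'n::finite) pseudo set \<Rightarrow> bool" where
  "spacelike M \<longleftrightarrow> (\<forall>p\<in>M. \<forall>v\<in>tangent_space M p. v \<noteq> 0 \<longrightarrow> pinner v v > 0)"

text \<open>The component \<open>u\<^sup>\<bottom>\<close> in the decomposition of the ambient space into tangent and normal
  space at \<open>p\<close>, which is a direct sum when \<open>M\<close> is space-like.\<close>

definition normal_part ::
  "('m::finite, 'n::finite) pseudo set \<Rightarrow> ('m, 'n) pseudo \<Rightarrow> ('m, 'n) pseudo \<Rightarrow> ('m, 'n) pseudo" where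
  "normal_part M p u = (THE \<nu>. \<nu> \<in> normal_space M p \<and> u - \<nu> \<in> tangent_space M p)"

subsection \<open>Second fundamental form, mean curvature and normal connection\<close>

text \<open>\<open>A\<close> will be a relatively open part of a submanifold; smoothness there means local
  extendability to smooth maps on open subsets of the ambient space.\<close>

definition smooth_field_on ::
  "('m::finite, 'n::finite) pseudo set \<Rightarrow> (('m, 'n) pseudo \<Rightarrow> ('m, 'n) pseudo) \<Rightarrow> bool" where
  "smooth_field_on A F \<longleftrightarrow>
     (\<forall>p\<in>A. \<exists>O' G. open O' \<and> p \<in> O' \<and> smooth_on O' G \<and> (\<forall>x\<in>A \<inter> O'. F x = G x))"

definition tangent_field_on ::
  "('m::finite, 'n::finite) pseudo set \<Rightarrow> ('m, 'n) pseudo set \<Rightarrow>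
   (('m, 'n) pseudo \<Rightarrow> ('m, 'n) pseudo) \<Rightarrow> bool" where
  "tangent_field_on M U V \<longleftrightarrow>
     open U \<and> smooth_field_on (M \<inter> U) V \<and> (\<forall>x\<in>M \<inter> U. V x \<in> tangent_space M x)"

text \<open>The flat derivative \<open>\<nabla>\<^sub>v F\<close> at \<open>p\<close>, for \<open>v\<close> tangent to \<open>M\<close> at \<open>p\<close>.  As \<open>F\<close> is significant only
  on \<open>M\<close>, it is differentiated along curves in \<open>M\<close> with velocity \<open>v\<close>; the choice of the curve is
  immaterial for smooth \<open>F\<close>.\<close>

definition flat_deriv ::
  "('m::finite, 'n::finite) pseudo set \<Rightarrow> (('m, 'n) pseudo \<Rightarrow> ('m, 'n) pseudo) \<Rightarrow>
   ('m, 'n) pseudo \<Rightarrow> ('m, 'n) pseudo \<Rightarrow> ('m, 'n) pseudo" where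
  "flat_deriv M F p v =
     (THE w. \<forall>\<gamma>. curve_at M p v \<gamma> \<longrightarrow> ((F \<circ> \<gamma>) has_vector_derivative w) (at 0))"

definition second_fundamental_form ::
  "('m::finite, 'n::finite) pseudo set \<Rightarrow> (('m, 'n) pseudo \<Rightarrow> ('m, 'n) pseudo) \<Rightarrow>
   (('m, 'n) pseudo \<Rightarrow> ('m, 'n) pseudo) \<Rightarrow> ('m, 'n) pseudo \<Rightarrow> ('m, 'n) pseudo" where
  "second_fundamental_form M V W p = normal_part M p (flat_deriv M W p (V p))"

definition normal_connection ::
  "('m::finite, 'n::finite) pseudo set \<Rightarrow> (('m, 'n) pseudo \<Rightarrow> ('m, 'n) pseudo) \<Rightarrow>
   (('m, 'n) pseudo \<Rightarrow> ('m, 'n) pseudo) \<Rightarrow> ('m, 'n) pseudo \<Rightarrow> ('m, 'n) pseudo" where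
  "normal_connection M V \<nu> p = normal_part M p (flat_deriv M \<nu> p (V p))"

text \<open>The \<open>CARD('m)\<close> fields \<open>e i\<close> form a basis of each tangent space, by the dimension of \<open>M\<close>.\<close>

definition orthonormal_frame_on ::
  "('m::finite, 'n::finite) pseudo set \<Rightarrow> ('m, 'n) pseudo set \<Rightarrow>
   ('m \<Rightarrow> ('m, 'n) pseudo \<Rightarrow> ('m, 'n) pseudo) \<Rightarrow> bool" where
  "orthonormal_frame_on M U e \<longleftrightarrow>
     (\<forall>i. tangent_field_on M U (e i)) \<and>
     (\<forall>x\<in>M \<inter> U. \<forall>i j. pinner (e i x) (e j x) = (if i = j then 1 else 0))"

definition mean_curvature ::
  "('m::finite, 'n::finite) pseudo set \<Rightarrow> ('m, 'n) pseudo \<Rightarrow> ('m, 'n) pseudo" where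
  "mean_curvature M p =
     (THE h. \<exists>U e. p \<in> U \<and> orthonormal_frame_on M U e \<and>
        h = (1 / real CARD('m)) *\<^sub>R (\<Sum>i\<in>UNIV. second_fundamental_form M (e i) (e i) p))"

definition parallel_mean_curvature :: "('m::finite, 'n::finite) pseudo set \<Rightarrow> bool" where
  "parallel_mean_curvature M \<longleftrightarrow>
     (\<forall>U V. tangent_field_on M U V \<longrightarrow>
        (\<forall>p\<in>M \<inter> U. normal_connection M V (mean_curvature M) p = 0))"

subsection \<open>The induced Riemannian distance and completeness\<close>

text \<open>Lengths of piecewise continuously differentiable curves in \<open>M\<close>.  The library's \<open>valid_path\<close>
  does not bound the velocity near the break points, so the speed need not be integrable; the
  relational \<open>has_integral\<close> discards the curves of infinite length, to which \<open>integral\<close> would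
  assign the length 0.\<close>

definition curve_lengths ::
  "('m::finite, 'n::finite) pseudo set \<Rightarrow> ('m, 'n) pseudo \<Rightarrow> ('m, 'n) pseudo \<Rightarrow> real set" where
  "curve_lengths M p q =
     {L. \<exists>\<gamma>. valid_path \<gamma> \<and> path_image \<gamma> \<subseteq> M \<and> pathstart \<gamma> = p \<and> pathfinish \<gamma> = q \<and>
        ((\<lambda>t. sqrt (pinner (vector_derivative \<gamma> (at t)) (vector_derivative \<gamma> (at t))))
           has_integral L) {0..1}}"

text \<open>The value 0 off \<open>M\<close> is a dummy: \<^locale>\<open>Metric_space\<close> requires a nonnegative symmetric
  function on the whole type.\<close>

definition riemannian_dist ::
  "('m::finite, 'n::finite) pseudo set \<Rightarrow> ('m, 'n) pseudo \<Rightarrow> ('m, 'n) pseudo \<Rightarrow> real" where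
  "riemannian_dist M p q = (if p \<in> M \<and> q \<in> M then Inf (curve_lengths M p q) else 0)"

text \<open>Only used for connected \<open>M\<close>, where any two points are joined by a curve.\<close>

definition riemannian_complete :: "('m::finite, 'n::finite) pseudo set \<Rightarrow> bool" where
  "riemannian_complete M \<longleftrightarrow>
     Metric_space M (riemannian_dist M) \<and> Metric_space.mcomplete M (riemannian_dist M)"

end

theory Submission
  imports Defs
begin

text \<open>
  A space-like submanifold projects to the positive factor \<open>\<real>\<^sup>m\<close> by a local diffeomorphism whose local inverses
  have slope less than one. If it is closed, these local inverses can be continued along every ball, as the
  continuation stays in a compact part of it. If it is also connected, it is therefore the graph of a smooth
  function \<open>f : \<real>\<^sup>m \<rightarrow> \<real>\<^sup>n\<close> that shortens all distances (\<open>global_graph\<close>), and everything can be computed in the global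
  coordinates of \<open>F(x) = (x, f(x))\<close>.

  Fix a point \<open>F(x0)\<close> and let \<open>X = F - F(x0)\<close> be the position vector and \<open>z = \<langle>X, X\<rangle>\<close> the pseudo-distance function.
  It is nonnegative and proper (\<open>z_proper\<close>), because the slope of \<open>f\<close> is less than one. Completeness amounts to
  showing that a curve of finite length cannot leave every sublevel set of \<open>z\<close>. For this it is enough that
  \<open>ln (z + 1)\<close> has bounded gradient. The gradient of \<open>z\<close> is twice the tangential part of \<open>X\<close>, of squared length \<open>z + w\<close>,
  where \<open>w = - \<langle>X\<^sup>N, X\<^sup>N\<rangle>\<close> measures the normal part. So the point is the growth estimate \<open>w \<le> C (z + 1)\<^sup>2\<close>
  (\<open>normal_part_bound\<close>).

  It comes from the maximum principle. Let \<open>B\<close> be the second fundamental form and \<open>S = \<langle>B, X\<^sup>N\<rangle>\<close>. If the mean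
  curvature is parallel, the Codazzi equation leads to
  \<open>\<Delta>w = 2 tr S + 2 |S|\<^sup>2 + 2 \<Sum>\<^sub>i |B(e\<^sub>i, X\<^sup>T)|\<^sup>2\<close>, with the norm of the last term taken in the negative definite normal
  space, while \<open>\<nabla>w = 2 S X\<^sup>T\<close> and \<open>\<Delta>z = 2 m + 2 tr S\<close>. Moreover \<open>|tr S|\<close> is at most a constant times \<open>\<surd>w\<close>,
  because a parallel mean curvature vector has constant length. At a maximum of
  \<open>w (b - z)\<^sup>N\<close> the vector \<open>X\<^sup>T\<close> is an eigenvector of \<open>S\<close> with eigenvalue \<open>\<mu> = N w / (b - z)\<close>. The last term of \<open>\<Delta>w\<close> is
  bounded below by the Cauchy-Schwarz inequality, and \<open>|S|\<^sup>2\<close> by \<open>\<mu>\<^sup>2 + (tr S - \<mu>)\<^sup>2 / m\<close>. Since the trace is small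
  compared with \<open>\<mu>\<close>, a large exponent \<open>N\<close> makes the defect \<open>(tr S - \<mu>)\<^sup>2 / m\<close> absorb the bad terms that the weight
  produces. The result is \<open>\<surd>w \<le> C b\<close> at the maximum (\<open>bound_at_maximum\<close>), and letting \<open>b\<close> be comparable to \<open>z\<close> gives the
  estimate everywhere.

  The Laplacian itself does not appear. At the maximum point the function \<open>w\<close> is replaced by the lower barrier
  \<open>- \<langle>X - V, X - V\<rangle>\<close> for a tangent field \<open>V\<close> that equals \<open>X\<^sup>T\<close> at the point, and the barrier is differentiated
  twice along \<open>m\<close> parabolas in the coordinates (\<open>maximum_variation\<close>). Their accelerations and the field \<open>V\<close> are
  chosen so that the sum of the second derivatives agrees with the covariant formulas above.
\<close>

section \<open>Calculus of smooth maps\<close>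

text \<open>The directional derivative as a function of the base point: iterated derivatives, also in
  constant but different directions, are then iterated applications of one operator.\<close>

abbreviation pd :: "'a::real_normed_vector \<Rightarrow> ('a \<Rightarrow> 'b::real_normed_vector) \<Rightarrow> 'a \<Rightarrow> 'b" where
  "pd v f \<equiv> \<lambda>x. frechet_derivative f (at x) v"

lemma pd_eq: "(f has_derivative f') (at x) \<Longrightarrow> pd v f x = f' v"
  using frechet_derivative_at by fastforce

lemma differentiable_has_pd:
  "f differentiable (at x) \<Longrightarrow> (f has_derivative (\<lambda>v. pd v f x)) (at x)"
  by (simp add: frechet_derivative_works)

lemma pd_cong_open:
  assumes "open S" "x \<in> S" "\<And>y. y \<in> S \<Longrightarrow> f y = g y" "f differentiable (at x)"
  shows "g differentiable (at x)" "pd v g x = pd v f x"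
proof -
  have "(g has_derivative (\<lambda>v. pd v f x)) (at x)"
    using has_derivative_transform_within_open[OF differentiable_has_pd[OF assms(4)] assms(1,2,3)] .
  then show "g differentiable (at x)" "pd v g x = pd v f x"
    by (auto simp: differentiable_def pd_eq)
qed

lemma Ck_on_cong:
  assumes "open S" "\<And>x. x \<in> S \<Longrightarrow> f x = g x" "Ck_on k S f"
  shows "Ck_on k S g"
  using assms(2,3)
proof (induction k arbitrary: f g)
  case 0
  then show ?case by (simp cong: continuous_on_cong)
next
  case (Suc k)
  then have *: "f differentiable (at x)" if "x \<in> S" for x using that by auto
  have "Ck_on k S (pd v g)" for v
    using Suc.IH[of "pd v f" "pd v g"] Suc.prems pd_cong_open(2)[OF assms(1) _ Suc.prems(1) *]
    by simp
  then show ?case using pd_cong_open(1)[OF assms(1) _ Suc.prems(1) *] by auto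
qed

lemma Ck_on_SucD: "Ck_on (Suc k) S f \<Longrightarrow> Ck_on k S f"
proof (induction k arbitrary: f)
  case 0
  then show ?case
    by (auto intro!: continuous_at_imp_continuous_on differentiable_imp_continuous_within)
next
  case (Suc k)
  then show ?case by (metis Ck_on.simps(2))
qed

lemma Ck_on_continuous: "Ck_on k S f \<Longrightarrow> continuous_on S f"
proof (induction k)
  case (Suc k) then show ?case using Ck_on_SucD by blast
qed simp

lemma Ck_on_subset: "Ck_on k S f \<Longrightarrow> T \<subseteq> S \<Longrightarrow> Ck_on k T f"
  by (induction k arbitrary: f) (auto intro: continuous_on_subset)

lemma Ck_on_local:
  assumes "\<And>x. x \<in> S \<Longrightarrow> \<exists>T. open T \<and> x \<in> T \<and> Ck_on k T f"
  shows "Ck_on k S f"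
  using assms
proof (induction k arbitrary: f)
  case 0
  show ?case
  proof (simp, intro continuous_at_imp_continuous_on ballI)
    fix x assume "x \<in> S"
    then obtain T where "open T" "x \<in> T" "continuous_on T f" using 0 by auto
    then show "isCont f x" by (simp add: continuous_on_eq_continuous_at)
  qed
next
  case (Suc k)
  have "Ck_on k S (pd v f)" for v
    by (rule Suc.IH) (use Suc.prems in \<open>metis Ck_on.simps(2)\<close>)
  moreover have "f differentiable (at x)" if "x \<in> S" for x
    using Suc.prems[OF that] by auto
  ultimately show ?case by simp
qed

lemma Ck_on_const: "Ck_on k S (\<lambda>x. c)"
  by (induction k arbitrary: c) (auto simp: frechet_derivative_const)

lemma Ck_on_compose_linear:
  assumes "open S" "bounded_linear L" "Ck_on k S f"
  shows "Ck_on k S (\<lambda>x. L (f x))"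
  using assms(3)
proof (induction k arbitrary: f)
  case 0
  then show ?case
    using assms(2) by (auto intro!: continuous_on_compose2[OF linear_continuous_on, of L])
next
  case (Suc k)
  have *: "((\<lambda>x. L (f x)) has_derivative (\<lambda>v. L (pd v f x))) (at x)" if "x \<in> S" for x
    using that Suc.prems
    by (auto intro!: bounded_linear.has_derivative[OF assms(2)] differentiable_has_pd)
  have "Ck_on k S (pd v (\<lambda>x. L (f x)))" for v
    by (rule Ck_on_cong[OF assms(1), of "\<lambda>x. L (pd v f x)"])
      (use Suc in \<open>auto simp: pd_eq[OF *]\<close>)
  then show ?case using * by (auto simp: differentiable_def)
qed

lemma Ck_on_id: "Ck_on k S (\<lambda>x. x)"
  by (cases k) (auto simp: Ck_on_const frechet_derivative_ident)

lemma Ck_on_add: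
  assumes "open S" "Ck_on k S f" "Ck_on k S g"
  shows "Ck_on k S (\<lambda>x. f x + g x)"
  using assms(2,3)
proof (induction k arbitrary: f g)
  case 0
  then show ?case by (auto intro: continuous_intros)
next
  case (Suc k)
  have *: "((\<lambda>x. f x + g x) has_derivative (\<lambda>v. pd v f x + pd v g x)) (at x)" if "x \<in> S" for x
    using that Suc.prems by (auto intro!: has_derivative_add differentiable_has_pd)
  have "Ck_on k S (pd v (\<lambda>x. f x + g x))" for v
    by (rule Ck_on_cong[OF assms(1), of "\<lambda>x. pd v f x + pd v g x"])
      (use Suc in \<open>auto simp: pd_eq[OF *]\<close>)
  then show ?case using * by (auto simp: differentiable_def)
qed

lemma Ck_on_sum:
  assumes "open S" "\<And>i. i \<in> I \<Longrightarrow> Ck_on k S (f i)"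
  shows "Ck_on k S (\<lambda>x. \<Sum>i\<in>I. f i x)"
  using assms(2)
  by (induction I rule: infinite_finite_induct) (auto intro: Ck_on_add[OF assms(1)] Ck_on_const)

lemma Ck_on_bilinear:
  assumes "open S" "bounded_bilinear B" "Ck_on k S f" "Ck_on k S g"
  shows "Ck_on k S (\<lambda>x. B (f x) (g x))"
  using assms(3,4)
proof (induction k arbitrary: f g)
  case 0
  then show ?case using bounded_bilinear.continuous_on[OF assms(2)] by auto
next
  case (Suc k)
  have *: "((\<lambda>x. B (f x) (g x)) has_derivative (\<lambda>v. B (f x) (pd v g x) + B (pd v f x) (g x))) (at x)"
    if "x \<in> S" for x
    using that Suc.prems
    by (auto intro!: bounded_bilinear.FDERIV[OF assms(2)] differentiable_has_pd)
  have "Ck_on k S (pd v (\<lambda>x. B (f x) (g x)))" for v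
    by (rule Ck_on_cong[OF assms(1), of "\<lambda>x. B (f x) (pd v g x) + B (pd v f x) (g x)"])
      (use Suc.prems in \<open>auto simp: pd_eq[OF *] intro!: Ck_on_add[OF assms(1)] Suc.IH simp del: Ck_on.simps(1)
        intro: Ck_on_SucD[OF Suc.prems(1)] Ck_on_SucD[OF Suc.prems(2)]\<close>)
  then show ?case using * by (auto simp: differentiable_def)
qed

lemma pd_expand:
  fixes f :: "'a::euclidean_space \<Rightarrow> 'b::real_normed_vector"
  assumes "f differentiable (at x)"
  shows "pd w f x = (\<Sum>b\<in>Basis. (w \<bullet> b) *\<^sub>R pd b f x)"
proof -
  interpret bounded_linear "\<lambda>v. pd v f x"
    using differentiable_has_pd[OF assms] by (rule has_derivative_bounded_linear)
  have "pd (\<Sum>b\<in>Basis. (w \<bullet> b) *\<^sub>R b) f x = (\<Sum>b\<in>Basis. (w \<bullet> b) *\<^sub>R pd b f x)"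
    by (simp only: sum scaleR)
  then show ?thesis by (simp add: euclidean_representation)
qed

text \<open>The chain rule expands \<open>D(f \<circ> g)\<close> over a basis of the middle space. Each summand is a product of maps
  that are smooth of lower order, so that the induction closes.\<close>

lemma Ck_on_compose:
  fixes f :: "'b::euclidean_space \<Rightarrow> 'c::real_normed_vector"
  assumes "open S" "open T" "\<And>x. x \<in> S \<Longrightarrow> g x \<in> T" "Ck_on k T f" "Ck_on k S g"
  shows "Ck_on k S (\<lambda>x. f (g x))"
  using assms(4,5)
proof (induction k arbitrary: f)
  case 0
  then show ?case using assms(3) by (auto intro!: continuous_on_compose2[of T f S g])
next
  case (Suc k)
  have g: "g differentiable (at x)" "f differentiable (at (g x))" if "x \<in> S" for x
    using that Suc.prems assms(3) by auto
  have *: "((\<lambda>x. f (g x)) has_derivative (\<lambda>v. pd (pd v g x) f (g x))) (at x)" if "x \<in> S" for x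
    using has_derivative_compose[OF differentiable_has_pd[OF g(1)] differentiable_has_pd[OF g(2)]]
      that by blast
  have **: "pd v (\<lambda>x. f (g x)) x = (\<Sum>b\<in>Basis. (pd v g x \<bullet> b) *\<^sub>R pd b f (g x))"
    if "x \<in> S" for x v
    using pd_eq[OF *] pd_expand g that by metis
  have "Ck_on k S (pd v (\<lambda>x. f (g x)))" for v
  proof (rule Ck_on_cong[OF assms(1), of "\<lambda>x. \<Sum>b\<in>Basis. (pd v g x \<bullet> b) *\<^sub>R pd b f (g x)"])
    show "(\<Sum>b\<in>Basis. (pd v g x \<bullet> b) *\<^sub>R pd b f (g x)) = pd v (\<lambda>x. f (g x)) x" if "x \<in> S" for x
      using ** that by simp
    have "Ck_on k S (pd v g)" "\<And>b. Ck_on k T (pd b f)" "Ck_on k S g"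
      using Suc.prems Ck_on_SucD by auto
    then show "Ck_on k S (\<lambda>x. \<Sum>b\<in>Basis. (pd v g x \<bullet> b) *\<^sub>R pd b f (g x))"
      by (intro Ck_on_sum Ck_on_bilinear[OF _ bounded_bilinear_scaleR]
          Ck_on_bilinear[OF _ bounded_bilinear_inner] Suc.IH Ck_on_const assms(1))
  qed
  then show ?case using * by (auto simp: differentiable_def)
qed

text \<open>Differentiation only lowers the exponent, so all exponents are treated at once.\<close>

lemma Ck_on_powr: "Ck_on k {0<..} (\<lambda>x::real. x powr a)"
proof (induction k arbitrary: a)
  case 0
  then show ?case by (auto intro!: continuous_intros)
next
  case (Suc k)
  have *: "((\<lambda>x. x powr a) has_derivative (\<lambda>v. v * (a * x powr (a - 1)))) (at x)" if "0 < x" for x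
    using has_real_derivative_powr[OF that, of a] by (simp add: has_field_derivative_def mult.commute[of _ "a * _"])
  have "Ck_on k {0<..} (pd v (\<lambda>x. x powr a))" for v
    by (rule Ck_on_cong[of _ "\<lambda>x. v * (a * x powr (a - 1))"])
      (use Suc in \<open>auto simp: pd_eq[OF *] intro!: Ck_on_bilinear[OF _ bounded_bilinear_mult] Ck_on_const simp del: mult_minus_right Ck_on.simps\<close>)
  then show ?case using * by (auto simp: differentiable_def)
qed

lemma Ck_on_inverse: "Ck_on k (-{0}) (inverse :: real \<Rightarrow> real)"
proof (induction k)
  case 0
  then show ?case by (auto intro!: continuous_intros)
next
  case (Suc k)
  have *: "(inverse has_derivative (\<lambda>v. - (inverse x * v * inverse x))) (at x)" if "x \<noteq> 0" for x :: real
    using has_derivative_inverse'[OF that, of UNIV] by simp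
  have "Ck_on k (-{0}) (\<lambda>x. (inverse x * inverse x) * c)" for c :: real
    by (intro Ck_on_bilinear[OF _ bounded_bilinear_mult] Ck_on_const Suc) auto
  then have "Ck_on k (-{0}) (pd v inverse)" for v :: real
    by (rule Ck_on_cong[rotated 2, of _ _ "\<lambda>x. (inverse x * inverse x) * (- v)"])
      (use pd_eq[OF *] in auto)
  then show ?case using * by (auto simp: differentiable_def)
qed

lemma smooth_on_cong: "open S \<Longrightarrow> (\<And>x. x \<in> S \<Longrightarrow> f x = g x) \<Longrightarrow> smooth_on S f \<Longrightarrow> smooth_on S g"
  unfolding smooth_on_def using Ck_on_cong by blast

lemma smooth_on_subset: "smooth_on S f \<Longrightarrow> T \<subseteq> S \<Longrightarrow> smooth_on T f"
  unfolding smooth_on_def using Ck_on_subset by blast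

lemma smooth_on_continuous: "smooth_on S f \<Longrightarrow> continuous_on S f"
  unfolding smooth_on_def using Ck_on_continuous by blast

lemma smooth_on_differentiable: "smooth_on S f \<Longrightarrow> x \<in> S \<Longrightarrow> f differentiable (at x)"
  unfolding smooth_on_def by (metis Ck_on.simps(2))

lemma smooth_on_pd: "smooth_on S f \<Longrightarrow> smooth_on S (pd v f)"
  unfolding smooth_on_def by (metis Ck_on.simps(2))

lemma smooth_on_const: "smooth_on S (\<lambda>x. c)"
  unfolding smooth_on_def using Ck_on_const by blast

lemma smooth_on_id: "smooth_on S (\<lambda>x. x)"
  unfolding smooth_on_def using Ck_on_id by blast

lemma smooth_on_compose_linear:
  "open S \<Longrightarrow> bounded_linear L \<Longrightarrow> smooth_on S f \<Longrightarrow> smooth_on S (\<lambda>x. L (f x))"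
  unfolding smooth_on_def using Ck_on_compose_linear by blast

lemma smooth_on_add:
  "open S \<Longrightarrow> smooth_on S f \<Longrightarrow> smooth_on S g \<Longrightarrow> smooth_on S (\<lambda>x. f x + g x)"
  unfolding smooth_on_def using Ck_on_add by blast

lemma smooth_on_sum:
  "open S \<Longrightarrow> (\<And>i. i \<in> I \<Longrightarrow> smooth_on S (f i)) \<Longrightarrow> smooth_on S (\<lambda>x. \<Sum>i\<in>I. f i x)"
  by (simp add: smooth_on_def Ck_on_sum)

lemma smooth_on_bilinear:
  "open S \<Longrightarrow> bounded_bilinear B \<Longrightarrow> smooth_on S f \<Longrightarrow> smooth_on S g \<Longrightarrow>
    smooth_on S (\<lambda>x. B (f x) (g x))"
  unfolding smooth_on_def using Ck_on_bilinear by blast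

lemmas smooth_on_scaleR = smooth_on_bilinear[OF _ bounded_bilinear_scaleR]
lemmas smooth_on_inner = smooth_on_bilinear[OF _ bounded_bilinear_inner]

lemma smooth_on_minus: "open S \<Longrightarrow> smooth_on S f \<Longrightarrow> smooth_on S (\<lambda>x. - f x)"
  using smooth_on_compose_linear[OF _ bounded_linear_minus[OF bounded_linear_ident]] .

lemma smooth_on_diff:
  "open S \<Longrightarrow> smooth_on S f \<Longrightarrow> smooth_on S g \<Longrightarrow> smooth_on S (\<lambda>x. f x - g x)"
  using smooth_on_add[of S f "\<lambda>x. - g x"] smooth_on_minus[of S g] by simp

lemma smooth_on_fst: "open S \<Longrightarrow> smooth_on S f \<Longrightarrow> smooth_on S (\<lambda>x. fst (f x))"
  by (rule smooth_on_compose_linear[OF _ bounded_linear_fst])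

lemma smooth_on_snd: "open S \<Longrightarrow> smooth_on S f \<Longrightarrow> smooth_on S (\<lambda>x. snd (f x))"
  by (rule smooth_on_compose_linear[OF _ bounded_linear_snd])

lemma smooth_on_Pair:
  assumes "open S" "smooth_on S f" "smooth_on S g"
  shows "smooth_on S (\<lambda>x. (f x, g x))"
proof -
  have 1: "bounded_linear (\<lambda>y. (y, 0))" "bounded_linear (\<lambda>y. (0, y))"
    by (auto intro!: bounded_linear_Pair bounded_linear_ident bounded_linear_zero)
  have "smooth_on S (\<lambda>x. (f x, 0) + (0, g x))"
    by (intro smooth_on_add smooth_on_compose_linear[OF _ 1(1)] smooth_on_compose_linear[OF _ 1(2)] assms)
  then show ?thesis by simp
qed

lemma smooth_on_compose:
  fixes f :: "'b::euclidean_space \<Rightarrow> 'c::real_normed_vector"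
  assumes "open S" "open T" "\<And>x. x \<in> S \<Longrightarrow> g x \<in> T" "smooth_on T f" "smooth_on S g"
  shows "smooth_on S (\<lambda>x. f (g x))"
  using assms Ck_on_compose[of S T g _ f] unfolding smooth_on_def by blast

lemma smooth_on_powr:
  assumes "open S" "smooth_on S f" "\<And>x. x \<in> S \<Longrightarrow> (0::real) < f x"
  shows "smooth_on S (\<lambda>x. f x powr a)"
  by (rule smooth_on_compose[of S "{0<..}" f "\<lambda>x. x powr a"])
    (use assms Ck_on_powr in \<open>auto simp: smooth_on_def\<close>)

text \<open>The mean value theorem along the two sides of a small parallelogram. The left side is symmetric in
  \<open>u\<close> and \<open>v\<close>, which forces the mixed derivatives to agree.\<close>

lemma second_difference_mvt:
  fixes f :: "'a::real_normed_vector \<Rightarrow> real"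
  assumes f: "Ck_on 2 UNIV f" and s: "0 < s"
  shows "\<exists>\<theta>\<in>{0<..<s}. \<exists>\<eta>\<in>{0<..<s}. f (x + s *\<^sub>R u + s *\<^sub>R v) - f (x + s *\<^sub>R u) - f (x + s *\<^sub>R v) + f x
    = s * s * pd v (pd u f) (x + \<theta> *\<^sub>R u + \<eta> *\<^sub>R v)"
proof -
  have d: "f differentiable (at y)" "pd w f differentiable (at y)" for y w
    using f by (auto simp: numeral_2_eq_2)
  have line: "((\<lambda>t. g (y + t *\<^sub>R w)) has_real_derivative pd w g (y + t *\<^sub>R w)) (at t)"
    if "g differentiable (at (y + t *\<^sub>R w))" for g :: "'a \<Rightarrow> real" and y w t
  proof -
    have 1: "((\<lambda>t. y + t *\<^sub>R w) has_derivative (\<lambda>h. h *\<^sub>R w)) (at t)"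
      by (auto intro!: derivative_eq_intros)
    interpret bounded_linear "\<lambda>v. pd v g (y + t *\<^sub>R w)"
      using differentiable_has_pd[OF that] by (rule has_derivative_bounded_linear)
    have 2: "(\<lambda>h. pd (h *\<^sub>R w) g (y + t *\<^sub>R w)) = (*) (pd w g (y + t *\<^sub>R w))"
      by (rule ext) (simp only: scaleR real_scaleR_def mult.commute)
    show ?thesis
      using has_derivative_compose[OF 1 differentiable_has_pd[OF that]]
      unfolding has_field_derivative_def 2 .
  qed
  define h where "h = (\<lambda>t. f ((x + s *\<^sub>R v) + t *\<^sub>R u) - f (x + t *\<^sub>R u))"
  have h: "(h has_real_derivative (pd u f ((x + s *\<^sub>R v) + t *\<^sub>R u) - pd u f (x + t *\<^sub>R u))) (at t)" for t
    unfolding h_def by (intro DERIV_diff line d)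
  have "\<exists>z>0. z < s \<and> h s - h 0
      = (s - 0) * (pd u f ((x + s *\<^sub>R v) + z *\<^sub>R u) - pd u f (x + z *\<^sub>R u))"
    by (rule MVT2[OF s]) (rule h)
  then obtain \<theta> where th: "0 < \<theta>" "\<theta> < s"
    "h s - h 0 = (s - 0) * (pd u f ((x + s *\<^sub>R v) + \<theta> *\<^sub>R u) - pd u f (x + \<theta> *\<^sub>R u))"
    by (elim exE conjE)
  have "\<exists>z>0. z < s \<and> pd u f ((x + \<theta> *\<^sub>R u) + s *\<^sub>R v) - pd u f ((x + \<theta> *\<^sub>R u) + 0 *\<^sub>R v)
      = (s - 0) * pd v (pd u f) ((x + \<theta> *\<^sub>R u) + z *\<^sub>R v)"
    by (rule MVT2[OF s]) (rule line[OF d(2)])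
  then obtain \<eta> where et: "0 < \<eta>" "\<eta> < s"
    "pd u f ((x + \<theta> *\<^sub>R u) + s *\<^sub>R v) - pd u f ((x + \<theta> *\<^sub>R u) + 0 *\<^sub>R v)
      = (s - 0) * pd v (pd u f) ((x + \<theta> *\<^sub>R u) + \<eta> *\<^sub>R v)"
    by (elim exE conjE)
  have swap: "(x + s *\<^sub>R v) + t *\<^sub>R u = (x + t *\<^sub>R u) + s *\<^sub>R v" for t by simp
  have "h s - h 0 = s * (s * pd v (pd u f) (x + \<theta> *\<^sub>R u + \<eta> *\<^sub>R v))"
    using th(3) et(3) unfolding swap by simp
  moreover have "h s - h 0 = f (x + s *\<^sub>R u + s *\<^sub>R v) - f (x + s *\<^sub>R u) - f (x + s *\<^sub>R v) + f x"
    unfolding h_def swap by simp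
  ultimately show ?thesis using th(1,2) et(1,2) by (intro bexI[of _ \<theta>] bexI[of _ \<eta>]) auto
qed

lemma pd_commute_real:
  fixes f :: "'a::real_normed_vector \<Rightarrow> real"
  assumes f: "Ck_on 2 UNIV f"
  shows "pd u (pd v f) x = pd v (pd u f) x"
proof -
  have c: "isCont (pd u (pd v f)) x" for u v
    using f by (auto simp: numeral_2_eq_2 continuous_on_eq_continuous_at)
  have lim: "(\<lambda>n. (f (x + s n *\<^sub>R u + s n *\<^sub>R v) - f (x + s n *\<^sub>R u) - f (x + s n *\<^sub>R v) + f x) / (s n * s n))
     \<longlonglongrightarrow> pd v (pd u f) x" if s: "s = (\<lambda>n. inverse (real (Suc n)))" for s :: "nat \<Rightarrow> real" and u v
  proof -
    have sp: "s n > 0" for n using s by simp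
    have "\<forall>n. \<exists>q. fst q \<in> {0<..<s n} \<and> snd q \<in> {0<..<s n} \<and>
        f (x + s n *\<^sub>R u + s n *\<^sub>R v) - f (x + s n *\<^sub>R u) - f (x + s n *\<^sub>R v) + f x
        = s n * s n * pd v (pd u f) (x + fst q *\<^sub>R u + snd q *\<^sub>R v)"
      using second_difference_mvt[OF f sp, where x=x and u=u and v=v] by fastforce
    from choice[OF this] obtain q where q: "\<And>n. fst (q n) \<in> {0<..<s n}" "\<And>n. snd (q n) \<in> {0<..<s n}"
      "\<And>n. f (x + s n *\<^sub>R u + s n *\<^sub>R v) - f (x + s n *\<^sub>R u) - f (x + s n *\<^sub>R v) + f x
        = s n * s n * pd v (pd u f) (x + fst (q n) *\<^sub>R u + snd (q n) *\<^sub>R v)" by blast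
    define \<theta> \<eta> where th_et: "\<theta> n = fst (q n)" "\<eta> n = snd (q n)" for n
    note te = q[folded th_et]
    have s0: "s \<longlonglongrightarrow> 0" unfolding s using LIMSEQ_inverse_real_of_nat by simp
    have t0: "\<theta> \<longlonglongrightarrow> 0" "\<eta> \<longlonglongrightarrow> 0"
      by (rule tendsto_sandwich[OF _ _ tendsto_const s0];
          use te(1,2) in \<open>simp add: less_imp_le\<close>)+
    have "(\<lambda>n. x + \<theta> n *\<^sub>R u + \<eta> n *\<^sub>R v) \<longlonglongrightarrow> x + 0 *\<^sub>R u + 0 *\<^sub>R v"
      by (intro tendsto_intros t0)
    then have "(\<lambda>n. pd v (pd u f) (x + \<theta> n *\<^sub>R u + \<eta> n *\<^sub>R v)) \<longlonglongrightarrow> pd v (pd u f) x"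
      using isCont_tendsto_compose[OF c] by simp
    then show ?thesis
      using sp by (simp add: te(3) less_imp_neq[symmetric])
  qed
  have "(\<lambda>n. (f (x + s n *\<^sub>R u + s n *\<^sub>R v) - f (x + s n *\<^sub>R u) - f (x + s n *\<^sub>R v) + f x) / (s n * s n))
     \<longlonglongrightarrow> pd u (pd v f) x" if s: "s = (\<lambda>n. inverse (real (Suc n)))" for s :: "nat \<Rightarrow> real"
  proof -
    have "f (x + s n *\<^sub>R u + s n *\<^sub>R v) - f (x + s n *\<^sub>R u) - f (x + s n *\<^sub>R v) + f x
      = f (x + s n *\<^sub>R v + s n *\<^sub>R u) - f (x + s n *\<^sub>R v) - f (x + s n *\<^sub>R u) + f x" for n
      by (simp add: add.assoc add.commute[of "s n *\<^sub>R u"])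
    then show ?thesis using lim[OF s, of v u] by presburger
  qed
  with lim[OF refl, of u v] show ?thesis using LIMSEQ_unique by blast
qed

lemma pd_compose_linear:
  assumes "bounded_linear L" "f differentiable (at x)"
  shows "pd v (\<lambda>x. L (f x)) x = L (pd v f x)"
  by (rule pd_eq) (auto intro!: bounded_linear.has_derivative[OF assms(1)] differentiable_has_pd assms)

lemma pd_commute:
  fixes f :: "'a::real_normed_vector \<Rightarrow> 'b::euclidean_space"
  assumes f: "smooth_on UNIV f"
  shows "pd u (pd v f) x = pd v (pd u f) x"
proof (rule euclidean_eqI)
  fix b :: 'b assume "b \<in> Basis"
  have b: "bounded_linear (\<lambda>y. y \<bullet> b)" by (rule bounded_linear_inner_left)
  have d: "f differentiable (at y)" "pd w f differentiable (at y)" for y w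
    using smooth_on_differentiable[OF f] smooth_on_differentiable[OF smooth_on_pd[OF f]] by auto
  have 1: "pd w (\<lambda>x. f x \<bullet> b) = (\<lambda>x. pd w f x \<bullet> b)" for w
    using pd_compose_linear[OF b d(1)] by blast
  have 2: "pd u (pd v (\<lambda>x. f x \<bullet> b)) x = pd u (pd v f) x \<bullet> b" for u v
    unfolding 1 using pd_compose_linear[OF b d(2)] by blast
  have "Ck_on 2 UNIV (\<lambda>x. f x \<bullet> b)"
    using smooth_on_compose_linear[OF open_UNIV b f] by (auto simp: smooth_on_def)
  from pd_commute_real[OF this, where u=u and v=v and x=x] show "pd u (pd v f) x \<bullet> b = pd v (pd u f) x \<bullet> b"
    unfolding 2 .
qed

section \<open>Smooth inverse maps\<close>

lemma Ck_on_prod: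
  assumes "open S" "\<And>i. i \<in> I \<Longrightarrow> Ck_on k S (f i)"
  shows "Ck_on k S (\<lambda>x. \<Prod>i\<in>I. f i x :: real)"
  using assms(2)
  by (induction I rule: infinite_finite_induct)
    (simp_all add: Ck_on_bilinear[OF assms(1) bounded_bilinear_mult] Ck_on_const)

lemma Ck_on_det:
  fixes F :: "'a::real_normed_vector \<Rightarrow> real^'k^'k"
  assumes "open S" "\<And>i j. Ck_on k S (\<lambda>x. F x $ i $ j)"
  shows "Ck_on k S (\<lambda>x. det (F x))"
  unfolding det_def
  by (intro Ck_on_sum Ck_on_bilinear[OF _ bounded_bilinear_mult] Ck_on_prod Ck_on_const assms)

lemma Ck_on_vec:
  fixes f :: "'a::real_normed_vector \<Rightarrow> real^'k"
  assumes "open S" "\<And>i. Ck_on k S (\<lambda>x. f x $ i)"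
  shows "Ck_on k S f"
proof -
  have "Ck_on k S (\<lambda>x. \<Sum>i\<in>UNIV. (f x $ i) *\<^sub>R (axis i 1 :: real^'k))"
    by (intro Ck_on_sum Ck_on_bilinear[OF _ bounded_bilinear_scaleR] Ck_on_const assms)
  moreover have "(\<lambda>x. \<Sum>i\<in>UNIV. (f x $ i) *\<^sub>R (axis i 1 :: real^'k)) = f"
    by (rule ext, simp add: vec_eq_iff axis_def if_distrib cong: if_cong)
  ultimately show ?thesis by simp
qed

lemma bounded_linear_pd:
  "f differentiable (at x) \<Longrightarrow> bounded_linear (\<lambda>v. pd v f x)"
  using differentiable_has_pd has_derivative_bounded_linear by blast

text \<open>Cramer's rule writes the derivative of the inverse map as a rational expression in the derivative
  of the given map at the image point. Hence each order of smoothness of the inverse yields the next one.\<close>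

lemma smooth_on_inverse_map:
  fixes \<phi> :: "real^'k \<Rightarrow> real^'k"
  assumes U: "open U" and V: "open V" and \<phi>: "smooth_on U \<phi>" and hU: "\<And>y. y \<in> V \<Longrightarrow> h y \<in> U"
    and dh: "\<And>y. y \<in> V \<Longrightarrow> (h has_derivative inv (\<lambda>v. pd v \<phi> (h y))) (at y)"
    and bij: "\<And>y. y \<in> V \<Longrightarrow> bij (\<lambda>v. pd v \<phi> (h y))"
  shows "smooth_on V h"
proof -
  define J where "J y = matrix (\<lambda>v. pd v \<phi> (h y))" for y
  have lin: "linear (\<lambda>v. pd v \<phi> (h y))" if "y \<in> V" for y
    using bounded_linear_pd[OF smooth_on_differentiable[OF \<phi> hU[OF that]]] bounded_linear.linear by blast
  have det: "det (J y) \<noteq> 0" if "y \<in> V" for y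
    unfolding J_def using det_nz_iff_inj[OF lin[OF that]] bij[OF that] bij_is_inj by blast
  have eq: "pd v h y = (\<chi> k. det (\<chi> i j. if j = k then v $ i else J y $ i $ j) * inverse (det (J y)))"
    if "y \<in> V" for v y
  proof -
    have "pd (pd v h y) \<phi> (h y) = v"
      using pd_eq[OF dh[OF that]] bij[OF that] by (simp add: bij_is_surj surj_f_inv_f)
    then have "J y *v pd v h y = v"
      using lin[OF that] by (simp add: J_def matrix_works)
    then show ?thesis
      using cramer[OF det[OF that]] by (simp add: divide_inverse)
  qed
  have J_comp: "J y $ i $ j = pd (axis j 1) \<phi> (h y) $ i" for y i j
    by (simp add: J_def matrix_def)
  have "Ck_on k V h" for k
  proof (induction k)
    case 0
    show ?case
      using dh by (auto intro!: continuous_at_imp_continuous_on has_derivative_continuous)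
  next
    case (Suc k)
    have Jk: "Ck_on k V (\<lambda>y. J y $ i $ j)" for i j
      unfolding J_comp
      by (intro Ck_on_compose_linear[OF V bounded_linear_vec_nth] Ck_on_compose[OF V U hU _ Suc])
        (use smooth_on_pd[OF \<phi>] in \<open>auto simp: smooth_on_def\<close>)
    have detk: "Ck_on k V (\<lambda>y. inverse (det (J y)))"
      by (rule Ck_on_compose[OF V _ _ Ck_on_inverse Ck_on_det[OF V Jk]]) (use det in auto)
    have "Ck_on k V (\<lambda>y. if j = l then v $ i else J y $ i $ j)" for i j l and v :: "real^'k"
      using Jk by (cases "j = l") (auto intro: Ck_on_const)
    then have "Ck_on k V (\<lambda>y. \<chi> k. det (\<chi> i j. if j = k then v $ i else J y $ i $ j) * inverse (det (J y)))"
      for v :: "real^'k"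
      by (intro Ck_on_vec[OF V])
        (simp, intro Ck_on_bilinear[OF V bounded_bilinear_mult] detk Ck_on_det[OF V], simp)
    then have "Ck_on k V (pd v h)" for v
      by (rule Ck_on_cong[OF V, rotated]) (simp add: eq)
    then show ?case
      using dh by (auto simp: differentiable_def)
  qed
  then show ?thesis by (simp add: smooth_on_def)
qed

lemma smooth_inverse_function:
  fixes \<phi> :: "real^'k \<Rightarrow> real^'k"
  assumes "open U" "smooth_on U \<phi>" "x0 \<in> U" and inj: "\<And>v. pd v \<phi> x0 = 0 \<Longrightarrow> v = 0"
  obtains U' V' g where "open U'" "U' \<subseteq> U" "x0 \<in> U'" "open V'" "\<phi> x0 \<in> V'" "homeomorphism U' V' \<phi> g"
    "smooth_on V' g"
proof -
  define f' where "f' x = Blinfun (\<lambda>v. pd v \<phi> x)" for x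
  have f': "blinfun_apply (f' x) = (\<lambda>v. pd v \<phi> x)" if "x \<in> U" for x
    unfolding f'_def
    by (rule bounded_linear_Blinfun_apply[OF bounded_linear_pd[OF smooth_on_differentiable[OF assms(2) that]]])
  have der: "(\<phi> has_derivative blinfun_apply (f' x)) (at x)" if "x \<in> U" for x
    unfolding f'[OF that] by (rule differentiable_has_pd[OF smooth_on_differentiable[OF assms(2) that]])
  have cont: "continuous_on U f'"
  proof (rule continuous_on_blinfun_componentwise)
    fix i :: "real^'k"
    show "continuous_on U (\<lambda>x. blinfun_apply (f' x) i)"
      using smooth_on_continuous[OF smooth_on_pd[OF assms(2)], of i] f'
      by (auto cong: continuous_on_cong)
  qed
  have lin: "linear (\<lambda>v. pd v \<phi> x0)"
    using bounded_linear_pd[OF smooth_on_differentiable[OF assms(2,3)]] bounded_linear.linear by blast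
  have "inj (\<lambda>v. pd v \<phi> x0)" using linear_injective_0[OF lin] inj by blast
  then obtain l where l: "linear l" "\<And>v. l (pd v \<phi> x0) = v"
    using linear_injective_left_inverse[OF lin] by (metis comp_apply id_apply)
  have "Blinfun l o\<^sub>L f' x0 = id_blinfun"
    using l f'[OF assms(3)]
    by (intro blinfun_eqI) (simp add: bounded_linear_Blinfun_apply linear_conv_bounded_linear)
  from inverse_function_theorem[OF assms(1) der cont assms(3) this]
  obtain U' V g g' where *: "open U'" "U' \<subseteq> U" "x0 \<in> U'" "open V" "\<phi> x0 \<in> V" "homeomorphism U' V \<phi> g"
    "\<And>y. y \<in> V \<Longrightarrow> (g has_derivative (g' y)) (at y)"
    "\<And>y. y \<in> V \<Longrightarrow> g' y = inv (blinfun_apply (f'(g y)))"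
    "\<And>y. y \<in> V \<Longrightarrow> bij (blinfun_apply (f'(g y)))" by blast
  have gU: "g y \<in> U'" if "y \<in> V" for y
    using *(6) that by (auto simp: homeomorphism_def)
  have "smooth_on V g"
  proof (rule smooth_on_inverse_map[OF *(1) *(4)])
    show "smooth_on U' \<phi>" using assms(2) *(2) smooth_on_subset by blast
    show "g y \<in> U'" if "y \<in> V" for y using gU that .
    fix y assume y: "y \<in> V"
    have gy: "g y \<in> U" using gU[OF y] *(2) by blast
    show "(g has_derivative inv (\<lambda>v. pd v \<phi> (g y))) (at y)"
      using *(7,8)[OF y] f'[OF gy] by simp
    show "bij (\<lambda>v. pd v \<phi> (g y))" using *(9)[OF y] f'[OF gy] by simp
  qed
  with * show ?thesis using that by blast
qed

lemma vector_derivative_along_line: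
  assumes "f differentiable (at (x :: 'a::real_normed_vector))"
  shows "((\<lambda>t. f (x + t *\<^sub>R v)) has_vector_derivative pd v f x) (at 0)"
proof -
  have 1: "((\<lambda>t. x + t *\<^sub>R v) has_derivative (\<lambda>h. h *\<^sub>R v)) (at 0)"
    by (auto intro!: derivative_eq_intros)
  have d: "f differentiable (at (x + 0 *\<^sub>R v))" using assms by simp
  interpret bounded_linear "\<lambda>v. pd v f x" using bounded_linear_pd[OF assms] .
  show ?thesis
    using has_derivative_compose[OF 1 differentiable_has_pd[OF d]]
    by (simp add: has_vector_derivative_def scaleR)
qed

lemma pd_in_tangent_space:
  fixes \<sigma> :: "'a::euclidean_space \<Rightarrow> ('m::finite, 'n::finite) pseudo"
  assumes S: "open S" and \<sigma>: "smooth_on S \<sigma>" and M: "\<And>u. u \<in> S \<Longrightarrow> \<sigma> u \<in> M" and u: "u \<in> S"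
  shows "pd v \<sigma> u \<in> tangent_space M (\<sigma> u)"
proof -
  define c where "c = (\<lambda>t. u + t *\<^sub>R v)"
  have "open (c -` S)" unfolding c_def
    by (rule open_vimage[OF S]) (auto intro!: continuous_intros)
  moreover have "0 \<in> c -` S" using u by (simp add: c_def)
  ultimately obtain e where e: "e > 0" "ball 0 e \<subseteq> c -` S"
    using open_contains_ball by blast
  then have cS: "c t \<in> S" if "t \<in> {-e<..<e}" for t using that by (auto simp: subset_iff)
  have cs: "smooth_on {-e<..<e} c" unfolding c_def
    by (intro smooth_on_add smooth_on_const smooth_on_compose_linear[OF _ bounded_linear_scaleR_left] smooth_on_id)
      auto
  have "smooth_on {-e<..<e} (\<lambda>t. \<sigma> (c t))"
    by (rule smooth_on_compose[OF _ S cS \<sigma> cs]) auto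
  moreover have "((\<lambda>t. \<sigma> (c t)) has_vector_derivative pd v \<sigma> u) (at 0)"
    unfolding c_def by (rule vector_derivative_along_line[OF smooth_on_differentiable[OF \<sigma> u]])
  ultimately show ?thesis
    unfolding tangent_space_def curve_at_def using e(1) cS M
    by (intro CollectI exI[of _ "\<lambda>t. \<sigma> (c t)"]) (auto simp: c_def)
qed

section \<open>A closed space-like submanifold is an entire graph\<close>

locale spacelike_submanifold =
  fixes M :: "((real ^ 'm::finite) \<times> (real ^ 'n::finite)) set"
  assumes sub: "smooth_submanifold M" and sp: "spacelike M"
begin

lemma tangent_spacelike: "p \<in> M \<Longrightarrow> v \<in> tangent_space M p \<Longrightarrow> v \<noteq> 0 \<Longrightarrow> norm (snd v) < norm (fst v)"
  using sp unfolding spacelike_def pinner_def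
  by (metis diff_gt_0_iff_gt norm_lt)

text \<open>The projection to the positive factor, restricted to the submanifold, has injective differential
  because a nonzero space-like vector has a nonzero positive component. The inverse function theorem then
  straightens a chart into a graph.\<close>

lemma local_graph:
  assumes p: "p \<in> M"
  obtains W \<epsilon> f where "open W" "p \<in> W" "0 < \<epsilon>" "smooth_on (ball (fst p) \<epsilon>) f"
    "M \<inter> W = (\<lambda>x. (x, f x)) ` ball (fst p) \<epsilon>"
proof -
  obtain U V \<Phi> \<Psi> where ch: "open U" "p \<in> U" "open (V :: ('m, 'n) pseudo set)"
        "homeomorphism U V \<Phi> \<Psi>" "smooth_on U \<Phi>" "smooth_on V \<Psi>"
        "\<Phi> ` (M \<inter> U) = {z \<in> V. snd z = 0}"
    using sub p unfolding smooth_submanifold_def by meson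
  have \<Psi>\<Phi>: "\<Psi> (\<Phi> q) = q" "\<Phi> q \<in> V" if "q \<in> U" for q
    using ch(4) that unfolding homeomorphism_def by auto
  have \<Phi>\<Psi>: "\<Phi> (\<Psi> z) = z" "\<Psi> z \<in> U" if "z \<in> V" for z
    using ch(4) that unfolding homeomorphism_def by auto
  have slice: "\<Psi> z \<in> M" if "z \<in> V" "snd z = 0" for z
  proof -
    from that have "z \<in> \<Phi> ` (M \<inter> U)" using ch(7) by blast
    then show ?thesis using \<Psi>\<Phi> by auto
  qed
  have snd0: "snd (\<Phi> q) = 0" if "q \<in> M" "q \<in> U" for q
    using ch(7) that by blast
  define S where "S = (\<lambda>u. (u, 0)) -` V"
  have bl: "bounded_linear (\<lambda>u::real^'m. (u, 0::real^'n))"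
    by (intro bounded_linear_Pair bounded_linear_ident bounded_linear_zero)
  have S: "open S" unfolding S_def
    by (rule open_vimage[OF ch(3)]) (auto intro!: continuous_intros)
  define \<sigma> where "\<sigma> u = \<Psi> (u, 0)" for u
  have \<sigma>: "smooth_on S \<sigma>" unfolding \<sigma>_def
    by (rule smooth_on_compose[OF S ch(3) _ ch(6) smooth_on_compose_linear[OF S bl smooth_on_id]])
      (simp add: S_def)
  have \<sigma>M: "\<sigma> u \<in> M" if "u \<in> S" for u using slice that by (simp add: \<sigma>_def S_def)
  have \<sigma>_tan: "pd v \<sigma> u \<in> tangent_space M (\<sigma> u)" if "u \<in> S" for u v
    by (rule pd_in_tangent_space[OF S \<sigma> \<sigma>M that])
  have \<sigma>_inj: "pd v \<sigma> u \<noteq> 0" if u: "u \<in> S" and v: "v \<noteq> 0" for u v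
  proof -
    have d: "\<sigma> differentiable (at u)" using smooth_on_differentiable[OF \<sigma> u] .
    have d\<Phi>: "\<Phi> differentiable (at (\<sigma> u))"
      using smooth_on_differentiable[OF ch(5)] \<Phi>\<Psi>(2) u by (simp add: \<sigma>_def S_def)
    interpret bounded_linear "\<lambda>v. pd v \<Phi> (\<sigma> u)" using bounded_linear_pd[OF d\<Phi>] .
    have "((\<lambda>u. \<Phi> (\<sigma> u)) has_derivative (\<lambda>v. pd (pd v \<sigma> u) \<Phi> (\<sigma> u))) (at u)"
      using has_derivative_compose[OF differentiable_has_pd[OF d] differentiable_has_pd[OF d\<Phi>]] .
    then have "((\<lambda>u. (u, 0)) has_derivative (\<lambda>v. pd (pd v \<sigma> u) \<Phi> (\<sigma> u))) (at u)"
      by (rule has_derivative_transform_within_open[OF _ S u]) (simp add: \<sigma>_def S_def \<Phi>\<Psi>)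
    then have "(\<lambda>v. pd (pd v \<sigma> u) \<Phi> (\<sigma> u)) = (\<lambda>v. (v, 0))"
      using has_derivative_unique bounded_linear.has_derivative[OF bl has_derivative_ident] by blast
    then have "pd (pd v \<sigma> u) \<Phi> (\<sigma> u) = (v, 0)" by metis
    then show ?thesis using v zero by (auto simp: zero_prod_def)
  qed
  define \<phi> where "\<phi> u = fst (\<sigma> u)" for u
  have \<phi>: "smooth_on S \<phi>" unfolding \<phi>_def by (rule smooth_on_fst[OF S \<sigma>])
  define u0 where "u0 = fst (\<Phi> p)"
  have \<Phi>p: "\<Phi> p = (u0, 0)" using snd0[OF p ch(2)] by (simp add: u0_def prod_eq_iff)
  have u0: "u0 \<in> S" using \<Psi>\<Phi>(2)[OF ch(2)] \<Phi>p by (simp add: S_def)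
  have \<sigma>u0: "\<sigma> u0 = p" using \<Psi>\<Phi>(1)[OF ch(2)] \<Phi>p by (simp add: \<sigma>_def)
  have "v = 0" if "pd v \<phi> u0 = 0" for v
  proof (rule ccontr)
    assume "v \<noteq> 0"
    have "pd v \<phi> u0 = fst (pd v \<sigma> u0)"
      unfolding \<phi>_def by (rule pd_compose_linear[OF bounded_linear_fst smooth_on_differentiable[OF \<sigma> u0]])
    then show False
      using tangent_spacelike[OF \<sigma>M \<sigma>_tan \<sigma>_inj] that u0 \<open>v \<noteq> 0\<close> by fastforce
  qed
  from smooth_inverse_function[OF S \<phi> u0 this] obtain U' V' g where g: "open U'" "U' \<subseteq> S" "u0 \<in> U'"
    "open V'" "\<phi> u0 \<in> V'" "homeomorphism U' V' \<phi> g" "smooth_on V' g" by blast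
  have g': "g x \<in> U'" "\<phi> (g x) = x" if "x \<in> V'" for x
    using g(6) that by (auto simp: homeomorphism_def)
  have g'': "\<phi> u \<in> V'" "g (\<phi> u) = u" if "u \<in> U'" for u
    using g(6) that by (auto simp: homeomorphism_def)
  obtain \<epsilon> where \<epsilon>: "0 < \<epsilon>" "ball (fst p) \<epsilon> \<subseteq> V'"
    using g(4,5) \<sigma>u0 by (metis \<phi>_def open_contains_ball)
  define f where "f x = snd (\<sigma> (g x))" for x
  have f: "smooth_on (ball (fst p) \<epsilon>) f"
  proof (rule smooth_on_subset[OF _ \<epsilon>(2)])
    show "smooth_on V' f" unfolding f_def
      by (intro smooth_on_snd[OF g(4)] smooth_on_compose[OF g(4) S _ \<sigma> g(7)]) (use g' g(2) in blast)
  qed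
  define W where "W = (U \<inter> (\<lambda>q. fst (\<Phi> q)) -` U') \<inter> fst -` ball (fst p) \<epsilon>"
  have "continuous_on U (\<lambda>q. fst (\<Phi> q))"
    using ch(4) by (auto simp: homeomorphism_def intro!: continuous_intros)
  then have "open (U \<inter> (\<lambda>q. fst (\<Phi> q)) -` U')"
    by (rule continuous_open_preimage[OF _ ch(1) g(1)])
  then have W: "open W" unfolding W_def
    by (rule open_Int[OF _ open_vimage_fst[OF open_ball]])
  have pW: "p \<in> W" using ch(2) g(3) \<epsilon>(1) \<Phi>p by (simp add: W_def)
  have "M \<inter> W = (\<lambda>x. (x, f x)) ` ball (fst p) \<epsilon>"
  proof (intro equalityI subsetI)
    fix q assume "q \<in> M \<inter> W"
    then have q: "q \<in> M" "q \<in> U" "fst (\<Phi> q) \<in> U'" "fst q \<in> ball (fst p) \<epsilon>" by (auto simp: W_def)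
    have "\<Phi> q = (fst (\<Phi> q), 0)" using snd0[OF q(1,2)] by (simp add: prod_eq_iff)
    then have \<sigma>q: "\<sigma> (fst (\<Phi> q)) = q" using \<Psi>\<Phi>(1)[OF q(2)] by (simp add: \<sigma>_def)
    then have "g (fst q) = fst (\<Phi> q)" using g''(2)[OF q(3)] by (simp add: \<phi>_def)
    then have "q = (fst q, f (fst q))" using \<sigma>q by (simp add: f_def)
    then show "q \<in> (\<lambda>x. (x, f x)) ` ball (fst p) \<epsilon>" using q(4) by blast
  next
    fix q assume "q \<in> (\<lambda>x. (x, f x)) ` ball (fst p) \<epsilon>"
    then obtain x where x: "x \<in> ball (fst p) \<epsilon>" "q = (x, f x)" by blast
    then have xV: "x \<in> V'" using \<epsilon>(2) by blast
    have gS: "g x \<in> S" using g'[OF xV] g(2) by blast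
    have "q = \<sigma> (g x)" using x g'(2)[OF xV] by (simp add: f_def \<phi>_def prod_eq_iff)
    moreover have "\<sigma> (g x) \<in> U" "fst (\<Phi> (\<sigma> (g x))) = g x"
      using gS \<Phi>\<Psi> by (auto simp: \<sigma>_def S_def)
    moreover have "fst q \<in> ball (fst p) \<epsilon>" using x by simp
    ultimately show "q \<in> M \<inter> W" using \<sigma>M[OF gS] g'(1)[OF xV] by (simp add: W_def)
  qed
  then show ?thesis using that W pW \<epsilon>(1) f by blast
qed

text \<open>Lifts of the projection \<open>M \<rightarrow> \<real>\<^sup>m\<close>. Only continuity is asked for; smoothness follows from the local graphs.\<close>

definition sect :: "(real^'m) set \<Rightarrow> (real^'m \<Rightarrow> real^'n) \<Rightarrow> bool" where
  "sect B f \<longleftrightarrow> continuous_on B f \<and> (\<forall>x\<in>B. (x, f x) \<in> M)"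

lemma sect_subset: "sect B f \<Longrightarrow> A \<subseteq> B \<Longrightarrow> sect A f"
  unfolding sect_def using continuous_on_subset by blast

lemma sect_near:
  assumes B: "open B" and f: "sect B f" and x: "x \<in> B" and W: "open W" "(x, f x) \<in> W"
  obtains r where "0 < r" "ball x r \<subseteq> B" "\<And>y. y \<in> ball x r \<Longrightarrow> (y, f y) \<in> W"
proof -
  have "continuous_on B (\<lambda>y. (y, f y))"
    using f by (auto simp: sect_def intro!: continuous_intros)
  then have "open (B \<inter> (\<lambda>y. (y, f y)) -` W)"
    by (rule continuous_open_preimage[OF _ B W(1)])
  then obtain r where "0 < r" "ball x r \<subseteq> B \<inter> (\<lambda>y. (y, f y)) -` W"
    using x W(2) unfolding open_contains_ball by (meson IntI vimageI)
  then show ?thesis using that by blast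
qed

lemma sect_local_graph:
  assumes B: "open B" and f: "sect B f" and x: "x \<in> B"
    and W: "open W" "(x, f x) \<in> W" "M \<inter> W = (\<lambda>x. (x, h x)) ` D"
  obtains r where "0 < r" "ball x r \<subseteq> B" "ball x r \<subseteq> D" "\<forall>y\<in>ball x r. f y = h y"
proof -
  obtain r where r: "0 < r" "ball x r \<subseteq> B" "\<And>y. y \<in> ball x r \<Longrightarrow> (y, f y) \<in> W"
    using sect_near[OF B f x W(1,2)] by blast
  have "y \<in> D \<and> f y = h y" if "y \<in> ball x r" for y
  proof -
    have "(y, f y) \<in> M \<inter> W" using r that f by (auto simp: sect_def)
    then show ?thesis unfolding W(3) by auto
  qed
  then show ?thesis using that r by blast
qed

text \<open>The set where two lifts agree is relatively closed by continuity, and open because both lifts follow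
  the same local graph.\<close>

lemma sect_unique:
  assumes B: "open B" "connected B" and fg: "sect B f" "sect B g" and a: "a \<in> B" "f a = g a"
    and x: "x \<in> B"
  shows "f x = g x"
proof -
  define A where "A = {x \<in> B. f x = g x}"
  have "open A"
    unfolding open_contains_ball
  proof
    fix y assume y: "y \<in> A"
    then have yB: "y \<in> B" "f y = g y" by (auto simp: A_def)
    have "(y, f y) \<in> M" using fg yB by (auto simp: sect_def)
    from local_graph[OF this] obtain W \<epsilon> h where W: "open W" "(y, f y) \<in> W"
      "M \<inter> W = (\<lambda>x. (x, h x)) ` ball y \<epsilon>" by (metis fst_conv)
    obtain r where r: "0 < r" "ball y r \<subseteq> B" "ball y r \<subseteq> ball y \<epsilon>"
        "\<forall>z\<in>ball y r. f z = h z"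
      by (rule sect_local_graph[OF B(1) fg(1) yB(1) W])
    have W2: "(y, g y) \<in> W" using W(2) yB by simp
    obtain r' where r': "0 < r'" "ball y r' \<subseteq> B" "ball y r' \<subseteq> ball y \<epsilon>"
        "\<forall>z\<in>ball y r'. g z = h z"
      by (rule sect_local_graph[OF B(1) fg(2) yB(1) W(1) W2 W(3)])
    have "ball y (min r r') \<subseteq> A"
    proof
      fix z assume "z \<in> ball y (min r r')"
      then have z: "z \<in> ball y r" "z \<in> ball y r'" by auto
      have "f z = g z" using bspec[OF r(4) z(1)] bspec[OF r'(4) z(2)] by simp
      then show "z \<in> A" using r(2) z(1) by (auto simp: A_def)
    qed
    then show "\<exists>e>0. ball y e \<subseteq> A" using r(1) r'(1) by (meson min_less_iff_conj)
  qed
  then have "openin (top_of_set B) A" by (rule open_subset[rotated]) (simp add: A_def)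
  moreover have "closedin (top_of_set B) A"
  proof -
    have "continuous_on B (\<lambda>x. f x - g x)" using fg by (auto simp: sect_def intro!: continuous_intros)
    from continuous_closedin_preimage_constant[OF this, of 0] show ?thesis by (simp add: A_def)
  qed
  ultimately have "A = {} \<or> A = B" using B(2) connected_clopen by blast
  then show ?thesis using a x by (auto simp: A_def)
qed

lemma sect_smooth:
  assumes B: "open B" and f: "sect B f"
  shows "smooth_on B f"
proof -
  have "\<exists>T. open T \<and> x \<in> T \<and> smooth_on T f" if x: "x \<in> B" for x
  proof -
    have "(x, f x) \<in> M" using f x by (auto simp: sect_def)
    from local_graph[OF this] obtain W \<epsilon> h where W: "open W" "(x, f x) \<in> W"
      "M \<inter> W = (\<lambda>x. (x, h x)) ` ball x \<epsilon>" "smooth_on (ball x \<epsilon>) h" by (metis fst_conv)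
    obtain r where r: "0 < r" "ball x r \<subseteq> B" "ball x r \<subseteq> ball x \<epsilon>"
        "\<forall>z\<in>ball x r. f z = h z"
      by (rule sect_local_graph[OF B f x W(1-3)])
    have "smooth_on (ball x r) f"
      by (rule smooth_on_cong[OF _ _ smooth_on_subset[OF W(4) r(3)]]) (use r(4) in auto)
    then show ?thesis using r(1) by (meson centre_in_ball open_ball)
  qed
  then show ?thesis unfolding smooth_on_def by (intro allI Ck_on_local) blast
qed

lemma sect_tangent:
  assumes B: "open B" and f: "sect B f" and x: "x \<in> B"
  shows "(v, pd v f x) \<in> tangent_space M (x, f x)"
proof -
  have "((\<lambda>x. (x, f x)) has_derivative (\<lambda>v. (v, pd v f x))) (at x)"
    by (intro has_derivative_Pair has_derivative_ident differentiable_has_pd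
        smooth_on_differentiable[OF sect_smooth[OF B f] x])
  moreover have "pd v (\<lambda>x. (x, f x)) x \<in> tangent_space M (x, f x)"
    by (rule pd_in_tangent_space[OF B smooth_on_Pair[OF B smooth_on_id sect_smooth[OF B f]] _ x])
      (use f in \<open>simp add: sect_def\<close>)
  ultimately show ?thesis by (simp add: pd_eq)
qed

lemma sect_pd_less:
  assumes B: "open B" and f: "sect B f" and x: "x \<in> B" and "v \<noteq> 0"
  shows "norm (pd v f x) < norm v"
  using tangent_spacelike[OF _ sect_tangent[OF assms(1-3)], of v] f x \<open>v \<noteq> 0\<close>
  by (auto simp: sect_def zero_prod_def)

text \<open>Space-likeness bounds the slope by one. This is what keeps a lift over a bounded ball within a compact
  part of the submanifold.\<close>

lemma sect_Lipschitz:
  assumes B: "open B" "convex B" and f: "sect B f" and xy: "x \<in> B" "y \<in> B"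
  shows "norm (f x - f y) \<le> norm (x - y)"
proof -
  have "norm (f x - f y) \<le> 1 * norm (x - y)"
  proof (rule differentiable_bound[OF B(2) _ _ xy])
    fix z assume z: "z \<in> B"
    have d: "f differentiable (at z)" using smooth_on_differentiable[OF sect_smooth[OF B(1) f] z] .
    show "(f has_derivative (\<lambda>v. pd v f z)) (at z within B)"
      using differentiable_has_pd[OF d] has_derivative_at_withinI by blast
    show "onorm (\<lambda>v. pd v f z) \<le> 1"
    proof (rule onorm_le)
      fix v
      show "norm (pd v f z) \<le> 1 * norm v"
        using sect_pd_less[OF B(1) f z, of v] linear_0[OF bounded_linear.linear[OF bounded_linear_pd[OF d]]]
        by (cases "v = 0") auto
    qed
  qed
  then show ?thesis by simp
qed

text \<open>A local graph around a point provides lifts through all nearby points over balls of half the radius;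
  finitely many such neighbourhoods suffice.\<close>

lemma uniform_sect_radius:
  assumes K: "compact K" "K \<subseteq> M"
  obtains \<epsilon> where "0 < \<epsilon>" "\<And>p. p \<in> K \<Longrightarrow> \<exists>s. sect (ball (fst p) \<epsilon>) s \<and> s (fst p) = snd p"
proof -
  have "\<exists>\<delta>>0. \<forall>q \<in> M \<inter> ball p \<delta>. \<exists>s. sect (ball (fst q) \<delta>) s \<and> s (fst q) = snd q"
    if p: "p \<in> K" for p
  proof -
    obtain W \<epsilon> f where W: "open W" "p \<in> W" "0 < \<epsilon>" "smooth_on (ball (fst p) \<epsilon>) f"
      "M \<inter> W = (\<lambda>x. (x, f x)) ` ball (fst p) \<epsilon>"
      by (rule local_graph[OF subsetD[OF K(2) p]])
    have f: "sect (ball (fst p) \<epsilon>) f"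
      using smooth_on_continuous[OF W(4)] W(5) by (auto simp: sect_def)
    obtain \<delta>0 where \<delta>0: "0 < \<delta>0" "ball p \<delta>0 \<subseteq> W" using W open_contains_ball by blast
    define \<delta> where "\<delta> = min \<delta>0 (\<epsilon> / 2)"
    have "\<exists>s. sect (ball (fst q) \<delta>) s \<and> s (fst q) = snd q" if q: "q \<in> M \<inter> ball p \<delta>" for q
    proof (intro exI conjI)
      have "q \<in> M \<inter> W" using q \<delta>0 by (auto simp: \<delta>_def)
      then show "f (fst q) = snd q" unfolding W(5) by auto
      have "dist (fst p) (fst q) \<le> dist p q" by (metis dist_fst_le)
      then have d: "dist (fst p) (fst q) < \<epsilon> / 2" using q by (auto simp: \<delta>_def)
      have "ball (fst q) \<delta> \<subseteq> ball (fst p) \<epsilon>"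
      proof
        fix y assume "y \<in> ball (fst q) \<delta>"
        then have "dist (fst q) y < \<epsilon> / 2" by (simp add: \<delta>_def)
        then show "y \<in> ball (fst p) \<epsilon>"
          using d dist_triangle[of "fst p" y "fst q"] by simp
      qed
      then show "sect (ball (fst q) \<delta>) f" using sect_subset[OF f] by blast
    qed
    moreover have "\<delta> > 0" using \<delta>0 W(3) by (simp add: \<delta>_def)
    ultimately show ?thesis by blast
  qed
  then obtain \<delta> where \<delta>: "\<And>p. p \<in> K \<Longrightarrow> \<delta> p > 0"
    "\<And>p q. p \<in> K \<Longrightarrow> q \<in> M \<inter> ball p (\<delta> p) \<Longrightarrow> \<exists>s. sect (ball (fst q) (\<delta> p)) s \<and> s (fst q) = snd q"
    by metis
  have "K \<subseteq> (\<Union>p\<in>K. ball p (\<delta> p))" using \<delta>(1) by auto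
  then obtain C where C: "C \<subseteq> K" "finite C" "K \<subseteq> (\<Union>p\<in>C. ball p (\<delta> p))"
    using compactE_image[OF K(1), of K "\<lambda>p. ball p (\<delta> p)"] by auto
  define \<epsilon> where "\<epsilon> = Min (insert 1 (\<delta> ` C))"
  have "\<epsilon> > 0" unfolding \<epsilon>_def using C \<delta>(1) by (subst Min_gr_iff) auto
  moreover have "\<exists>s. sect (ball (fst q) \<epsilon>) s \<and> s (fst q) = snd q" if q: "q \<in> K" for q
  proof -
    obtain p where p: "p \<in> C" "q \<in> ball p (\<delta> p)" using C(3) q by blast
    then obtain s where s: "sect (ball (fst q) (\<delta> p)) s" "s (fst q) = snd q"
      using \<delta>(2)[of p q] C(1) q K(2) by blast
    have "\<epsilon> \<le> \<delta> p" unfolding \<epsilon>_def using C(2) p(1) by (intro Min_le) auto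
    then have "ball (fst q) \<epsilon> \<subseteq> ball (fst q) (\<delta> p)" by auto
    then show ?thesis using s sect_subset by blast
  qed
  ultimately show ?thesis using that by blast
qed

text \<open>The local lifts \<open>S \<xi>\<close> fit together: if the balls around \<open>\<xi>\<close> and \<open>\<xi>\<^sub>1\<close> meet, then the midpoint of the two
  centres lies in both balls and in the original ball, where both lifts agree with \<open>f\<close>.\<close>

lemma sect_extend:
  assumes R: "0 < R" and f: "sect (ball x0 R) f" and e: "0 < \<epsilon>"
    and loc: "\<And>\<xi>. \<xi> \<in> ball x0 R \<Longrightarrow> \<exists>s. sect (ball \<xi> \<epsilon>) s \<and> s \<xi> = f \<xi>"
  shows "\<exists>g. sect (ball x0 (R + \<epsilon>)) g \<and> g x0 = f x0"
proof -
  from loc obtain S where S: "\<And>\<xi>. \<xi> \<in> ball x0 R \<Longrightarrow> sect (ball \<xi> \<epsilon>) (S \<xi>)"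
    "\<And>\<xi>. \<xi> \<in> ball x0 R \<Longrightarrow> S \<xi> \<xi> = f \<xi>" by metis
  have Sf: "S \<xi> y = f y" if "\<xi> \<in> ball x0 R" "y \<in> ball \<xi> \<epsilon>" "y \<in> ball x0 R" for \<xi> y
  proof (rule sect_unique[of "ball \<xi> \<epsilon> \<inter> ball x0 R" _ _ \<xi>])
    show "connected (ball \<xi> \<epsilon> \<inter> ball x0 R)"
      by (intro convex_connected convex_Int convex_ball)
    show "sect (ball \<xi> \<epsilon> \<inter> ball x0 R) (S \<xi>)" by (rule sect_subset[OF S(1)[OF that(1)]]) simp
    show "sect (ball \<xi> \<epsilon> \<inter> ball x0 R) f" by (rule sect_subset[OF f]) simp
  qed (use that e S(2) in auto)
  have agree: "S \<xi> y = S \<xi>' y"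
    if x: "\<xi> \<in> ball x0 R" "\<xi>' \<in> ball x0 R" and y: "y \<in> ball \<xi> \<epsilon>" "y \<in> ball \<xi>' \<epsilon>" for \<xi> \<xi>' y
  proof -
    \<comment> \<open>The midpoint is within half the distance of the centres, which is less than \<open>\<epsilon>\<close>.\<close>
    define m where "m = midpoint \<xi> \<xi>'"
    have "dist \<xi> \<xi>' < 2 * \<epsilon>" using y dist_triangle2[of \<xi> \<xi>' y] by (simp add: dist_commute)
    then have mb: "m \<in> ball \<xi> \<epsilon>" "m \<in> ball \<xi>' \<epsilon>"
      unfolding m_def by (auto simp: dist_midpoint)
    have "m \<in> closed_segment \<xi> \<xi>'" unfolding m_def by (rule midpoint_in_closed_segment)
    then have mR: "m \<in> ball x0 R" using closed_segment_subset[OF x convex_ball] by blast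
    show ?thesis
    proof (rule sect_unique[of "ball \<xi> \<epsilon> \<inter> ball \<xi>' \<epsilon>" _ _ m])
      show "connected (ball \<xi> \<epsilon> \<inter> ball \<xi>' \<epsilon>)"
        by (intro convex_connected convex_Int convex_ball)
      show "sect (ball \<xi> \<epsilon> \<inter> ball \<xi>' \<epsilon>) (S \<xi>)" by (rule sect_subset[OF S(1)[OF x(1)]]) simp
      show "sect (ball \<xi> \<epsilon> \<inter> ball \<xi>' \<epsilon>) (S \<xi>')" by (rule sect_subset[OF S(1)[OF x(2)]]) simp
      show "S \<xi> m = S \<xi>' m" using Sf[OF x(1) mb(1) mR] Sf[OF x(2) mb(2) mR] by simp
    qed (use y mb in auto)
  qed
  define P where "P y = (SOME \<xi>. \<xi> \<in> ball x0 R \<and> y \<in> ball \<xi> \<epsilon>)" for y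
  define g where "g y = S (P y) y" for y
  have gS: "g y = S \<xi> y" if "\<xi> \<in> ball x0 R" "y \<in> ball \<xi> \<epsilon>" for \<xi> y
  proof -
    have "P y \<in> ball x0 R \<and> y \<in> ball (P y) \<epsilon>"
      unfolding P_def by (rule someI[of _ \<xi>]) (use that in auto)
    then show ?thesis unfolding g_def using agree that by blast
  qed
  have cover: "\<exists>\<xi> \<in> ball x0 R. y \<in> ball \<xi> \<epsilon>" if y: "y \<in> ball x0 (R + \<epsilon>)" for y
  proof -
    \<comment> \<open>Shrinking towards \<open>x0\<close> by this factor splits the distance in the proportion \<open>R : \<epsilon>\<close>.\<close>
    define t where "t = R / (R + \<epsilon>)"
    have t: "0 < t" "1 - t = \<epsilon> / (R + \<epsilon>)" "0 < 1 - t" using R e by (auto simp: t_def field_simps)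
    define \<xi> where "\<xi> = x0 + t *\<^sub>R (y - x0)"
    have n: "norm (y - x0) < R + \<epsilon>" using y by (simp add: dist_norm norm_minus_commute)
    have "dist x0 \<xi> = t * norm (y - x0)" using t by (simp add: \<xi>_def dist_norm)
    also have "\<dots> < t * (R + \<epsilon>)" using n t by simp
    also have "\<dots> = R" using R e by (simp add: t_def)
    finally have 1: "\<xi> \<in> ball x0 R" by simp
    have "y - \<xi> = (1 - t) *\<^sub>R (y - x0)" by (simp add: \<xi>_def algebra_simps)
    then have "dist \<xi> y = (1 - t) * norm (y - x0)" using t(3) by (metis abs_of_pos dist_norm dist_commute norm_scaleR)
    also have "\<dots> < (1 - t) * (R + \<epsilon>)" using n t(3) by simp
    also have "\<dots> = \<epsilon>" unfolding t(2) using R e by simp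
    finally show ?thesis using 1 by auto
  qed
  have "sect (ball x0 (R + \<epsilon>)) g"
    unfolding sect_def
  proof (intro conjI ballI continuous_at_imp_continuous_on)
    fix y assume y: "y \<in> ball x0 (R + \<epsilon>)"
    obtain \<xi> where \<xi>: "\<xi> \<in> ball x0 R" "y \<in> ball \<xi> \<epsilon>" using cover[OF y] by blast
    have "continuous_on (ball \<xi> \<epsilon>) (S \<xi>)" using S(1)[OF \<xi>(1)] by (simp add: sect_def)
    then have "continuous_on (ball \<xi> \<epsilon>) g" using gS[OF \<xi>(1)] by (metis continuous_on_cong)
    then show "isCont g y" using \<xi>(2) by (simp add: continuous_on_eq_continuous_at)
    show "(y, g y) \<in> M" using gS[OF \<xi>] S(1)[OF \<xi>(1)] \<xi>(2) by (simp add: sect_def)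
  qed
  moreover have "g x0 = f x0" using gS[of x0 x0] S(2)[of x0] R e by simp
  ultimately show ?thesis by blast
qed

text \<open>At a finite supremum of the admissible radii, the lifts stay in a compact part of the closed
  submanifold, so that they can be continued by a uniform amount.\<close>

lemma sect_on_ball:
  assumes M: "closed M" and p: "p \<in> M" and R: "0 < R"
  shows "\<exists>s. sect (ball (fst p) R) s \<and> s (fst p) = snd p"
proof (rule ccontr)
  define A where "A = {R. 0 < R \<and> (\<exists>s. sect (ball (fst p) R) s \<and> s (fst p) = snd p)}"
  assume "\<not> ?thesis"
  then have R_notin: "R \<notin> A" by (simp add: A_def)
  have down: "r \<in> A" if "r' \<in> A" "0 < r" "r \<le> r'" for r r'
  proof -
    have "ball (fst p) r \<subseteq> ball (fst p) r'" using that by auto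
    then show ?thesis using that sect_subset unfolding A_def by blast
  qed
  have le: "r \<le> R" if "r \<in> A" for r using down[OF that R] R_notin by fastforce
  have p_sing: "compact {p}" "{p} \<subseteq> M" using p by auto
  obtain r0 where "0 < r0" "\<And>q. q \<in> {p} \<Longrightarrow> \<exists>s. sect (ball (fst q) r0) s \<and> s (fst q) = snd q"
    using uniform_sect_radius[OF p_sing] by metis
  then have r0: "r0 \<in> A" by (simp add: A_def)
  define L where "L = Sup A"
  have bdd: "bdd_above A" using le by (auto simp: bdd_above_def)
  have rL: "r \<le> L" if "r \<in> A" for r unfolding L_def by (rule cSup_upper[OF that bdd])
  define K where "K = M \<inter> (cball (fst p) L \<times> cball (snd p) L)"
  have "compact K" unfolding K_def
    by (intro closed_Int_compact M compact_Times compact_cball)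
  then obtain \<epsilon> where \<epsilon>: "0 < \<epsilon>" "\<And>p. p \<in> K \<Longrightarrow> \<exists>s. sect (ball (fst p) \<epsilon>) s \<and> s (fst p) = snd p"
    using uniform_sect_radius[of K] by (auto simp: K_def)
  obtain r where r: "r \<in> A" "L - \<epsilon> < r"
    using less_cSupE[of "L - \<epsilon>" A] r0 \<epsilon>(1) by (auto simp: L_def)
  then obtain f where f: "0 < r" "sect (ball (fst p) r) f" "f (fst p) = snd p" by (auto simp: A_def)
  have "\<exists>s. sect (ball \<xi> \<epsilon>) s \<and> s \<xi> = f \<xi>" if \<xi>: "\<xi> \<in> ball (fst p) r" for \<xi>
  proof -
    have "norm (f \<xi> - f (fst p)) \<le> norm (\<xi> - fst p)"
      by (rule sect_Lipschitz[OF _ _ f(2) \<xi>]) (use f(1) in auto)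
    then have "(\<xi>, f \<xi>) \<in> K"
      using \<xi> f rL[OF r(1)] by (auto simp: K_def sect_def dist_norm norm_minus_commute)
    from \<epsilon>(2)[OF this] show ?thesis by simp
  qed
  from sect_extend[OF f(1,2) \<epsilon>(1) this] have "r + \<epsilon> \<in> A"
    using f(1,3) \<epsilon>(1) by (auto simp: A_def)
  then show False using rL r(2) by fastforce
qed

lemma sect_global:
  assumes M: "closed M" and p: "p \<in> M"
  shows "\<exists>f. sect UNIV f \<and> f (fst p) = snd p"
proof -
  let ?x0 = "fst p"
  from sect_on_ball[OF M p] obtain S where S: "\<And>R. 0 < R \<Longrightarrow> sect (ball ?x0 R) (S R)"
    "\<And>R. 0 < R \<Longrightarrow> S R ?x0 = snd p" by metis
  have agree: "S R x = S R' x" if "x \<in> ball ?x0 R" "x \<in> ball ?x0 R'" for R R' x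
  proof (rule sect_unique[of "ball ?x0 (min R R')" _ _ ?x0])
    have R: "0 < R" "0 < R'" using that by (auto intro: le_less_trans[OF zero_le_dist])
    show "sect (ball ?x0 (min R R')) (S R)" by (rule sect_subset[OF S(1)[OF R(1)]]) auto
    show "sect (ball ?x0 (min R R')) (S R')" by (rule sect_subset[OF S(1)[OF R(2)]]) auto
    show "S R ?x0 = S R' ?x0" using S(2) R by simp
    show "?x0 \<in> ball ?x0 (min R R')" using R by simp
  qed (use that in auto)
  define f where "f x = S (dist ?x0 x + 1) x" for x
  have fS: "f x = S R x" if "x \<in> ball ?x0 R" for x R
    unfolding f_def by (rule agree) (use that in auto)
  have "sect UNIV f"
    unfolding sect_def
  proof (intro conjI ballI continuous_at_imp_continuous_on)
    fix x
    define R where "R = dist ?x0 x + 1"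
    have R: "0 < R" "x \<in> ball ?x0 R" by (auto simp: R_def add_nonneg_pos)
    have "continuous_on (ball ?x0 R) (S R)" using S(1)[OF R(1)] by (simp add: sect_def)
    then have "continuous_on (ball ?x0 R) f" using fS by (metis continuous_on_cong)
    then show "isCont f x" using R(2) by (simp add: continuous_on_eq_continuous_at)
    show "(x, f x) \<in> M" using fS[OF R(2)] S(1)[OF R(1)] R(2) by (simp add: sect_def)
  qed
  moreover have "f ?x0 = snd p" using fS[of ?x0 1] S(2)[of 1] by simp
  ultimately show ?thesis by blast
qed

text \<open>A global lift traces out a relatively open and closed part of the submanifold.\<close>

theorem global_graph:
  assumes M: "closed M" "connected M" "M \<noteq> {}"
  obtains f where "smooth_on UNIV f" "M = range (\<lambda>x. (x, f x))"
    "\<And>x v. v \<noteq> 0 \<Longrightarrow> norm (pd v f x) < norm v"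
proof -
  obtain p where p: "p \<in> M" using M by blast
  obtain f where f: "sect UNIV f" "f (fst p) = snd p" using sect_global[OF M(1) p] by blast
  define G where "G = range (\<lambda>x. (x, f x))"
  have GM: "G \<subseteq> M" using f by (auto simp: G_def sect_def)
  have "openin (top_of_set M) G"
    unfolding openin_subopen[of _ G]
  proof
    fix q assume q: "q \<in> G"
    then obtain x where x: "q = (x, f x)" by (auto simp: G_def)
    obtain W \<epsilon> h where W: "open W" "q \<in> W" "0 < \<epsilon>" "smooth_on (ball x \<epsilon>) h"
      "M \<inter> W = (\<lambda>x. (x, h x)) ` ball x \<epsilon>" using local_graph[of q] q GM x by (metis fst_conv subsetD)
    have h: "sect (ball x \<epsilon>) h" using smooth_on_continuous[OF W(4)] W(5) by (auto simp: sect_def)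
    have "q \<in> M \<inter> W" using q GM W by blast
    then have hx: "h x = f x" unfolding W(5) x by auto
    have "h y = f y" if "y \<in> ball x \<epsilon>" for y
      by (rule sect_unique[OF _ _ h sect_subset[OF f(1)] _ hx that]) (use W(3) in auto)
    then have "M \<inter> W \<subseteq> G" unfolding W(5) G_def by auto
    then show "\<exists>T. openin (top_of_set M) T \<and> q \<in> T \<and> T \<subseteq> G"
      using W(1,2) q GM by (intro exI[of _ "M \<inter> W"]) (auto simp: openin_open)
  qed
  moreover have "closedin (top_of_set M) G"
  proof -
    have c: "continuous_on UNIV f" using f(1) by (simp add: sect_def)
    have "closed {q. snd q = f (fst q)}"
      by (intro closed_Collect_eq continuous_intros continuous_on_compose2[OF c]) auto
    moreover have "G = {q. snd q = f (fst q)}" by (force simp: G_def)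
    ultimately show ?thesis using GM by (metis closed_subset)
  qed
  moreover have "G \<noteq> {}" by (simp add: G_def)
  ultimately have "M = G" using M(2) connected_clopen by metis
  then show ?thesis
    using that[of f] sect_smooth[OF open_UNIV f(1)] sect_pd_less[OF open_UNIV f(1)] G_def by blast
qed

end

section \<open>Positive forms and the ambient inner product\<close>

lemma bounded_bilinear_pinner: "bounded_bilinear (pinner :: ('m::finite, 'n::finite) pseudo \<Rightarrow> _)"
  unfolding bilinear_conv_bounded_bilinear[symmetric] bilinear_def
  by (auto intro!: linearI simp: pinner_def inner_simps algebra_simps)

interpretation pinner: bounded_bilinear "pinner :: ('m::finite, 'n::finite) pseudo \<Rightarrow> _"
  by (rule bounded_bilinear_pinner)

lemma pinner_commute: "pinner u v = pinner v u"
  by (simp add: pinner_def inner_commute)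

lemmas pinner_simps = pinner.add_left pinner.add_right pinner.diff_left pinner.diff_right
  pinner.scaleR_left pinner.scaleR_right pinner.zero_left pinner.zero_right
  pinner.minus_left pinner.minus_right pinner.sum_left pinner.sum_right

text \<open>The Cauchy-Schwarz inequality for a semidefinite form, read off from the values on a line \<open>u - t v\<close>; the case
  \<open>c = 0\<close> is that of a null vector \<open>v\<close>.\<close>

lemma discriminant_bound:
  fixes a \<beta> c :: real
  assumes "\<And>t. 0 \<le> a - 2 * \<beta> * t + c * t\<^sup>2"
  shows "\<beta>\<^sup>2 \<le> a * c"
proof (cases "c = 0")
  case True
  have "\<beta> = 0"
  proof (rule ccontr)
    assume "\<beta> \<noteq> 0"
    then show False using assms[of "(a + 1) / (2 * \<beta>)"] True by simp
  qed
  then show ?thesis using True by simp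
next
  case False
  have "c > 0"
  proof (rule ccontr)
    assume "\<not> c > 0"
    then have c: "c < 0" using False by simp
    have a: "0 \<le> a" using assms[of 0] by simp
    \<comment> \<open>At \<open>\<plusminus> T\<close> the even part of the quadratic equals \<open>-1\<close>, and one of the two signs makes the odd part nonpositive.\<close>
    define T where "T = sqrt ((a + 1) / (- c))"
    have T: "c * T\<^sup>2 = - (a + 1)" using c a by (simp add: T_def field_simps)
    have "0 \<le> a - 2 * \<beta> * T + c * T\<^sup>2" "0 \<le> a - 2 * \<beta> * (- T) + c * (- T)\<^sup>2"
      by (rule assms)+
    then show False using T by simp
  qed
  moreover have "0 \<le> a - 2 * \<beta> * (\<beta> / c) + c * (\<beta> / c)\<^sup>2" by (rule assms)
  ultimately show ?thesis by (simp add: field_simps power2_eq_square)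
qed

locale positive_form =
  fixes g :: "real^'m::finite \<Rightarrow> real^'m \<Rightarrow> real"
  assumes bil: "bounded_bilinear g" and sym: "g u v = g v u" and pos: "v \<noteq> 0 \<Longrightarrow> 0 < g v v"
begin

sublocale bounded_bilinear g by (rule bil)

lemmas g_simps = add_left add_right diff_left diff_right scaleR_left scaleR_right zero_left zero_right
  minus_left minus_right sum_left sum_right

definition orthonormal :: "('m \<Rightarrow> real^'m) \<Rightarrow> bool" where
  "orthonormal e \<longleftrightarrow> (\<forall>i j. g (e i) (e j) = (if i = j then 1 else 0))"

lemma nonneg: "0 \<le> g v v"
  using pos[of v] by (cases "v = 0") (auto simp: zero_left)

lemma orthonormal_comb:
  assumes "orthonormal e"
  shows "g (\<Sum>i\<in>UNIV. c i *\<^sub>R e i) (e j) = c j"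
proof -
  have "g (\<Sum>i\<in>UNIV. c i *\<^sub>R e i) (e j) = (\<Sum>i\<in>UNIV. c i * g (e i) (e j))"
    by (simp add: g_simps)
  also have "\<dots> = (\<Sum>i\<in>UNIV. if i = j then c j else 0)"
    using assms by (intro sum.cong) (auto simp: orthonormal_def)
  finally show ?thesis by simp
qed

text \<open>Orthonormality makes the map from coefficients to linear combinations injective, hence surjective by
  equality of dimensions.\<close>

lemma orthonormal_expand:
  assumes e: "orthonormal e"
  shows "v = (\<Sum>i\<in>UNIV. g v (e i) *\<^sub>R e i)"
proof -
  define A where "A c = (\<Sum>i\<in>UNIV. (c $ i) *\<^sub>R e i)" for c :: "real^'m"
  have lin: "linear A"
    by (rule linearI) (simp_all add: A_def scaleR_add_left sum.distrib scaleR_sum_right)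
  have "c = 0" if "A c = 0" for c
  proof -
    have "c $ j = 0" for j
      using orthonormal_comb[OF e, of "\<lambda>i. c $ i" j, folded A_def] that by (simp add: zero_left)
    then show ?thesis by (simp add: vec_eq_iff)
  qed
  then have "inj A" using linear_injective_0[OF lin] by blast
  then have "surj A" using linear_injective_imp_surjective lin by blast
  then obtain c where c: "v = A c" by (meson surjD)
  then have "g v (e j) = c $ j" for j
    using orthonormal_comb[OF e, of "\<lambda>i. c $ i" j] by (simp add: A_def)
  then show ?thesis using c by (simp add: A_def)
qed

lemma parseval:
  assumes e: "orthonormal e"
  shows "g u v = (\<Sum>i\<in>UNIV. g u (e i) * g v (e i))"
proof -
  have "g u v = g u (\<Sum>i\<in>UNIV. g v (e i) *\<^sub>R e i)" using orthonormal_expand[OF e, of v] by simp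
  then show ?thesis by (simp add: g_simps mult.commute)
qed

lemma cauchy_schwarz: "(g u v)\<^sup>2 \<le> g u u * g v v"
proof (rule discriminant_bound)
  fix t
  have "0 \<le> g (u - t *\<^sub>R v) (u - t *\<^sub>R v)" by (rule nonneg)
  then show "0 \<le> g u u - 2 * g u v * t + g v v * t\<^sup>2"
    using sym[of u v] by (simp add: g_simps power2_eq_square algebra_simps)
qed

lemma trace_independent:
  fixes Q :: "real^'m \<Rightarrow> real^'m \<Rightarrow> 'b::real_normed_vector"
  assumes Q: "bounded_bilinear Q" and e: "orthonormal e" and a: "orthonormal a"
  shows "(\<Sum>i\<in>UNIV. Q (a i) (a i)) = (\<Sum>i\<in>UNIV. Q (e i) (e i))"
proof -
  interpret Q: bounded_bilinear Q by (rule Q)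
  have "Q (a i) (a i) = (\<Sum>j\<in>UNIV. \<Sum>k\<in>UNIV. (g (a i) (e j) * g (a i) (e k)) *\<^sub>R Q (e j) (e k))" for i
  proof -
    have "Q (a i) (a i) = Q (\<Sum>j\<in>UNIV. g (a i) (e j) *\<^sub>R e j) (\<Sum>k\<in>UNIV. g (a i) (e k) *\<^sub>R e k)"
      using orthonormal_expand[OF e, of "a i"] by simp
    also have "\<dots> = (\<Sum>j\<in>UNIV. \<Sum>k\<in>UNIV. (g (a i) (e j) * g (a i) (e k)) *\<^sub>R Q (e j) (e k))"
      by (subst sum.swap) (simp add: Q.sum_left Q.sum_right Q.scaleR_left Q.scaleR_right scaleR_sum_right mult.commute)
    finally show ?thesis .
  qed
  then have "(\<Sum>i\<in>UNIV. Q (a i) (a i))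
      = (\<Sum>i\<in>UNIV. \<Sum>j\<in>UNIV. \<Sum>k\<in>UNIV. (g (a i) (e j) * g (a i) (e k)) *\<^sub>R Q (e j) (e k))"
    by simp
  also have "\<dots> = (\<Sum>j\<in>UNIV. \<Sum>i\<in>UNIV. \<Sum>k\<in>UNIV. (g (a i) (e j) * g (a i) (e k)) *\<^sub>R Q (e j) (e k))"
    by (rule sum.swap)
  also have "\<dots> = (\<Sum>j\<in>UNIV. \<Sum>k\<in>UNIV. \<Sum>i\<in>UNIV. (g (a i) (e j) * g (a i) (e k)) *\<^sub>R Q (e j) (e k))"
    by (intro sum.cong refl sum.swap)
  also have "\<dots> = (\<Sum>j\<in>UNIV. \<Sum>k\<in>UNIV. g (e j) (e k) *\<^sub>R Q (e j) (e k))"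
  proof (intro sum.cong refl)
    fix j k
    have "(\<Sum>i\<in>UNIV. g (a i) (e j) * g (a i) (e k)) = g (e j) (e k)"
      using parseval[OF a, of "e j" "e k"] sym by simp
    then show "(\<Sum>i\<in>UNIV. (g (a i) (e j) * g (a i) (e k)) *\<^sub>R Q (e j) (e k)) = g (e j) (e k) *\<^sub>R Q (e j) (e k)"
      by (simp add: scaleR_sum_left[symmetric])
  qed
  also have "\<dots> = (\<Sum>j\<in>UNIV. Q (e j) (e j))"
  proof (intro sum.cong refl)
    fix j
    have "(\<Sum>k\<in>UNIV. g (e j) (e k) *\<^sub>R Q (e j) (e k)) = (\<Sum>k\<in>UNIV. if k = j then Q (e j) (e j) else 0)"
      using e by (intro sum.cong) (auto simp: orthonormal_def)
    then show "(\<Sum>k\<in>UNIV. g (e j) (e k) *\<^sub>R Q (e j) (e k)) = Q (e j) (e j)" by simp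
  qed
  finally show ?thesis .
qed

end

section \<open>Derivatives in variable directions\<close>

lemma smooth_on_pd_field:
  fixes F :: "'a::euclidean_space \<Rightarrow> 'b::real_normed_vector"
  assumes F: "smooth_on UNIV F" and a: "smooth_on S a" and S: "open S"
  shows "smooth_on S (\<lambda>x. pd (a x) F x)"
proof -
  have "smooth_on S (\<lambda>x. \<Sum>b\<in>Basis. (a x \<bullet> b) *\<^sub>R pd b F x)"
    by (intro smooth_on_sum smooth_on_scaleR smooth_on_inner a smooth_on_const S
        smooth_on_subset[OF smooth_on_pd[OF F]]) auto
  moreover have "(\<lambda>x. pd (a x) F x) = (\<lambda>x. \<Sum>b\<in>Basis. (a x \<bullet> b) *\<^sub>R pd b F x)"
    by (rule ext) (rule pd_expand[OF smooth_on_differentiable[OF F UNIV_I]])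
  ultimately show ?thesis by simp
qed

text \<open>The product rule for the derivative of \<open>F\<close> along a vector field \<open>a\<close>; the two summands are the second
  derivative of \<open>F\<close> and the derivative along the change of \<open>a\<close>.\<close>

lemma pd_field_has_derivative:
  fixes F :: "'a::euclidean_space \<Rightarrow> 'b::real_normed_vector"
  assumes F: "smooth_on UNIV F" and a: "a differentiable (at x)"
  shows "((\<lambda>y. pd (a y) F y) has_derivative (\<lambda>v. pd v (pd (a x) F) x + pd (pd v a x) F x)) (at x)"
proof -
  have dF: "F differentiable (at y)" "pd b F differentiable (at y)" for y b
    using smooth_on_differentiable[OF F] smooth_on_differentiable[OF smooth_on_pd[OF F]] by auto
  have "((\<lambda>y. \<Sum>b\<in>Basis. (a y \<bullet> b) *\<^sub>R pd b F y) has_derivative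
      (\<lambda>v. \<Sum>b\<in>Basis. (a x \<bullet> b) *\<^sub>R pd v (pd b F) x + (pd v a x \<bullet> b) *\<^sub>R pd b F x)) (at x)"
    by (intro has_derivative_sum has_derivative_scaleR has_derivative_inner_left
        differentiable_has_pd a dF)
  moreover have "(\<lambda>y. \<Sum>b\<in>Basis. (a y \<bullet> b) *\<^sub>R pd b F y) = (\<lambda>y. pd (a y) F y)"
    by (rule ext) (rule pd_expand[OF dF(1), symmetric])
  moreover have "pd v (pd (a x) F) x = (\<Sum>b\<in>Basis. (a x \<bullet> b) *\<^sub>R pd v (pd b F) x)" for v
  proof -
    have "((\<lambda>y. \<Sum>b\<in>Basis. (a x \<bullet> b) *\<^sub>R pd b F y) has_derivative
      (\<lambda>v. \<Sum>b\<in>Basis. (a x \<bullet> b) *\<^sub>R pd v (pd b F) x)) (at x)"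
      by (intro has_derivative_sum bounded_linear.has_derivative[OF bounded_linear_scaleR_right]
          differentiable_has_pd dF)
    moreover have "(\<lambda>y. \<Sum>b\<in>Basis. (a x \<bullet> b) *\<^sub>R pd b F y) = pd (a x) F"
      by (rule ext) (rule pd_expand[OF dF(1), symmetric])
    ultimately show ?thesis by (simp add: pd_eq)
  qed
  moreover have "pd (pd v a x) F x = (\<Sum>b\<in>Basis. (pd v a x \<bullet> b) *\<^sub>R pd b F x)" for v
    by (rule pd_expand[OF dF(1)])
  ultimately show ?thesis by (simp add: sum.distrib)
qed

lemma bounded_bilinear_pd_pd:
  fixes F :: "'a::euclidean_space \<Rightarrow> 'b::euclidean_space"
  assumes F: "smooth_on UNIV F"
  shows "bounded_bilinear (\<lambda>u v. pd u (pd v F) x)"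
proof -
  have 1: "bounded_linear (\<lambda>u. pd u (pd v F) x)" for v
    by (rule bounded_linear_pd[OF smooth_on_differentiable[OF smooth_on_pd[OF F]]]) simp
  have 2: "bounded_linear (\<lambda>v. pd u (pd v F) x)" for u
    using 1[of u] pd_commute[OF F, of u] by simp
  show ?thesis
    using 1 2 by (simp add: bilinear_conv_bounded_bilinear[symmetric] bilinear_def linear_conv_bounded_linear)
qed

lemma pd_pd_expand:
  fixes F :: "'a::euclidean_space \<Rightarrow> 'b::euclidean_space"
  assumes F: "smooth_on UNIV F"
  shows "pd w (pd u F) x = (\<Sum>b\<in>Basis. (u \<bullet> b) *\<^sub>R pd w (pd b F) x)"
proof -
  have "pd w (pd u F) x = pd u (pd w F) x" by (rule pd_commute[OF F])
  also have "\<dots> = (\<Sum>b\<in>Basis. (u \<bullet> b) *\<^sub>R pd b (pd w F) x)"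
    by (rule pd_expand[OF smooth_on_differentiable[OF smooth_on_pd[OF F] UNIV_I]])
  also have "\<dots> = (\<Sum>b\<in>Basis. (u \<bullet> b) *\<^sub>R pd w (pd b F) x)"
    by (simp only: pd_commute[OF F, of w])
  finally show ?thesis .
qed

lemma smooth_on_pd_pd_field:
  fixes F :: "'a::euclidean_space \<Rightarrow> 'b::euclidean_space"
  assumes F: "smooth_on UNIV F" and u: "smooth_on UNIV u"
  shows "smooth_on UNIV (\<lambda>y. pd (u y) (pd (u y) F) y)"
proof -
  have eq: "(\<lambda>y. pd (u y) (pd (u y) F) y) = (\<lambda>y. \<Sum>b\<in>Basis. (u y \<bullet> b) *\<^sub>R pd (u y) (pd b F) y)"
    by (rule ext) (rule pd_pd_expand[OF F])
  show ?thesis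
    unfolding eq
  by (intro smooth_on_sum smooth_on_scaleR smooth_on_inner smooth_on_const u
      smooth_on_pd_field[OF smooth_on_pd[OF F]]) auto
qed

lemma pd_pd_pd_field:
  fixes F :: "'a::euclidean_space \<Rightarrow> 'b::euclidean_space"
  assumes F: "smooth_on UNIV F" and u: "u differentiable (at x)"
  shows "pd a (\<lambda>y. pd (u y) (pd (u y) F) y) x
    = pd a (pd (u x) (pd (u x) F)) x + 2 *\<^sub>R pd (pd a u x) (pd (u x) F) x"
proof -
  let ?a' = "pd a u x"
  have eq1: "(\<lambda>y. pd (u y) (pd (u y) F) y) = (\<lambda>y. \<Sum>b\<in>Basis. (u y \<bullet> b) *\<^sub>R pd (u y) (pd b F) y)"
    by (rule ext) (rule pd_pd_expand[OF F])
  have eq2: "(\<lambda>y. pd (u x) (pd (u x) F) y) = (\<lambda>y. \<Sum>b\<in>Basis. (u x \<bullet> b) *\<^sub>R pd (u x) (pd b F) y)"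
    by (rule ext) (rule pd_pd_expand[OF F])
  have 1: "((\<lambda>y. pd (u y) (pd (u y) F) y) has_derivative
     (\<lambda>a. \<Sum>b\<in>Basis. (u x \<bullet> b) *\<^sub>R (pd a (pd (u x) (pd b F)) x + pd (pd a u x) (pd b F) x)
        + (pd a u x \<bullet> b) *\<^sub>R pd (u x) (pd b F) x)) (at x)"
    unfolding eq1
    by (intro has_derivative_sum has_derivative_scaleR has_derivative_inner_left
        pd_field_has_derivative[OF smooth_on_pd[OF F] u] differentiable_has_pd u)
  have "((\<lambda>y. pd (u x) (pd (u x) F) y) has_derivative
     (\<lambda>a. \<Sum>b\<in>Basis. (u x \<bullet> b) *\<^sub>R pd a (pd (u x) (pd b F)) x)) (at x)"
    unfolding eq2
    by (intro has_derivative_sum bounded_linear.has_derivative[OF bounded_linear_scaleR_right]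
        differentiable_has_pd smooth_on_differentiable[OF smooth_on_pd[OF smooth_on_pd[OF F]] UNIV_I])
  then have 2: "pd a (pd (u x) (pd (u x) F)) x = (\<Sum>b\<in>Basis. (u x \<bullet> b) *\<^sub>R pd a (pd (u x) (pd b F)) x)"
    by (rule pd_eq)
  have 3: "pd ?a' (pd (u x) F) x = (\<Sum>b\<in>Basis. (u x \<bullet> b) *\<^sub>R pd ?a' (pd b F) x)"
    by (rule pd_pd_expand[OF F])
  have "pd ?a' (pd (u x) F) x = pd (u x) (pd ?a' F) x" by (rule pd_commute[OF F])
  also have "\<dots> = (\<Sum>b\<in>Basis. (?a' \<bullet> b) *\<^sub>R pd (u x) (pd b F) x)"
    by (rule pd_pd_expand[OF F])
  finally have 4: "pd ?a' (pd (u x) F) x = \<dots>" .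
  show ?thesis
    unfolding pd_eq[OF 1] scaleR_2 2
    by (subst (2) 4, subst 3) (simp add: sum.distrib scaleR_add_right)
qed

section \<open>Entire space-like graphs\<close>

locale spacelike_graph =
  fixes f :: "real^'m::finite \<Rightarrow> real^'n::finite"
  assumes smooth_f: "smooth_on UNIV f" and pd_less: "v \<noteq> 0 \<Longrightarrow> norm (pd v f x) < norm v"
begin

definition F :: "real^'m \<Rightarrow> ('m, 'n) pseudo" where "F x = (x, f x)"

text \<open>The induced metric in the global coordinates given by the graph.\<close>

definition G :: "real^'m \<Rightarrow> real^'m \<Rightarrow> real^'m \<Rightarrow> real" where
  "G x u v = pinner (pd u F x) (pd v F x)"

lemma smooth_F: "smooth_on UNIV F"
  unfolding F_def by (intro smooth_on_Pair smooth_on_id smooth_f) auto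

lemma F_diff: "F differentiable (at x)"
  using smooth_on_differentiable[OF smooth_F] by simp

lemma pd_F_diff: "pd v F differentiable (at x)"
  using smooth_on_differentiable[OF smooth_on_pd[OF smooth_F]] by simp

lemma pd_F: "pd v F x = (v, pd v f x)"
  unfolding F_def
  by (rule pd_eq) (intro has_derivative_Pair has_derivative_ident differentiable_has_pd
      smooth_on_differentiable[OF smooth_f UNIV_I])

lemma bounded_linear_L: "bounded_linear (\<lambda>v. pd v F x)"
  by (rule bounded_linear_pd[OF F_diff])

sublocale L: bounded_linear "\<lambda>v. pd v F x" for x by (rule bounded_linear_L)

lemma pd_le: "norm (pd v f x) \<le> norm v"
proof (cases "v = 0")
  case True
  then show ?thesis using L.zero[of x] by (simp add: pd_F zero_prod_def)
next
  case False
  then show ?thesis using pd_less[of v x] by simp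
qed

lemma G_alt: "G x v v = (norm v)\<^sup>2 - (norm (pd v f x))\<^sup>2"
  by (simp add: G_def pd_F pinner_def dot_square_norm)

lemma G_le: "G x v v \<le> (norm v)\<^sup>2" by (simp add: G_alt)

lemma positive_form_G: "positive_form (G x)"
proof (rule positive_form.intro)
  show "bounded_bilinear (G x)"
    unfolding G_def by (rule bounded_bilinear.comp[OF bounded_bilinear_pinner bounded_linear_L bounded_linear_L])
  show "G x u v = G x v u" for u v by (simp add: G_def pinner_commute)
  show "0 < G x v v" if "v \<noteq> 0" for v
    using pd_less[OF that, of x] by (simp add: G_alt power_strict_mono)
qed

sublocale pf: positive_form "G x" for x by (rule positive_form_G)

lemma smooth_G:
  assumes "smooth_on UNIV u" "smooth_on UNIV v"
  shows "smooth_on UNIV (\<lambda>x. G x (u x) (v x))"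
  unfolding G_def
  by (intro smooth_on_bilinear[OF _ bounded_bilinear_pinner] smooth_on_pd_field smooth_F assms) auto

text \<open>Gram-Schmidt, applied to the coordinate fields at all points simultaneously. That the \<open>i\<close>-th field only
  has components in the index set treated so far keeps the next coordinate field independent of the earlier ones.\<close>

lemma frame_exists:
  "\<exists>E. \<forall>i. smooth_on UNIV (E i) \<and> (\<forall>x. pf.orthonormal x (\<lambda>i. E i x))"
proof -
  have "\<exists>E. (\<forall>i\<in>I. smooth_on UNIV (E i)) \<and>
      (\<forall>x. \<forall>i\<in>I. \<forall>j\<in>I. G x (E i x) (E j x) = (if i = j then 1 else 0)) \<and>
      (\<forall>x. \<forall>i\<in>I. \<forall>k. k \<notin> I \<longrightarrow> E i x $ k = 0)" for I :: "'m set"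
    using finite[of I]
  proof (induction I rule: finite_induct)
    case empty
    then show ?case by simp
  next
    case (insert a I)
    then obtain E where E: "\<And>i. i \<in> I \<Longrightarrow> smooth_on UNIV (E i)"
      "\<And>x i j. i \<in> I \<Longrightarrow> j \<in> I \<Longrightarrow> G x (E i x) (E j x) = (if i = j then 1 else 0)"
      "\<And>x i k. i \<in> I \<Longrightarrow> k \<notin> I \<Longrightarrow> E i x $ k = 0" by metis
    define ax :: "real^'m" where "ax = axis a 1"
    define w where "w x = ax - (\<Sum>i\<in>I. G x ax (E i x) *\<^sub>R E i x)" for x
    have w: "smooth_on UNIV w"
      unfolding w_def by (intro smooth_on_diff smooth_on_sum smooth_on_scaleR smooth_on_const smooth_G E(1)) auto
    have wk: "w x $ k = (if k = a then 1 else 0)" if "k \<notin> I" for x k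
      using that insert.hyps E(3) by (simp add: w_def ax_def axis_def)
    then have "w x $ a = 1" for x using insert.hyps by simp
    then have "w x \<noteq> 0" for x by (metis zero_index zero_neq_one)
    then have wpos: "0 < G x (w x) (w x)" for x by (rule pf.pos)
    have worth: "G x (w x) (E j x) = 0" if "j \<in> I" for j x
    proof -
      have "(\<Sum>i\<in>I. G x ax (E i x) * G x (E i x) (E j x)) = (\<Sum>i\<in>I. if i = j then G x ax (E j x) else 0)"
        using E(2) that by (intro sum.cong) auto
      then show ?thesis using that insert.hyps by (simp add: w_def pf.g_simps)
    qed
    define r where "r x = G x (w x) (w x) powr (- 1 / 2)" for x
    have r: "smooth_on UNIV r"
      unfolding r_def by (intro smooth_on_powr smooth_G w) (use wpos in auto)
    have rr: "r x * r x * G x (w x) (w x) = 1" for x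
    proof -
      have "r x * r x = G x (w x) (w x) powr (-1)" by (simp add: r_def powr_add[symmetric])
      then show ?thesis using wpos[of x] by (simp add: powr_minus)
    qed
    define E' where "E' i = (if i = a then (\<lambda>x. r x *\<^sub>R w x) else E i)" for i
    have E'a: "E' a = (\<lambda>x. r x *\<^sub>R w x)" and E'i: "\<And>i. i \<in> I \<Longrightarrow> E' i = E i"
      using insert.hyps by (auto simp: E'_def)
    show ?case
    proof (intro exI[of _ E'] conjI allI ballI impI)
      fix i assume i: "i \<in> insert a I"
      show "smooth_on UNIV (E' i)"
        using i E(1) E'i by (auto simp: E'a intro!: smooth_on_scaleR r w)
    next
      fix x i j assume ij: "i \<in> insert a I" "j \<in> insert a I"
      have sym: "G x (E j x) (w x) = G x (w x) (E j x)" for j by (rule pf.sym)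
      show "G x (E' i x) (E' j x) = (if i = j then 1 else 0)"
        using ij insert.hyps E(2) worth rr[of x]
        by (auto simp: E'a E'i pf.g_simps sym mult.assoc)
    next
      fix x i k assume ik: "i \<in> insert a I" "k \<notin> insert a I"
      then show "E' i x $ k = 0" using wk[of k x] E(3)[of i k x] by (auto simp: E'a E'i)
    qed
  qed
  from this[of UNIV] show ?thesis by (auto simp: pf.orthonormal_def)
qed

definition E :: "'m \<Rightarrow> real^'m \<Rightarrow> real^'m" where
  "E = (SOME E. \<forall>i. smooth_on UNIV (E i) \<and> (\<forall>x. pf.orthonormal x (\<lambda>i. E i x)))"

lemma smooth_E: "smooth_on UNIV (E i)" and orthonormal_E: "pf.orthonormal x (\<lambda>i. E i x)"
  using someI_ex[OF frame_exists, folded E_def] by blast+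

text \<open>The tangential component, as a coordinate vector.\<close>

definition T :: "real^'m \<Rightarrow> ('m, 'n) pseudo \<Rightarrow> real^'m" where
  "T x y = (\<Sum>i\<in>UNIV. pinner y (pd (E i x) F x) *\<^sub>R E i x)"

definition nor :: "real^'m \<Rightarrow> ('m, 'n) pseudo \<Rightarrow> ('m, 'n) pseudo" where
  "nor x y = y - pd (T x y) F x"

lemma bounded_linear_T: "bounded_linear (T x)"
  unfolding T_def
  by (intro bounded_linear_sum bounded_linear_scaleR_const pinner.bounded_linear_left) 

sublocale T: bounded_linear "T x" for x by (rule bounded_linear_T)

text \<open>\<open>T\<close> represents the functional \<open>v \<mapsto> \<langle>y, dF v\<rangle>\<close> with respect to the induced metric.\<close>

lemma pinner_L: "pinner y (pd v F x) = G x (T x y) v"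
proof -
  have v: "v = (\<Sum>i\<in>UNIV. G x v (E i x) *\<^sub>R E i x)" by (rule pf.orthonormal_expand[OF orthonormal_E])
  have "pinner y (pd v F x) = pinner y (pd (\<Sum>i\<in>UNIV. G x v (E i x) *\<^sub>R E i x) F x)" using v by simp
  also have "\<dots> = (\<Sum>i\<in>UNIV. G x v (E i x) * pinner y (pd (E i x) F x))"
    by (simp add: L.sum L.scaleR pinner_simps)
  also have "\<dots> = G x v (T x y)"
    by (simp add: T_def pf.g_simps mult.commute)
  finally show ?thesis by (simp add: pf.sym)
qed

lemma T_L: "T x (pd v F x) = v"
  using pf.orthonormal_expand[OF orthonormal_E, of v x] by (simp add: T_def G_def)

definition normal :: "real^'m \<Rightarrow> ('m, 'n) pseudo \<Rightarrow> bool" where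
  "normal x y \<longleftrightarrow> (\<forall>v. pinner y (pd v F x) = 0)"

lemma normal_T: "normal x y \<longleftrightarrow> T x y = 0"
proof
  assume "normal x y"
  then have "G x (T x y) (T x y) = 0" by (simp add: normal_def pinner_L[symmetric])
  then show "T x y = 0" using pf.pos[of "T x y" x] by force
qed (simp add: normal_def pinner_L pf.zero_left)

lemma normal_nor: "normal x (nor x y)"
  by (simp add: normal_T nor_def T.diff T_L)

lemma nor_normal: "normal x y \<Longrightarrow> nor x y = y"
  by (simp add: normal_T nor_def L.zero)

lemma nor_L: "nor x (pd v F x) = 0"
  by (simp add: nor_def T_L)

lemma bounded_linear_nor: "bounded_linear (nor x)"
  unfolding nor_def
  by (intro bounded_linear_sub bounded_linear_ident bounded_linear_compose[OF bounded_linear_L bounded_linear_T])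

sublocale nor: bounded_linear "nor x" for x by (rule bounded_linear_nor)

lemma pinner_nor_left: "normal x N \<Longrightarrow> pinner (nor x y) N = pinner y N"
  by (simp add: nor_def pinner_simps normal_def pinner_commute[of _ N])

lemma split_pinner: "pinner y y' = G x (T x y) (T x y') + pinner (nor x y) (nor x y')"
proof -
  have "pinner (nor x y) (nor x y') = pinner y (nor x y')"
    by (rule pinner_nor_left[OF normal_nor])
  then show ?thesis by (simp add: nor_def[of x y'] pinner_simps pinner_L)
qed

text \<open>Pairing a normal vector with the tangent vector above its own positive component, whose negative
  component is not longer, shows that the negative component of the normal vector dominates.\<close>

lemma normal_nonpos:
  assumes "normal x y"
  shows "pinner y y \<le> 0"
proof -
  let ?v = "fst y"
  have "fst y \<bullet> fst y = snd y \<bullet> pd ?v f x"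
    using assms unfolding normal_def by (simp add: pinner_def pd_F)
  also have "\<dots> \<le> norm (snd y) * norm (pd ?v f x)" by (rule norm_cauchy_schwarz)
  also have "\<dots> \<le> norm (snd y) * norm ?v" by (intro mult_left_mono pd_le) simp
  finally have "norm ?v * norm ?v \<le> norm (snd y) * norm ?v" by (simp add: norm_eq_sqrt_inner)
  then have "norm ?v \<le> norm (snd y)"
    by (cases "norm ?v = 0") auto
  then show ?thesis by (simp add: pinner_def dot_square_norm power_mono)
qed

lemma normal_add: "normal x y \<Longrightarrow> normal x y' \<Longrightarrow> normal x (y + y')"
  and normal_scaleR: "normal x y \<Longrightarrow> normal x (c *\<^sub>R y)"
  by (simp_all add: normal_def pinner_simps)

lemma normal_cauchy_schwarz:
  assumes "normal x y" "normal x y'"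
  shows "(pinner y y')\<^sup>2 \<le> (- pinner y y) * (- pinner y' y')"
proof (rule discriminant_bound)
  fix t
  have "normal x (y + t *\<^sub>R y')" using assms by (intro normal_add normal_scaleR)
  from normal_nonpos[OF this]
  show "0 \<le> - pinner y y - 2 * pinner y y' * t + (- pinner y' y') * t\<^sup>2"
    by (simp add: pinner_simps pinner_commute[of y' y] power2_eq_square algebra_simps)
qed

end

section \<open>Parallel mean curvature of a graph\<close>

context spacelike_graph
begin

abbreviation M :: "('m, 'n) pseudo set" where "M \<equiv> range F"

lemma fst_F [simp]: "fst (F x) = x" by (simp add: F_def)

lemma F_fst: "p \<in> M \<Longrightarrow> F (fst p) = p" by auto

lemma curve_through: "curve_at M (F x) (pd v F x) (\<lambda>t. F (x + t *\<^sub>R v))"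
proof -
  have c: "smooth_on {-1<..<1} (\<lambda>t. x + t *\<^sub>R v)"
    by (intro smooth_on_add smooth_on_const smooth_on_compose_linear[OF _ bounded_linear_scaleR_left] smooth_on_id)
      auto
  have "smooth_on {-1<..<1} (\<lambda>t. F (x + t *\<^sub>R v))"
    by (rule smooth_on_compose[OF _ open_UNIV _ smooth_F c]) auto
  then show ?thesis
    unfolding curve_at_def using vector_derivative_along_line[OF F_diff, of x v]
    by (intro conjI exI[of _ 1]) auto
qed

text \<open>Velocities of curves in the graph are determined by their projection, since the curve is recovered
  from its projection near \<open>0\<close>.\<close>

lemma curve_at_graph:
  assumes "curve_at M (F x) w \<gamma>" and K: "K differentiable (at x)"
  shows "((\<lambda>t. K (fst (\<gamma> t))) has_vector_derivative pd (fst w) K x) (at 0)"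
    and "\<exists>\<epsilon>>0. \<forall>t\<in>{-\<epsilon><..<\<epsilon>}. F (fst (\<gamma> t)) = \<gamma> t"
proof -
  obtain \<epsilon> where \<gamma>: "\<gamma> 0 = F x" "(\<gamma> has_vector_derivative w) (at 0)" "\<epsilon> > 0"
    "\<gamma> ` {-\<epsilon><..<\<epsilon>} \<subseteq> M"
    using assms by (auto simp: curve_at_def)
  then have "F (fst (\<gamma> t)) = \<gamma> t" if "t \<in> {-\<epsilon><..<\<epsilon>}" for t
    using that by (intro F_fst) blast
  then show "\<exists>\<epsilon>>0. \<forall>t\<in>{-\<epsilon><..<\<epsilon>}. F (fst (\<gamma> t)) = \<gamma> t" using \<gamma>(3) by blast
  have "((\<lambda>t. fst (\<gamma> t)) has_derivative (\<lambda>h. fst (h *\<^sub>R w))) (at 0)"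
    using \<gamma>(2) unfolding has_vector_derivative_def by (rule has_derivative_fst)
  moreover have "K differentiable (at (fst (\<gamma> 0)))" using K \<gamma>(1) by simp
  ultimately have "((\<lambda>t. K (fst (\<gamma> t))) has_derivative (\<lambda>h. pd (fst (h *\<^sub>R w)) K (fst (\<gamma> 0)))) (at 0)"
    using has_derivative_compose differentiable_has_pd by blast
  note d = this
  interpret bounded_linear "\<lambda>v. pd v K x" using bounded_linear_pd[OF K] .
  from d show "((\<lambda>t. K (fst (\<gamma> t))) has_vector_derivative pd (fst w) K x) (at 0)"
    by (simp add: has_vector_derivative_def \<gamma>(1) scaleR)
qed

lemma curve_velocity:
  assumes "curve_at M (F x) w \<gamma>"
  shows "w = pd (fst w) F x"
proof -
  obtain \<epsilon> where \<epsilon>: "\<epsilon> > 0" "\<forall>t\<in>{-\<epsilon><..<\<epsilon>}. F (fst (\<gamma> t)) = \<gamma> t"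
    using curve_at_graph(2)[OF assms F_diff] by blast
  have "(\<gamma> has_vector_derivative pd (fst w) F x) (at 0)"
    by (rule has_vector_derivative_transform_within_open[OF curve_at_graph(1)[OF assms F_diff], of "{-\<epsilon><..<\<epsilon>}"])
      (use \<epsilon> in auto)
  moreover have "(\<gamma> has_vector_derivative w) (at 0)" using assms by (simp add: curve_at_def)
  ultimately show ?thesis by (rule vector_derivative_unique_at[symmetric])
qed

lemma tangent_space_graph: "tangent_space M (F x) = range (\<lambda>v. pd v F x)"
proof
  show "tangent_space M (F x) \<subseteq> range (\<lambda>v. pd v F x)"
    unfolding tangent_space_def using curve_velocity by blast
  show "range (\<lambda>v. pd v F x) \<subseteq> tangent_space M (F x)"
    unfolding tangent_space_def using curve_through by blast
qed

lemma normal_space_graph: "normal_space M (F x) = {y. normal x y}"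
  by (simp add: normal_space_def tangent_space_graph normal_def)

lemma normal_part_graph: "normal_part M (F x) u = nor x u"
  unfolding normal_part_def
proof (rule the_equality)
  have "u - nor x u = pd (T x u) F x" by (simp add: nor_def)
  then show "nor x u \<in> normal_space M (F x) \<and> u - nor x u \<in> tangent_space M (F x)"
    by (simp add: normal_space_graph tangent_space_graph normal_nor)
next
  fix \<nu> assume *: "\<nu> \<in> normal_space M (F x) \<and> u - \<nu> \<in> tangent_space M (F x)"
  then obtain v where v: "u - \<nu> = pd v F x" by (auto simp: tangent_space_graph)
  then have "nor x u = nor x (\<nu> + pd v F x)" by (metis add_diff_cancel_left' diff_add_cancel add.commute)
  also have "\<dots> = \<nu>" using * by (simp add: normal_space_graph nor.add nor_normal nor_L)
  finally show "\<nu> = nor x u" ..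
qed

text \<open>A map on the graph is the same as a map in the coordinates, and its flat derivative is then an ordinary
  directional derivative, independent of the curve.\<close>

lemma flat_deriv_graph:
  assumes K: "(\<lambda>y. W (F y)) differentiable (at x)"
  shows "flat_deriv M W (F x) (pd v F x) = pd v (\<lambda>y. W (F y)) x"
  unfolding flat_deriv_def
proof (rule the_equality)
  show *: "\<forall>\<gamma>. curve_at M (F x) (pd v F x) \<gamma> \<longrightarrow>
      (W \<circ> \<gamma> has_vector_derivative pd v (\<lambda>y. W (F y)) x) (at 0)"
  proof (intro allI impI)
    fix \<gamma> assume \<gamma>: "curve_at M (F x) (pd v F x) \<gamma>"
    obtain \<epsilon> where \<epsilon>: "\<epsilon> > 0" "\<forall>t\<in>{-\<epsilon><..<\<epsilon>}. F (fst (\<gamma> t)) = \<gamma> t"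
      using curve_at_graph(2)[OF \<gamma> K] by blast
    show "(W \<circ> \<gamma> has_vector_derivative pd v (\<lambda>y. W (F y)) x) (at 0)"
      by (rule has_vector_derivative_transform_within_open[OF _ open_greaterThanLessThan, of _ _ _ "-\<epsilon>" \<epsilon>,
            OF curve_at_graph(1)[OF \<gamma> K, unfolded pd_F fst_conv]])
        (use \<epsilon> in auto)
  qed
  fix w assume "\<forall>\<gamma>. curve_at M (F x) (pd v F x) \<gamma> \<longrightarrow> (W \<circ> \<gamma> has_vector_derivative w) (at 0)"
  with * curve_through show "w = pd v (\<lambda>y. W (F y)) x"
    using vector_derivative_unique_at by blast
qed

lemma smooth_field_graph:
  assumes "smooth_field_on (M \<inter> U) W" "open U" "F x \<in> U"
  shows "\<exists>D. open D \<and> x \<in> D \<and> (\<forall>y\<in>D. F y \<in> U) \<and> smooth_on D (\<lambda>y. W (F y))"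
proof -
  obtain O' G' where O: "open O'" "F x \<in> O'" "smooth_on O' G'" "\<forall>y\<in>(M \<inter> U) \<inter> O'. W y = G' y"
    using assms unfolding smooth_field_on_def by (metis Int_iff rangeI)
  define D where "D = F -` (U \<inter> O')"
  have D: "open D" unfolding D_def
    using O(1) assms(2) smooth_on_continuous[OF smooth_F] by (intro open_vimage) auto
  have "smooth_on D (\<lambda>y. W (F y))"
  proof (rule smooth_on_cong[OF D, of "\<lambda>y. G' (F y)"])
    show "G' (F y) = W (F y)" if "y \<in> D" for y using O(4) that by (auto simp: D_def)
    show "smooth_on D (\<lambda>y. G' (F y))"
      by (rule smooth_on_compose[OF D O(1) _ O(3) smooth_on_subset[OF smooth_F]]) (auto simp: D_def)
  qed
  then show ?thesis using D O(2) assms(3) by (intro exI[of _ D]) (auto simp: D_def)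
qed

text \<open>Differentiating \<open>dF a\<close> along \<open>a\<close> gives the second derivative of \<open>F\<close> plus a tangential term.\<close>

lemma second_fundamental_form_graph:
  assumes e: "tangent_field_on M U e" and x: "F x \<in> U"
  shows "second_fundamental_form M e e (F x) = nor x (pd (fst (e (F x))) (pd (fst (e (F x))) F) x)"
proof -
  obtain D where D: "open D" "x \<in> D" "\<forall>y\<in>D. F y \<in> U" "smooth_on D (\<lambda>y. e (F y))"
    using smooth_field_graph[of U e x] e x by (auto simp: tangent_field_on_def)
  define a where "a y = fst (e (F y))" for y
  have tan: "e (F y) = pd (a y) F y" if "F y \<in> U" for y
  proof -
    have "e (F y) \<in> tangent_space M (F y)" using e that by (auto simp: tangent_field_on_def)
    then show ?thesis by (auto simp: tangent_space_graph a_def pd_F)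
  qed
  have K: "(\<lambda>y. e (F y)) differentiable (at x)" using smooth_on_differentiable[OF D(4,2)] .
  have "smooth_on D a" unfolding a_def by (rule smooth_on_fst[OF D(1,4)])
  then have a: "a differentiable (at x)" using smooth_on_differentiable D(2) by blast
  have "((\<lambda>y. e (F y)) has_derivative (\<lambda>v. pd v (pd (a x) F) x + pd (pd v a x) F x)) (at x)"
    by (rule has_derivative_transform_within_open[OF pd_field_has_derivative[OF smooth_F a] D(1,2)])
      (use D(3) tan in auto)
  then have "pd (a x) (\<lambda>y. e (F y)) x = pd (a x) (pd (a x) F) x + pd (pd (a x) a x) F x"
    by (rule pd_eq)
  moreover have "second_fundamental_form M e e (F x) = nor x (pd (a x) (\<lambda>y. e (F y)) x)"
    unfolding second_fundamental_form_def normal_part_graph tan[OF x] flat_deriv_graph[OF K] ..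
  ultimately show ?thesis by (simp add: nor.add nor_L a_def)
qed

text \<open>The trace of the second derivative of the parametrization. Its normal part is \<open>m\<close> times the mean
  curvature.\<close>

definition S :: "real^'m \<Rightarrow> ('m, 'n) pseudo" where
  "S x = (\<Sum>i\<in>UNIV. pd (E i x) (pd (E i x) F) x)"

definition H :: "real^'m \<Rightarrow> ('m, 'n) pseudo" where
  "H x = (1 / real CARD('m)) *\<^sub>R nor x (S x)"

text \<open>The trace of a bilinear map does not depend on the orthonormal basis, so that all frames give the same
  value.\<close>

lemma mean_curvature_graph: "mean_curvature M (F x) = H x"
  unfolding mean_curvature_def
proof (rule the_equality)
  define e where "e i p = pd (E i (fst p)) F (fst p)" for i and p :: "('m, 'n) pseudo"
  have sm: "smooth_on UNIV (e i)" for i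
  proof -
    have "smooth_on UNIV (\<lambda>x. pd (E i x) F x)"
      by (rule smooth_on_pd_field[OF smooth_F smooth_E open_UNIV])
    from smooth_on_compose[OF open_UNIV open_UNIV _ this smooth_on_fst[OF open_UNIV smooth_on_id]]
    show ?thesis by (simp add: e_def[abs_def])
  qed
  have tf: "tangent_field_on M UNIV (e i)" for i
    unfolding tangent_field_on_def smooth_field_on_def
    using sm by (auto simp: tangent_space_graph e_def intro!: exI[of _ UNIV] exI[of _ "e i"])
  have "orthonormal_frame_on M UNIV e"
    unfolding orthonormal_frame_on_def using tf orthonormal_E
    by (auto simp: e_def pf.orthonormal_def G_def[symmetric])
  moreover have "H x = (1 / real CARD('m)) *\<^sub>R (\<Sum>i\<in>UNIV. second_fundamental_form M (e i) (e i) (F x))"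
    by (simp add: H_def S_def nor.sum second_fundamental_form_graph[OF tf] e_def pd_F)
  ultimately show "\<exists>U e. F x \<in> U \<and> orthonormal_frame_on M U e \<and>
     H x = (1 / real CARD('m)) *\<^sub>R (\<Sum>i\<in>UNIV. second_fundamental_form M (e i) (e i) (F x))"
    by blast
next
  fix h assume "\<exists>U e. F x \<in> U \<and> orthonormal_frame_on M U e \<and>
     h = (1 / real CARD('m)) *\<^sub>R (\<Sum>i\<in>UNIV. second_fundamental_form M (e i) (e i) (F x))"
  then obtain U e where U: "F x \<in> U" "orthonormal_frame_on M U e"
     "h = (1 / real CARD('m)) *\<^sub>R (\<Sum>i\<in>UNIV. second_fundamental_form M (e i) (e i) (F x))" by blast
  define a where "a i = fst (e i (F x))" for i
  have tf: "tangent_field_on M U (e i)" for i using U(2) by (simp add: orthonormal_frame_on_def)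
  have ea: "e i (F x) = pd (a i) F x" for i
  proof -
    have "e i (F x) \<in> tangent_space M (F x)" using tf[of i] U(1) by (auto simp: tangent_field_on_def)
    then show ?thesis by (auto simp: tangent_space_graph a_def pd_F)
  qed
  have "pf.orthonormal x a"
    using U(1,2) by (auto simp: orthonormal_frame_on_def pf.orthonormal_def G_def ea[symmetric])
  then have "(\<Sum>i\<in>UNIV. pd (a i) (pd (a i) F) x) = S x"
    unfolding S_def
    by (rule pf.trace_independent[OF bounded_bilinear_pd_pd[OF smooth_F] orthonormal_E])
  then show "h = H x"
    unfolding U(3) H_def by (simp add: second_fundamental_form_graph[OF tf U(1)] a_def[symmetric] nor.sum[symmetric])
qed

lemma smooth_S: "smooth_on UNIV S"
  unfolding S_def by (intro smooth_on_sum smooth_on_pd_pd_field smooth_F smooth_E) auto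

lemma smooth_T: "smooth_on UNIV Y \<Longrightarrow> smooth_on UNIV (\<lambda>x. T x (Y x))"
  unfolding T_def
  by (intro smooth_on_sum smooth_on_scaleR smooth_on_bilinear[OF _ bounded_bilinear_pinner]
      smooth_on_pd_field smooth_F smooth_E) auto

lemma smooth_H: "smooth_on UNIV H"
  unfolding H_def nor_def
  by (intro smooth_on_scaleR smooth_on_const smooth_on_diff smooth_S smooth_on_pd_field smooth_F smooth_T) auto

lemma normal_H: "normal x (H x)"
  unfolding H_def by (intro normal_scaleR normal_nor)

lemma parallel_graph:
  assumes "parallel_mean_curvature M"
  shows "nor x (pd v H x) = 0"
proof -
  define V where "V p = pd v F (fst p)" for p :: "('m, 'n) pseudo"
  have "smooth_on UNIV V"
    unfolding V_def
    by (rule smooth_on_compose[OF open_UNIV open_UNIV _ smooth_on_pd[OF smooth_F]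
          smooth_on_fst[OF open_UNIV smooth_on_id]]) simp
  then have "tangent_field_on M UNIV V"
    unfolding tangent_field_on_def smooth_field_on_def
    by (auto simp: tangent_space_graph V_def intro!: exI[of _ UNIV] exI[of _ V])
  then have "normal_connection M V (mean_curvature M) (F x) = 0"
    using assms unfolding parallel_mean_curvature_def by blast
  moreover have "V (F x) = pd v F x" by (simp add: V_def)
  moreover have "(\<lambda>y. mean_curvature M (F y)) = H" by (rule ext) (rule mean_curvature_graph)
  ultimately show ?thesis
    using flat_deriv_graph[of "mean_curvature M" x v] smooth_on_differentiable[OF smooth_H UNIV_I, of x]
    by (simp add: normal_connection_def normal_part_graph)
qed

text \<open>The derivative of a parallel normal field is tangential, hence orthogonal to the field.\<close>

lemma norm_H_const:
  assumes "parallel_mean_curvature M"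
  shows "pinner (H x) (H x) = pinner (H y) (H y)"
proof -
  have Hd: "H differentiable (at x)" for x using smooth_on_differentiable[OF smooth_H] by simp
  have "((\<lambda>x. pinner (H x) (H x)) has_derivative (\<lambda>v. 0)) (at x)" for x
  proof -
    have "((\<lambda>x. pinner (H x) (H x)) has_derivative
        (\<lambda>v. pinner (H x) (pd v H x) + pinner (pd v H x) (H x))) (at x)"
      by (intro pinner.FDERIV differentiable_has_pd Hd)
    moreover have "pinner (pd v H x) (H x) = 0" for v
      using pinner_nor_left[OF normal_H, of x "pd v H x"] parallel_graph[OF assms] by (simp add: pinner_simps)
    ultimately show ?thesis by (simp add: pinner_commute)
  qed
  then have "\<And>x. x \<in> UNIV \<Longrightarrow> ((\<lambda>x. pinner (H x) (H x)) has_derivative (\<lambda>v. 0)) (at x within UNIV)" by simp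
  from has_derivative_zero_constant[OF convex_UNIV this] obtain c where "\<forall>x. pinner (H x) (H x) = c" by auto
  then show ?thesis by simp
qed

text \<open>The covariant derivative of an orthonormal frame is skew, and the contraction of a skew with a
  symmetric tensor vanishes. So the trace may be differentiated as if the frame were parallel.\<close>

lemma frame_rotation:
  assumes Q: "bounded_bilinear Q" and sym: "\<And>u v. Q u v = (Q v u :: real)"
  shows "(\<Sum>i\<in>UNIV. Q (T x (pd a (pd (E i x) F) x) + pd a (E i) x) (E i x)) = 0"
proof -
  interpret Q: bounded_bilinear Q by (rule Q)
  define u where "u i = T x (pd a (pd (E i x) F) x) + pd a (E i) x" for i
  have skew: "G x (u i) (E j x) + G x (u j) (E i x) = 0" for i j
  proof -
    have Ed: "E i differentiable (at x)" for i using smooth_on_differentiable[OF smooth_E] by simp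
    have eq: "(\<lambda>y. pinner (pd (E i y) F y) (pd (E j y) F y)) = (\<lambda>y. if i = j then 1 else 0)"
      using orthonormal_E by (auto simp: pf.orthonormal_def G_def)
    have "((\<lambda>y. pinner (pd (E i y) F y) (pd (E j y) F y)) has_derivative
      (\<lambda>a. pinner (pd (E i x) F x) (pd a (pd (E j x) F) x + pd (pd a (E j) x) F x)
        + pinner (pd a (pd (E i x) F) x + pd (pd a (E i) x) F x) (pd (E j x) F x))) (at x)"
      by (intro pinner.FDERIV pd_field_has_derivative smooth_F Ed)
    from pd_eq[OF this, of a]
    have "pinner (pd (E i x) F x) (pd a (pd (E j x) F) x + pd (pd a (E j) x) F x)
        + pinner (pd a (pd (E i x) F) x + pd (pd a (E i) x) F x) (pd (E j x) F x) = 0"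
      unfolding eq by (simp add: frechet_derivative_const)
    then show ?thesis
      by (simp add: u_def pinner_commute[of "pd (E i x) F x"] pinner_L T.add T_L add.commute)
  qed
  define A where "A i j = G x (u i) (E j x)" for i j
  have Qu: "Q (u i) (E i x) = (\<Sum>j\<in>UNIV. A i j * Q (E j x) (E i x))" for i
  proof -
    have "Q (u i) (E i x) = Q (\<Sum>j\<in>UNIV. A i j *\<^sub>R E j x) (E i x)"
      using pf.orthonormal_expand[OF orthonormal_E, of "u i" x] by (simp add: A_def)
    then show ?thesis by (simp add: Q.sum_left Q.scaleR_left)
  qed
  define s where "s = (\<Sum>i\<in>UNIV. \<Sum>j\<in>UNIV. A i j * Q (E j x) (E i x))"
  have "s = (\<Sum>j\<in>UNIV. \<Sum>i\<in>UNIV. A i j * Q (E j x) (E i x))" unfolding s_def by (rule sum.swap)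
  also have "\<dots> = (\<Sum>j\<in>UNIV. \<Sum>i\<in>UNIV. - (A j i * Q (E i x) (E j x)))"
  proof (intro sum.cong refl)
    fix j i
    have "A i j = - A j i" using skew[of i j] by (simp add: A_def)
    then show "A i j * Q (E j x) (E i x) = - (A j i * Q (E i x) (E j x))" using sym[of "E i x" "E j x"] by simp
  qed
  also have "\<dots> = - s" unfolding s_def by (simp add: sum_negf)
  finally have "s = 0" by simp
  then show ?thesis unfolding u_def[symmetric] Qu s_def .
qed

text \<open>The Codazzi equation, traced, for parallel mean curvature: the trace of the third derivative of \<open>F\<close>
  has no normal part apart from the Christoffel terms, which come from the tangential parts of the second derivatives.\<close>

lemma codazzi_trace:
  assumes par: "parallel_mean_curvature M" and N: "normal x N"
  shows "(\<Sum>i\<in>UNIV. pinner (pd a (pd (E i x) (pd (E i x) F)) x) N)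
     = 2 * (\<Sum>i\<in>UNIV. pinner (pd (T x (pd a (pd (E i x) F) x)) (pd (E i x) F) x) N)
       + pinner (pd a (pd (T x (S x)) F) x) N"
proof -
  define Q where "Q u v = pinner (pd u (pd v F) x) N" for u v
  have Ed: "E i differentiable (at x)" for i using smooth_on_differentiable[OF smooth_E] by simp
  have Sd: "S differentiable (at x)" using smooth_on_differentiable[OF smooth_S] by simp
  have Q: "bounded_bilinear Q"
  proof -
    interpret P: bounded_bilinear "\<lambda>u v. pd u (pd v F) x" by (rule bounded_bilinear_pd_pd[OF smooth_F])
    show ?thesis
      unfolding bilinear_conv_bounded_bilinear[symmetric] bilinear_def Q_def
      by (auto intro!: linearI simp: P.add_left P.add_right P.scaleR_left P.scaleR_right pinner_simps)
  qed
  interpret Q: bounded_bilinear Q by (rule Q)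
  have Qsym: "Q u v = Q v u" for u v unfolding Q_def using pd_commute[OF smooth_F] by metis
  define \<kappa> where "\<kappa> y = T y (S y)" for y
  have \<kappa>d: "\<kappa> differentiable (at x)"
    using smooth_on_differentiable[OF smooth_T[OF smooth_S]] by (simp add: \<kappa>_def[abs_def])
  have "(H has_derivative (\<lambda>v. (1 / real CARD('m)) *\<^sub>R (pd v S x - (pd v (pd (\<kappa> x) F) x + pd (pd v \<kappa> x) F x)))) (at x)"
    unfolding H_def nor_def \<kappa>_def[symmetric]
    by (intro bounded_linear.has_derivative[OF bounded_linear_scaleR_right] has_derivative_diff
        differentiable_has_pd Sd pd_field_has_derivative smooth_F \<kappa>d)
  then have "pd a H x = (1 / real CARD('m)) *\<^sub>R (pd a S x - (pd a (pd (\<kappa> x) F) x + pd (pd a \<kappa> x) F x))"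
    by (rule pd_eq)
  moreover have "pinner (pd a H x) N = 0"
    using pinner_nor_left[OF N, of "pd a H x"] parallel_graph[OF par] by (simp add: pinner_simps)
  moreover have "pinner (pd (pd a \<kappa> x) F x) N = 0" using N by (simp add: normal_def pinner_commute)
  ultimately have 1: "pinner (pd a S x) N = Q a (\<kappa> x)"
    by (simp add: pinner_simps Q_def)
  have "pd a S x = (\<Sum>i\<in>UNIV. pd a (\<lambda>y. pd (E i y) (pd (E i y) F) y) x)"
    unfolding S_def
    by (rule pd_eq, intro has_derivative_sum differentiable_has_pd
        smooth_on_differentiable[OF smooth_on_pd_pd_field[OF smooth_F smooth_E] UNIV_I])
  then have 2: "pinner (pd a S x) N = (\<Sum>i\<in>UNIV. pinner (pd a (pd (E i x) (pd (E i x) F)) x) N)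
      + 2 * (\<Sum>i\<in>UNIV. Q (pd a (E i) x) (E i x))"
    by (simp add: pd_pd_pd_field[OF smooth_F Ed] pinner_simps Q_def sum.distrib sum_distrib_left)
  have 3: "(\<Sum>i\<in>UNIV. Q (T x (pd a (pd (E i x) F) x)) (E i x)) + (\<Sum>i\<in>UNIV. Q (pd a (E i) x) (E i x)) = 0"
    using frame_rotation[OF Q Qsym, of x a] by (simp add: Q.add_left sum.distrib)
  show ?thesis using 1 2 3 by (simp add: Q_def \<kappa>_def)
qed

end

section \<open>The estimate at a maximum point\<close>

lemma second_derivative_test:
  fixes R :: "real \<Rightarrow> real"
  assumes R: "\<And>t. (R has_real_derivative R1 t) (at t)" and R1: "(R1 has_real_derivative R2) (at 0)"
    and d: "0 < d" and max: "\<And>t. \<bar>t\<bar> < d \<Longrightarrow> R t \<le> R 0"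
  shows "R1 0 = 0" and "R2 \<le> 0"
proof -
  show R10: "R1 0 = 0"
    by (rule DERIV_local_max[OF R d]) (use max in auto)
  show "R2 \<le> 0"
  proof (rule ccontr)
    assume "\<not> R2 \<le> 0"
    then obtain d' where d': "d' > 0" "\<And>h. 0 < h \<Longrightarrow> h < d' \<Longrightarrow> R1 0 < R1 (0 + h)"
      using DERIV_pos_inc_right[OF R1] by auto
    define t where "t = min d d' / 2"
    have t: "0 < t" "t < d" "t < d'" using d d' by (auto simp: t_def)
    have "\<exists>z>0. z < t \<and> R t - R 0 = (t - 0) * R1 z"
      by (rule MVT2[OF t(1)]) (rule R)
    then obtain z where z: "0 < z" "z < t" "R t - R 0 = (t - 0) * R1 z" by (elim exE conjE)
    have "0 < R1 z" using d'(2)[of z] z t R10 by simp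
    then have "0 < R t - R 0" unfolding z(3) using t by simp
    then show False using max[of t] t by simp
  qed
qed

text \<open>First and second order conditions for a product with a power, divided by the common power of \<open>s\<close>.\<close>

lemma local_max_product:
  fixes \<psi> s :: "real \<Rightarrow> real"
  assumes \<psi>: "\<And>t. (\<psi> has_real_derivative \<psi>1 t) (at t)" "(\<psi>1 has_real_derivative \<psi>2) (at 0)"
    and s: "\<And>t. (s has_real_derivative s1 t) (at t)" "(s1 has_real_derivative s2) (at 0)"
    and s0: "0 < s 0" and d: "0 < d"
    and max: "\<And>t. \<bar>t\<bar> < d \<Longrightarrow> \<psi> t * s t ^ Suc (Suc n) \<le> \<psi> 0 * s 0 ^ Suc (Suc n)"
  defines "N \<equiv> real (Suc (Suc n))"
  shows "\<psi>1 0 * s 0 + N * \<psi> 0 * s1 0 = 0"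
    and "\<psi>2 * (s 0)\<^sup>2 + 2 * N * \<psi>1 0 * s 0 * s1 0 + N * \<psi> 0 * s 0 * s2
          + N * (N - 1) * \<psi> 0 * (s1 0)\<^sup>2 \<le> 0"
proof -
  define R1 where "R1 t = \<psi>1 t * s t ^ Suc (Suc n) + \<psi> t * (N * s t ^ Suc n * s1 t)" for t
  define R2 where "R2 = \<psi>2 * s 0 ^ Suc (Suc n) + 2 * (\<psi>1 0 * (N * s 0 ^ Suc n * s1 0))
    + \<psi> 0 * (N * ((N - 1) * s 0 ^ n * s1 0 * s1 0 + s 0 ^ Suc n * s2))"
  have 1: "((\<lambda>t. \<psi> t * s t ^ Suc (Suc n)) has_real_derivative R1 t) (at t)" for t
    unfolding R1_def N_def by (rule derivative_eq_intros \<psi>(1) s(1) refl)+ (simp add: algebra_simps)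
  have 2: "(R1 has_real_derivative R2) (at 0)"
    unfolding R1_def[abs_def] R2_def N_def
    by (rule derivative_eq_intros \<psi> s refl)+ (simp add: algebra_simps)
  note t = second_derivative_test[OF 1 2 d max]
  have "R1 0 = s 0 ^ Suc n * (\<psi>1 0 * s 0 + N * \<psi> 0 * s1 0)"
    unfolding R1_def by (simp add: algebra_simps)
  then show "\<psi>1 0 * s 0 + N * \<psi> 0 * s1 0 = 0" using t(1) s0 by simp
  have R2_eq: "R2 = s 0 ^ n * (\<psi>2 * (s 0)\<^sup>2 + 2 * N * \<psi>1 0 * s 0 * s1 0 + N * \<psi> 0 * s 0 * s2
          + N * (N - 1) * \<psi> 0 * (s1 0)\<^sup>2)"
    unfolding R2_def by (simp add: algebra_simps power2_eq_square)
  show "\<psi>2 * (s 0)\<^sup>2 + 2 * N * \<psi>1 0 * s 0 * s1 0 + N * \<psi> 0 * s 0 * s2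
          + N * (N - 1) * \<psi> 0 * (s1 0)\<^sup>2 \<le> 0"
    using t(2) zero_less_power[OF s0, of n] unfolding R2_eq by (simp add: mult_le_0_iff)
qed

text \<open>Split off the rank one part belonging to the eigenvector. It contributes \<open>\<mu>\<^sup>2\<close> to the squared norm, and the
  remainder has trace \<open>tr S - \<mu>\<close>, whose square is at most \<open>m\<close> times the squared norm.\<close>

lemma norm_eigenvector_trace:
  fixes S :: "'m::finite \<Rightarrow> 'm \<Rightarrow> real"
  assumes eig: "\<And>i. (\<Sum>j\<in>UNIV. S i j * \<alpha> j) = \<mu> * \<alpha> i" and A: "A = (\<Sum>i\<in>UNIV. (\<alpha> i)\<^sup>2)" "0 < A"
  shows "\<mu>\<^sup>2 + ((\<Sum>i\<in>UNIV. S i i) - \<mu>)\<^sup>2 / real CARD('m) \<le> (\<Sum>i\<in>UNIV. \<Sum>j\<in>UNIV. (S i j)\<^sup>2)"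
proof -
  define c where "c = \<mu> / A"
  define P where "P i j = S i j - c * (\<alpha> i * \<alpha> j)" for i j
  have aa: "(\<Sum>i\<in>UNIV. \<alpha> i * \<alpha> i) = A" using A(1) by (simp add: power2_eq_square)
  have cA: "c * A = \<mu>" using A(2) by (simp add: c_def)
  have aSa: "(\<Sum>i\<in>UNIV. \<Sum>j\<in>UNIV. S i j * (\<alpha> i * \<alpha> j)) = \<mu> * A"
  proof -
    have "(\<Sum>i\<in>UNIV. \<Sum>j\<in>UNIV. S i j * (\<alpha> i * \<alpha> j)) = (\<Sum>i\<in>UNIV. \<alpha> i * (\<Sum>j\<in>UNIV. S i j * \<alpha> j))"
      by (simp add: sum_distrib_left mult_ac)
    also have "\<dots> = (\<Sum>i\<in>UNIV. \<mu> * (\<alpha> i * \<alpha> i))" by (intro sum.cong refl) (simp add: eig)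
    also have "\<dots> = \<mu> * A" by (simp add: sum_distrib_left[symmetric] aa)
    finally show ?thesis .
  qed
  have aaaa: "(\<Sum>i\<in>UNIV. \<Sum>j\<in>UNIV. (\<alpha> i * \<alpha> j)\<^sup>2) = A * A"
    by (simp add: A(1) power_mult_distrib sum_product)
  have "(P i j)\<^sup>2 = (S i j)\<^sup>2 - 2 * c * (S i j * (\<alpha> i * \<alpha> j)) + c\<^sup>2 * (\<alpha> i * \<alpha> j)\<^sup>2" for i j
    by (simp add: P_def power2_eq_square algebra_simps)
  then have "(\<Sum>i\<in>UNIV. \<Sum>j\<in>UNIV. (P i j)\<^sup>2)
      = (\<Sum>i\<in>UNIV. \<Sum>j\<in>UNIV. (S i j)\<^sup>2) - 2 * c * (\<mu> * A) + c\<^sup>2 * (A * A)"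
    by (simp add: sum.distrib sum_subtractf sum_distrib_left[symmetric] aSa aaaa)
  also have "\<dots> = (\<Sum>i\<in>UNIV. \<Sum>j\<in>UNIV. (S i j)\<^sup>2) - 2 * (c * A) * \<mu> + (c * A) * (c * A)"
    by (simp add: power2_eq_square)
  also have "\<dots> = (\<Sum>i\<in>UNIV. \<Sum>j\<in>UNIV. (S i j)\<^sup>2) - \<mu>\<^sup>2"
    by (simp add: cA power2_eq_square)
  finally have norm: "(\<Sum>i\<in>UNIV. \<Sum>j\<in>UNIV. (P i j)\<^sup>2) = (\<Sum>i\<in>UNIV. \<Sum>j\<in>UNIV. (S i j)\<^sup>2) - \<mu>\<^sup>2" .
  have "(\<Sum>i\<in>UNIV. P i i) = (\<Sum>i\<in>UNIV. S i i) - c * A"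
    by (simp add: P_def sum_subtractf sum_distrib_left[symmetric] aa)
  then have tr: "(\<Sum>i\<in>UNIV. P i i) = (\<Sum>i\<in>UNIV. S i i) - \<mu>" by (simp add: cA)
  have "(\<Sum>i\<in>UNIV. P i i)\<^sup>2 \<le> (\<Sum>i\<in>UNIV. (P i i)\<^sup>2) * (\<Sum>i\<in>(UNIV::'m set). 1\<^sup>2)"
    using Cauchy_Schwarz_ineq_sum[of "\<lambda>i. P i i" "\<lambda>i. 1" UNIV] by simp
  moreover have "(\<Sum>i\<in>UNIV. (P i i)\<^sup>2) \<le> (\<Sum>i\<in>UNIV. \<Sum>j\<in>UNIV. (P i j)\<^sup>2)"
    by (rule sum_mono) (rule member_le_sum, auto)
  ultimately have "(\<Sum>i\<in>UNIV. P i i)\<^sup>2 \<le> (\<Sum>i\<in>UNIV. \<Sum>j\<in>UNIV. (P i j)\<^sup>2) * real CARD('m)"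
    by (smt (verit, best) mult_right_mono of_nat_0_le_iff power_one real_of_card sum.cong)
  then show ?thesis unfolding tr norm by (simp add: field_simps)
qed

text \<open>The conditions at a maximum of \<open>w s\<^sup>N\<close>, summed over an orthonormal basis. The first order condition says that
  \<open>\<alpha>\<close>, the coordinates of the tangential position vector, is an eigenvector of \<open>S\<close> for \<open>N w / s\<close>. Inserted into the
  second order condition together with the lower bounds for the squared norm of \<open>S\<close> and for \<open>\<beta>\<close>, it makes the terms
  in \<open>N\<^sup>2 w\<^sup>2\<close> cancel. Only the trace defect survives with a favourable sign.\<close>

lemma summed_inequality:
  fixes S :: "'m::finite \<Rightarrow> 'm \<Rightarrow> real"
  defines "tr \<equiv> \<Sum>i\<in>UNIV. S i i" and "m \<equiv> real CARD('m)"
  assumes w: "0 < w" and s: "0 < s" and z: "0 \<le> z"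
    and A: "(\<Sum>i\<in>UNIV. (\<alpha> i)\<^sup>2) = z + w"
    and crit: "\<And>i. 2 * (\<Sum>j\<in>UNIV. S i j * \<alpha> j) * s + N * w * (- 2 * \<alpha> i) = 0"
    and second: "\<And>i. \<psi> i * s\<^sup>2 + 2 * N * (2 * (\<Sum>j\<in>UNIV. S i j * \<alpha> j)) * s * (- 2 * \<alpha> i)
        + N * w * s * (- 2 - 2 * S i i) + N * (N - 1) * w * (- 2 * \<alpha> i)\<^sup>2 \<le> 0"
    and \<psi>: "(\<Sum>i\<in>UNIV. \<psi> i) = 2 * (\<Sum>i\<in>UNIV. \<beta> i) + 2 * (\<Sum>i\<in>UNIV. \<Sum>j\<in>UNIV. (S i j)\<^sup>2) + 2 * tr"
    and \<beta>: "\<And>i. (\<Sum>j\<in>UNIV. S i j * \<alpha> j)\<^sup>2 \<le> \<beta> i * w"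
  shows "2 / m * (tr - N * w / s)\<^sup>2 * s\<^sup>2 + 2 * tr * s\<^sup>2 - 2 * N\<^sup>2 * w * z - 4 * N * w * (z + w)
      - 2 * N * w * s * (m + tr) \<le> 0"
proof -
  define \<mu> where "\<mu> = N * w / s"
  define Sa where "Sa i = (\<Sum>j\<in>UNIV. S i j * \<alpha> j)" for i
  have \<mu>s: "\<mu> * s = N * w" using s by (simp add: \<mu>_def)
  have Sa: "Sa i = \<mu> * \<alpha> i" for i
  proof -
    have "Sa i * s = N * w * \<alpha> i" using crit[of i] unfolding Sa_def by simp
    then show ?thesis using s by (simp add: \<mu>_def field_simps)
  qed
  define n2 where "n2 = (\<Sum>i\<in>UNIV. \<Sum>j\<in>UNIV. (S i j)\<^sup>2)"
  have eig: "\<mu>\<^sup>2 + (tr - \<mu>)\<^sup>2 / m \<le> n2"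
    unfolding tr_def m_def n2_def
    by (rule norm_eigenvector_trace[where \<alpha>=\<alpha> and A="z + w"]) (use Sa A w z in \<open>auto simp: Sa_def\<close>)
  have "0 \<ge> (\<Sum>i\<in>UNIV. \<psi> i * s\<^sup>2 + 2 * N * (2 * Sa i) * s * (- 2 * \<alpha> i)
        + N * w * s * (- 2 - 2 * S i i) + N * (N - 1) * w * (- 2 * \<alpha> i)\<^sup>2)"
    unfolding Sa_def by (intro sum_nonpos second)
  also have "(\<Sum>i\<in>UNIV. \<psi> i * s\<^sup>2 + 2 * N * (2 * Sa i) * s * (- 2 * \<alpha> i)
        + N * w * s * (- 2 - 2 * S i i) + N * (N - 1) * w * (- 2 * \<alpha> i)\<^sup>2)
     = (\<Sum>i\<in>UNIV. \<psi> i * s\<^sup>2 + (- 8 * N * (\<mu> * s)) * (\<alpha> i)\<^sup>2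
        + (N * w * s * (- 2) + N * w * s * (- 2) * S i i) + 4 * (N * (N - 1) * w) * (\<alpha> i)\<^sup>2)"
    by (intro sum.cong refl) (simp add: Sa power2_eq_square algebra_simps)
  also have "\<dots> = (\<Sum>i\<in>UNIV. \<psi> i) * s\<^sup>2 + (- 8 * N * (\<mu> * s)) * (z + w)
        + (N * w * s * (- 2) * m + N * w * s * (- 2) * tr) + 4 * (N * (N - 1) * w) * (z + w)"
    by (simp add: sum.distrib sum_distrib_left[symmetric] sum_distrib_right[symmetric] A tr_def m_def sum_negf
        sum_subtractf)
  finally have 1: "(\<Sum>i\<in>UNIV. \<psi> i) * s\<^sup>2 + (- 8 * N * (\<mu> * s)) * (z + w)
        + (N * w * s * (- 2) * m + N * w * s * (- 2) * tr) + 4 * (N * (N - 1) * w) * (z + w) \<le> 0" .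
  have "\<mu>\<^sup>2 * (z + w) = (\<Sum>i\<in>UNIV. (Sa i)\<^sup>2)"
    by (simp add: Sa power_mult_distrib sum_distrib_left[symmetric] A)
  also have "\<dots> \<le> (\<Sum>i\<in>UNIV. \<beta> i) * w"
    unfolding sum_distrib_right Sa_def by (intro sum_mono \<beta>)
  finally have 2: "\<mu>\<^sup>2 * (z + w) / w \<le> (\<Sum>i\<in>UNIV. \<beta> i)" using w by (simp add: field_simps)
  have "(\<mu>\<^sup>2 * (z + w) / w) * s\<^sup>2 = (\<mu> * s) * (\<mu> * s) * (z + w) / w" by (simp add: power2_eq_square)
  also have "\<dots> = N\<^sup>2 * w * (z + w)" unfolding \<mu>s using w by (simp add: power2_eq_square)
  finally have 3: "(\<mu>\<^sup>2 * (z + w) / w) * s\<^sup>2 = N\<^sup>2 * w * (z + w)" .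
  have "\<mu>\<^sup>2 * s\<^sup>2 = (\<mu> * s) * (\<mu> * s)" by (simp add: power2_eq_square)
  then have 4: "\<mu>\<^sup>2 * s\<^sup>2 = N\<^sup>2 * w\<^sup>2" unfolding \<mu>s by (simp add: power2_eq_square)
  have s2: "0 \<le> s\<^sup>2" by simp
  have 5: "N\<^sup>2 * w * (z + w) \<le> (\<Sum>i\<in>UNIV. \<beta> i) * s\<^sup>2"
    using mult_right_mono[OF 2 s2] unfolding 3 .
  have 6: "N\<^sup>2 * w\<^sup>2 + (tr - \<mu>)\<^sup>2 / m * s\<^sup>2 \<le> n2 * s\<^sup>2"
    using mult_right_mono[OF eig s2] by (simp add: distrib_right 4)
  have "(\<Sum>i\<in>UNIV. \<psi> i) * s\<^sup>2 = 2 * ((\<Sum>i\<in>UNIV. \<beta> i) * s\<^sup>2) + 2 * (n2 * s\<^sup>2) + 2 * tr * s\<^sup>2"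
    unfolding \<psi> n2_def by (simp add: algebra_simps)
  moreover define P U V D where "P = (\<Sum>i\<in>UNIV. \<psi> i) * s\<^sup>2"
    and "U = N\<^sup>2 * w * (z + w)" and "V = N\<^sup>2 * w\<^sup>2 + (tr - \<mu>)\<^sup>2 / m * s\<^sup>2"
    and "D = (- 8 * N * (\<mu> * s)) * (z + w)
        + (N * w * s * (- 2) * m + N * w * s * (- 2) * tr) + 4 * (N * (N - 1) * w) * (z + w)"
  moreover have "P + D \<le> 0" using 1 by (simp add: P_def D_def)
  moreover define R where "R = 2 * tr * s\<^sup>2"
  ultimately have "2 * U + 2 * V + R + D \<le> 0" using 5 6 by linarith
  then have "2 * U + 2 * V + 2 * tr * s\<^sup>2 + (- 8 * N * (N * w)) * (z + w)
      + (N * w * s * (- 2) * m + N * w * s * (- 2) * tr) + 4 * (N * (N - 1) * w) * (z + w) \<le> 0"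
    unfolding D_def \<mu>s R_def by simp
  moreover define Y where "Y = (tr - \<mu>)\<^sup>2 / m * s\<^sup>2"
  moreover have "2 / m * (tr - \<mu>)\<^sup>2 * s\<^sup>2 = 2 * Y" by (simp add: Y_def)
  ultimately show ?thesis unfolding \<mu>_def[symmetric] U_def V_def
    by (simp add: power2_eq_square algebra_simps)
qed

text \<open>For \<open>N = 8 m\<close> the trace defect contributes \<open>64 m w\<^sup>2\<close>, which beats the unfavourable \<open>32 m w\<^sup>2\<close>. The other
  terms are of lower order in \<open>q\<close>, with \<open>b\<close> supplying the missing homogeneity.\<close>

lemma inequality_gives_bound:
  fixes m h q b s z tr :: real
  assumes m: "1 \<le> m" and h: "0 \<le> h" and q: "1 \<le> q" and b: "1 \<le> b" and s: "0 < s" "s \<le> b"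
    and z: "0 \<le> z" "z \<le> b" and tr: "\<bar>tr\<bar> \<le> h * q"
    and ineq: "2 / m * (tr - 8 * m * q\<^sup>2 / s)\<^sup>2 * s\<^sup>2 + 2 * tr * s\<^sup>2 - 2 * (8 * m)\<^sup>2 * q\<^sup>2 * z
        - 4 * (8 * m) * q\<^sup>2 * (z + q\<^sup>2) - 2 * (8 * m) * q\<^sup>2 * s * (m + tr) \<le> 0"
  shows "q \<le> (6 * m + 2 * h + 1) * b"
proof (rule ccontr)
  define w where "w = q\<^sup>2"
  have w: "0 < w" "q \<le> w" "1 \<le> w" using q by (auto simp: w_def power2_eq_square mult_ge1_I)
  assume "\<not> ?thesis"
  then have big: "(6 * m + 2 * h + 1) * b < q" by simp
  have s2: "s\<^sup>2 \<le> b\<^sup>2" using s by (intro power_mono) auto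
  have zb: "z \<le> b\<^sup>2" using z(2) b by (simp add: power2_eq_square) (metis b mult_left_mono mult.right_neutral order_trans zero_le_one)
  have tr2: "tr\<^sup>2 \<le> h\<^sup>2 * w"
    using power_mono[OF tr, of 2] by (simp add: w_def power_mult_distrib)
  define \<mu> where "\<mu> = 8 * m * w / s"
  have \<mu>s: "\<mu> * s = 8 * m * w" using s by (simp add: \<mu>_def)
  have sq: "\<mu>\<^sup>2 / 2 - tr\<^sup>2 \<le> (tr - \<mu>)\<^sup>2"
  proof -
    have "(tr - \<mu>)\<^sup>2 - (\<mu>\<^sup>2 / 2 - tr\<^sup>2) = (2 * tr - \<mu>)\<^sup>2 / 2" by (simp add: power2_eq_square algebra_simps)
    then show ?thesis by (smt (verit) zero_le_power2 divide_nonneg_pos)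
  qed
  have "\<mu>\<^sup>2 * s\<^sup>2 = (\<mu> * s) * (\<mu> * s)" by (simp add: power2_eq_square)
  then have \<mu>2: "\<mu>\<^sup>2 * s\<^sup>2 = 64 * m\<^sup>2 * w\<^sup>2" unfolding \<mu>s by (simp add: power2_eq_square)
  have "2 / m * (\<mu>\<^sup>2 / 2 - tr\<^sup>2) * s\<^sup>2 \<le> 2 / m * (tr - \<mu>)\<^sup>2 * s\<^sup>2"
    using sq m by (intro mult_right_mono mult_left_mono) auto
  moreover have "2 / m * (\<mu>\<^sup>2 / 2 - tr\<^sup>2) * s\<^sup>2 = (\<mu>\<^sup>2 * s\<^sup>2) / m - 2 / m * (tr\<^sup>2 * s\<^sup>2)"
    using m by (simp add: field_simps)
  moreover have "(\<mu>\<^sup>2 * s\<^sup>2) / m = 64 * m * w\<^sup>2" unfolding \<mu>2 using m by (simp add: power2_eq_square)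
  moreover have "2 / m * (tr\<^sup>2 * s\<^sup>2) \<le> 2 * (h\<^sup>2 * w * b\<^sup>2)"
  proof -
    have "2 / m \<le> 2" using m by (simp add: field_simps)
    moreover have "tr\<^sup>2 * s\<^sup>2 \<le> h\<^sup>2 * w * b\<^sup>2" using tr2 s2 w by (intro mult_mono) auto
    ultimately show ?thesis by (rule mult_mono) auto
  qed
  ultimately have 1: "64 * m * w\<^sup>2 - 2 * (h\<^sup>2 * w * b\<^sup>2) \<le> 2 / m * (tr - \<mu>)\<^sup>2 * s\<^sup>2" by linarith
  have 2: "- (2 * (h * w * b\<^sup>2)) \<le> 2 * tr * s\<^sup>2"
  proof -
    have "\<bar>tr\<bar> * s\<^sup>2 \<le> (h * w) * b\<^sup>2"
      using tr s2 w h by (intro mult_mono order_trans[OF tr] mult_left_mono) auto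
    moreover have "- (\<bar>tr\<bar> * s\<^sup>2) \<le> tr * s\<^sup>2" by (metis abs_ge_minus_self minus_le_iff mult_minus_left mult_right_mono zero_le_power2)
    ultimately show ?thesis by linarith
  qed
  have 3: "2 * (8 * m)\<^sup>2 * w * z \<le> 128 * (m\<^sup>2 * w * b\<^sup>2)"
  proof -
    have "m\<^sup>2 * w * z \<le> m\<^sup>2 * w * b\<^sup>2" using zb w by (intro mult_left_mono) auto
    then show ?thesis by (simp add: power_mult_distrib)
  qed
  have 4: "4 * (8 * m) * w * (z + w) \<le> 32 * (m\<^sup>2 * w * b\<^sup>2) + 32 * m * w\<^sup>2"
  proof -
    have "m * w * z \<le> m\<^sup>2 * w * b\<^sup>2" using zb w m z
      by (intro mult_mono) (auto simp: power2_eq_square)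
    then show ?thesis by (simp add: algebra_simps power2_eq_square)
  qed
  have 5: "2 * (8 * m) * w * s * (m + tr) \<le> 16 * (m\<^sup>2 * w * b\<^sup>2) + 16 * (m * w * b * (h * q))"
  proof -
    have "m * w * s * (m + tr) \<le> m * w * b * (m + h * q)"
    proof -
      have "m * w * s * (m + tr) \<le> m * w * s * (m + h * q)"
        using tr s w m by (intro mult_left_mono) auto
      also have "\<dots> \<le> m * w * b * (m + h * q)"
        using s w m h q by (intro mult_right_mono mult_left_mono) auto
      finally show ?thesis .
    qed
    also have "\<dots> = m * w * b * m + m * w * b * (h * q)" by (simp add: distrib_left)
    also have "m * w * b * m \<le> m\<^sup>2 * w * b\<^sup>2"
    proof -
      have "b \<le> b\<^sup>2" using b by (simp add: power2_eq_square)
      then have "(m * m * w) * b \<le> (m * m * w) * b\<^sup>2" using m w by (intro mult_left_mono) auto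
      then show ?thesis by (simp add: power2_eq_square mult_ac)
    qed
    finally show ?thesis by linarith
  qed
  have "64 * m * w\<^sup>2 - 2 * (h\<^sup>2 * w * b\<^sup>2) - 2 * (h * w * b\<^sup>2) - 128 * (m\<^sup>2 * w * b\<^sup>2)
     - (32 * (m\<^sup>2 * w * b\<^sup>2) + 32 * m * w\<^sup>2) - (16 * (m\<^sup>2 * w * b\<^sup>2) + 16 * (m * w * b * (h * q))) \<le> 0"
    using ineq[folded w_def, folded \<mu>_def] 1 2 3 4 5 by linarith
  then have "w * (32 * m * w - (2 * h\<^sup>2 + 2 * h + 176 * m\<^sup>2) * b\<^sup>2 - 16 * m * (h * b) * q) \<le> 0"
    by (simp add: power2_eq_square algebra_simps)
  then have 6: "32 * m * q\<^sup>2 \<le> (2 * h\<^sup>2 + 2 * h + 176 * m\<^sup>2) * b\<^sup>2 + 16 * m * (h * b) * q"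
    using w(1) by (simp add: mult_le_0_iff w_def)
  have hb: "h * b \<le> q / 2" "0 \<le> h * b"
  proof -
    have "2 * (h * b) \<le> (6 * m + 2 * h + 1) * b" using m b h by (simp add: algebra_simps)
    then show "h * b \<le> q / 2" using big by linarith
  qed (use h b in auto)
  have "16 * m * (h * b) * q \<le> 16 * m * (q / 2) * q"
    using hb m q by (intro mult_right_mono mult_left_mono) auto
  then have 7: "16 * m * (h * b) * q \<le> 8 * m * q\<^sup>2" by (simp add: power2_eq_square)
  have "((6 * m + 2 * h + 1) * b)\<^sup>2 \<le> q\<^sup>2"
    using big m h b by (intro power_mono) auto
  then have 8: "(36 * m\<^sup>2 + 4 * h\<^sup>2 + 4 * h) * b\<^sup>2 \<le> q\<^sup>2"
  proof -
    have "36 * m\<^sup>2 + 4 * h\<^sup>2 + 4 * h \<le> (6 * m + 2 * h + 1)\<^sup>2"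
      using m h by (simp add: power2_eq_square algebra_simps)
    then have "(36 * m\<^sup>2 + 4 * h\<^sup>2 + 4 * h) * b\<^sup>2 \<le> (6 * m + 2 * h + 1)\<^sup>2 * b\<^sup>2" by (intro mult_right_mono) auto
    then show ?thesis using \<open>((6 * m + 2 * h + 1) * b)\<^sup>2 \<le> q\<^sup>2\<close> by (simp add: power_mult_distrib)
  qed
  have "(2 * h\<^sup>2 + 2 * h + 176 * m\<^sup>2) * b\<^sup>2 \<le> 5 * ((36 * m\<^sup>2 + 4 * h\<^sup>2 + 4 * h) * b\<^sup>2)"
    unfolding mult.assoc[symmetric] using h by (intro mult_right_mono) auto
  then have "32 * m * q\<^sup>2 \<le> 5 * q\<^sup>2 + 8 * m * q\<^sup>2" using 6 7 8 by linarith
  moreover have "q\<^sup>2 \<le> m * q\<^sup>2" using mult_right_mono[OF m, of "q\<^sup>2"] by simp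
  moreover have "0 < q\<^sup>2" using q by simp
  ultimately show False by linarith
qed

text \<open>The acceleration \<open>k\<close> is at disposal: it replaces the correction by Christoffel symbols in a covariant
  second derivative.\<close>

lemma smooth_along_parabola:
  fixes g :: "'a::euclidean_space \<Rightarrow> 'b::euclidean_space" and p e k :: 'a
  assumes g: "smooth_on UNIV g"
  defines "y \<equiv> \<lambda>t. p + t *\<^sub>R e + (t\<^sup>2 / 2) *\<^sub>R k"
  shows "((\<lambda>t. g (y t)) has_vector_derivative pd e g (y t) + t *\<^sub>R pd k g (y t)) (at t)"
    and "((\<lambda>t. pd e g (y t) + t *\<^sub>R pd k g (y t)) has_vector_derivative pd e (pd e g) p + pd k g p) (at 0)"
proof -
  have y: "(y has_derivative (\<lambda>h. h *\<^sub>R (e + t *\<^sub>R k))) (at t)" for t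
    unfolding y_def
    by (auto intro!: derivative_eq_intros simp: algebra_simps)
  have y0: "y 0 = p" by (simp add: y_def)
  have 1: "((\<lambda>t. g (y t)) has_vector_derivative pd e g (y t) + t *\<^sub>R pd k g (y t)) (at t)"
    if g: "smooth_on UNIV g" for g :: "'a \<Rightarrow> 'b" and t
  proof -
    have d: "g differentiable (at (y t))" using smooth_on_differentiable[OF g] by simp
    interpret bounded_linear "\<lambda>v. pd v g (y t)" using bounded_linear_pd[OF d] .
    show ?thesis
      using has_derivative_compose[OF y differentiable_has_pd[OF d]]
      unfolding has_vector_derivative_def by (simp add: scaleR add)
  qed
  show "((\<lambda>t. g (y t)) has_vector_derivative pd e g (y t) + t *\<^sub>R pd k g (y t)) (at t)"
    by (rule 1[OF g])
  have "((\<lambda>t. pd e g (y t) + t *\<^sub>R pd k g (y t)) has_vector_derivative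
      (pd e (pd e g) (y 0) + 0 *\<^sub>R pd k (pd e g) (y 0))
      + (0 *\<^sub>R (pd e (pd k g) (y 0) + 0 *\<^sub>R pd k (pd k g) (y 0)) + 1 *\<^sub>R pd k g (y 0))) (at 0)"
    by (intro has_vector_derivative_add has_vector_derivative_scaleR 1 smooth_on_pd g) auto
  then show "((\<lambda>t. pd e g (y t) + t *\<^sub>R pd k g (y t)) has_vector_derivative pd e (pd e g) p + pd k g p) (at 0)"
    by (simp add: y0)
qed

lemma pinner_self_derivative:
  fixes u :: "real \<Rightarrow> ('m::finite, 'n::finite) pseudo"
  assumes u: "\<And>t. (u has_vector_derivative u1 t) (at t)" and u1: "(u1 has_vector_derivative u2) (at 0)"
  shows "((\<lambda>t. pinner (u t) (u t)) has_real_derivative 2 * pinner (u t) (u1 t)) (at t)"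
    and "((\<lambda>t. 2 * pinner (u t) (u1 t)) has_real_derivative
          2 * (pinner (u1 0) (u1 0) + pinner (u 0) u2)) (at 0)"
proof -
  have "((\<lambda>t. pinner (u t) (u t)) has_vector_derivative pinner (u t) (u1 t) + pinner (u1 t) (u t)) (at t)"
    by (rule pinner.has_vector_derivative[OF u u])
  then show "((\<lambda>t. pinner (u t) (u t)) has_real_derivative 2 * pinner (u t) (u1 t)) (at t)"
    by (simp add: has_real_derivative_iff_has_vector_derivative pinner_commute)
  have "((\<lambda>t. pinner (u t) (u1 t)) has_vector_derivative pinner (u 0) u2 + pinner (u1 0) (u1 0)) (at 0)"
    by (rule pinner.has_vector_derivative[OF u u1])
  then have "((\<lambda>t. pinner (u t) (u1 t)) has_real_derivative pinner (u1 0) (u1 0) + pinner (u 0) u2) (at 0)"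
    by (simp add: has_real_derivative_iff_has_vector_derivative add.commute)
  from DERIV_cmult[OF this, of 2]
  show "((\<lambda>t. 2 * pinner (u t) (u1 t)) has_real_derivative
          2 * (pinner (u1 0) (u1 0) + pinner (u 0) u2)) (at 0)" .
qed

context spacelike_graph
begin

text \<open>The position vector relative to a point of the graph, its square \<open>z\<close> (the pseudo-distance function), and the
  squared length \<open>w\<close> of its normal part, with the sign that makes it nonnegative.\<close>

definition X :: "real^'m \<Rightarrow> real^'m \<Rightarrow> ('m, 'n) pseudo" where "X x0 x = F x - F x0"
definition z :: "real^'m \<Rightarrow> real^'m \<Rightarrow> real" where "z x0 x = pinner (X x0 x) (X x0 x)"
definition w :: "real^'m \<Rightarrow> real^'m \<Rightarrow> real" where
  "w x0 x = - pinner (nor x (X x0 x)) (nor x (X x0 x))"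

lemma w_nonneg: "0 \<le> w x0 x"
  using normal_nonpos[OF normal_nor] by (simp add: w_def)

lemma z_plus_w: "z x0 x + w x0 x = G x (T x (X x0 x)) (T x (X x0 x))"
  by (simp add: z_def w_def split_pinner[of "X x0 x" "X x0 x" x])

text \<open>Among all tangent vectors, the tangential part of \<open>X\<close> is the best approximation of \<open>X\<close>. So \<open>w\<close> may be
  differentiated at a maximum through lower barriers in which the tangential part is replaced by a convenient field.\<close>

lemma w_lower_bound: "- pinner (X x0 x - pd a F x) (X x0 x - pd a F x) \<le> w x0 x"
proof -
  let ?y = "X x0 x - pd a F x"
  have "nor x ?y = nor x (X x0 x)" by (simp add: nor.diff nor_L)
  then have "pinner ?y ?y = G x (T x ?y) (T x ?y) - w x0 x"
    by (simp add: split_pinner[of ?y ?y x] w_def)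
  then show ?thesis using pf.nonneg[of x "T x ?y"] by simp
qed

lemma smooth_X: "smooth_on UNIV (X x0)"
  unfolding X_def by (intro smooth_on_diff smooth_F smooth_on_const) auto

lemma continuous_z: "continuous_on UNIV (z x0)"
  unfolding z_def
  by (intro smooth_on_continuous smooth_on_bilinear[OF _ bounded_bilinear_pinner] smooth_X) auto

lemma continuous_w: "continuous_on UNIV (w x0)"
  unfolding w_def nor_def
  by (intro smooth_on_continuous smooth_on_minus smooth_on_bilinear[OF _ bounded_bilinear_pinner]
      smooth_on_diff smooth_X smooth_on_pd_field smooth_F smooth_T) auto

text \<open>The barrier of \<open>w_lower_bound\<close> along the parabola \<open>p + t e + t\<^sup>2 k / 2\<close>, with the tangential part
  of \<open>X\<close> replaced by the affine coordinate field \<open>a + t c\<close>. The barrier touches at \<open>t = 0\<close>, so that it inherits the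
  local maximum whatever \<open>e\<close>, \<open>k\<close> and \<open>c\<close> are. Here \<open>\<nu>1\<close> and \<open>\<nu>2\<close> are the first two derivatives of \<open>X - dF(a + t c)\<close>.\<close>

lemma maximum_variation:
  fixes n :: nat and b :: real and x0 p e c k :: "real^'m"
  assumes sp: "z x0 p < b"
    and max: "\<And>x. z x0 x < b \<Longrightarrow> w x0 x * (b - z x0 x) ^ Suc (Suc n) \<le> w x0 p * (b - z x0 p) ^ Suc (Suc n)"
  defines "N \<equiv> real (Suc (Suc n))"
    and "N0 \<equiv> nor p (X x0 p)" and "a \<equiv> T p (X x0 p)" and "s \<equiv> b - z x0 p"
    and "\<nu>1 \<equiv> pd e F p - pd e (pd (T p (X x0 p)) F) p - pd c F p"
    and "\<nu>2 \<equiv> pd e (pd e F) p + pd k F p - pd e (pd e (pd (T p (X x0 p)) F)) p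
        - pd k (pd (T p (X x0 p)) F) p - 2 *\<^sub>R pd e (pd c F) p"
    and "s2 \<equiv> - 2 * (G p e e + pinner (X x0 p) (pd e (pd e F) p + pd k F p))"
  shows "- 2 * pinner N0 \<nu>1 * s + N * w x0 p * (- 2 * G p a e) = 0"
    and "- 2 * (pinner \<nu>1 \<nu>1 + pinner N0 \<nu>2) * s\<^sup>2 + 2 * N * (- 2 * pinner N0 \<nu>1) * s * (- 2 * G p a e)
      + N * w x0 p * s * s2 + N * (N - 1) * w x0 p * (- 2 * G p a e)\<^sup>2 \<le> 0"
proof -
  define y where "y t = p + t *\<^sub>R e + (t\<^sup>2 / 2) *\<^sub>R k" for t
  have y0: "y 0 = p" by (simp add: y_def)
  define g0 where "g0 x = X x0 x - pd a F x" for x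
  define g1 where "g1 = pd c F"
  have g0: "smooth_on UNIV g0"
    unfolding g0_def by (intro smooth_on_diff smooth_X smooth_on_pd smooth_F) auto
  have g1: "smooth_on UNIV g1" unfolding g1_def by (rule smooth_on_pd[OF smooth_F])
  have Xd: "X x0 differentiable (at x)" "pd v F differentiable (at x)" "pd u (pd v F) differentiable (at x)" for x u v
    using smooth_on_differentiable[OF smooth_X] pd_F_diff
      smooth_on_differentiable[OF smooth_on_pd[OF smooth_on_pd[OF smooth_F]]] by auto
  have pdX': "pd v (X x0) x = pd v F x" for v x
  proof -
    have "(X x0 has_derivative (\<lambda>v. pd v F x - 0)) (at x)"
      unfolding X_def by (intro has_derivative_diff differentiable_has_pd F_diff has_derivative_const)
    from pd_eq[OF this] show "pd v (X x0) x = pd v F x" by simp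
  qed
  then have pdX: "pd v (X x0) = pd v F" for v by (rule ext)
  have pdg0: "pd v g0 = (\<lambda>x. pd v F x - pd v (pd a F) x)" for v
  proof
    fix x
    have "(g0 has_derivative (\<lambda>v. pd v (X x0) x - pd v (pd a F) x)) (at x)"
      unfolding g0_def by (intro has_derivative_diff differentiable_has_pd Xd)
    from pd_eq[OF this] show "pd v g0 x = pd v F x - pd v (pd a F) x" by (simp add: pdX')
  qed
  have pdpdg0: "pd e (pd e g0) x = pd e (pd e F) x - pd e (pd e (pd a F)) x" for x
    unfolding pdg0 by (rule pd_eq) (intro has_derivative_diff differentiable_has_pd Xd)
  define u where "u t = g0 (y t) - t *\<^sub>R g1 (y t)" for t
  define u1 where "u1 t = (pd e g0 (y t) + t *\<^sub>R pd k g0 (y t))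
      - (t *\<^sub>R (pd e g1 (y t) + t *\<^sub>R pd k g1 (y t)) + 1 *\<^sub>R g1 (y t))" for t
  have u: "(u has_vector_derivative u1 t) (at t)" for t
    unfolding u_def u1_def y_def
    by (intro has_vector_derivative_diff has_vector_derivative_scaleR smooth_along_parabola(1) g0 g1) auto
  have c0: "((\<lambda>t. pd e g1 (y t) + t *\<^sub>R pd k g1 (y t)) has_vector_derivative pd e (pd e g1) p + pd k g1 p) (at 0)"
    unfolding y_def by (rule smooth_along_parabola(2)[OF g1])
  have c1: "((\<lambda>t. pd e g0 (y t) + t *\<^sub>R pd k g0 (y t)) has_vector_derivative pd e (pd e g0) p + pd k g0 p) (at 0)"
    unfolding y_def by (rule smooth_along_parabola(2)[OF g0])
  have "(u1 has_vector_derivative (pd e (pd e g0) p + pd k g0 p)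
      - ((0 *\<^sub>R (pd e (pd e g1) p + pd k g1 p) + 1 *\<^sub>R (pd e g1 (y 0) + 0 *\<^sub>R pd k g1 (y 0)))
        + 1 *\<^sub>R (pd e g1 (y 0) + 0 *\<^sub>R pd k g1 (y 0)))) (at 0)"
    unfolding u1_def
  proof (rule has_vector_derivative_diff[OF c1 has_vector_derivative_add])
    show "((\<lambda>t. t *\<^sub>R (pd e g1 (y t) + t *\<^sub>R pd k g1 (y t))) has_vector_derivative
        0 *\<^sub>R (pd e (pd e g1) p + pd k g1 p) + 1 *\<^sub>R (pd e g1 (y 0) + 0 *\<^sub>R pd k g1 (y 0))) (at 0)"
      by (rule has_vector_derivative_scaleR[OF _ c0]) auto
    show "((\<lambda>t. 1 *\<^sub>R g1 (y t)) has_vector_derivative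
        1 *\<^sub>R (pd e g1 (y 0) + 0 *\<^sub>R pd k g1 (y 0))) (at 0)"
      unfolding y_def scaleR_one by (rule smooth_along_parabola(1)[OF g1])
  qed
  moreover have "(pd e (pd e g0) p + pd k g0 p)
      - ((0 *\<^sub>R (pd e (pd e g1) p + pd k g1 p) + 1 *\<^sub>R (pd e g1 (y 0) + 0 *\<^sub>R pd k g1 (y 0)))
        + 1 *\<^sub>R (pd e g1 (y 0) + 0 *\<^sub>R pd k g1 (y 0))) = \<nu>2"
    unfolding pdpdg0 y0
    by (simp add: fun_cong[OF pdg0] g1_def \<nu>2_def a_def[symmetric] scaleR_2 algebra_simps)
  ultimately have u2: "(u1 has_vector_derivative \<nu>2) (at 0)" by simp
  have u10: "u1 0 = \<nu>1" by (simp add: u1_def y0 fun_cong[OF pdg0] g1_def \<nu>1_def a_def)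
  have u0: "u 0 = N0" by (simp add: u_def y0 g0_def N0_def nor_def a_def)
  define \<psi> where "\<psi> t = - pinner (u t) (u t)" for t
  define \<psi>1 where "\<psi>1 t = - (2 * pinner (u t) (u1 t))" for t
  have \<psi>: "(\<psi> has_real_derivative \<psi>1 t) (at t)" for t
    unfolding \<psi>_def \<psi>1_def by (intro DERIV_minus pinner_self_derivative(1)[OF u u2])
  have \<psi>1: "(\<psi>1 has_real_derivative - (2 * (pinner (u1 0) (u1 0) + pinner (u 0) \<nu>2))) (at 0)"
    unfolding \<psi>1_def by (intro DERIV_minus pinner_self_derivative(2)[OF u u2])
  define Y1 where "Y1 t = pd e (X x0) (y t) + t *\<^sub>R pd k (X x0) (y t)" for t
  have Y: "((\<lambda>t. X x0 (y t)) has_vector_derivative Y1 t) (at t)" for t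
    unfolding Y1_def y_def by (rule smooth_along_parabola(1)[OF smooth_X])
  have Y1: "(Y1 has_vector_derivative pd e (pd e (X x0)) p + pd k (X x0) p) (at 0)"
    unfolding Y1_def y_def by (rule smooth_along_parabola(2)[OF smooth_X])
  define \<sigma> where "\<sigma> t = b - z x0 (y t)" for t
  define \<sigma>1 where "\<sigma>1 t = 0 - 2 * pinner (X x0 (y t)) (Y1 t)" for t
  have \<sigma>: "(\<sigma> has_real_derivative \<sigma>1 t) (at t)" for t
    unfolding \<sigma>_def \<sigma>1_def z_def
    by (intro DERIV_diff DERIV_const pinner_self_derivative(1)[OF Y Y1])
  have \<sigma>1: "(\<sigma>1 has_real_derivative 0 - 2 * (pinner (Y1 0) (Y1 0) + pinner (X x0 (y 0)) (pd e (pd e (X x0)) p + pd k (X x0) p))) (at 0)"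
    unfolding \<sigma>1_def
    by (intro DERIV_diff DERIV_const pinner_self_derivative(2)[OF Y Y1])
  have \<sigma>0: "\<sigma> 0 = s" by (simp add: \<sigma>_def y0 s_def)
  have \<psi>0: "\<psi> 0 = w x0 p" by (simp add: \<psi>_def u0 N0_def w_def)
  have "open {t. z x0 (y t) < b}"
  proof -
    have "continuous_on UNIV (\<lambda>t. z x0 (y t))"
      unfolding y_def by (intro continuous_on_compose2[OF continuous_z] continuous_intros) auto
    then show ?thesis by (intro open_Collect_less continuous_on_const)
  qed
  moreover have "0 \<in> {t. z x0 (y t) < b}" using sp by (simp add: y0)
  ultimately obtain d where d: "d > 0" "ball 0 d \<subseteq> {t. z x0 (y t) < b}"
    using open_contains_ball by blast
  have local_max: "\<psi> t * \<sigma> t ^ Suc (Suc n) \<le> \<psi> 0 * \<sigma> 0 ^ Suc (Suc n)" if t: "\<bar>t\<bar> < d" for t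
  proof -
    have zt: "z x0 (y t) < b" using d(2) t by (auto simp: subset_iff)
    have "u t = X x0 (y t) - pd (a + t *\<^sub>R c) F (y t)"
      by (simp add: u_def g0_def g1_def L.add L.scaleR)
    then have "\<psi> t \<le> w x0 (y t)" unfolding \<psi>_def using w_lower_bound by simp
    then have "\<psi> t * \<sigma> t ^ Suc (Suc n) \<le> w x0 (y t) * \<sigma> t ^ Suc (Suc n)"
      using zt by (intro mult_right_mono) (auto simp: \<sigma>_def)
    also have "\<dots> \<le> \<psi> 0 * \<sigma> 0 ^ Suc (Suc n)"
      using max[OF zt] by (simp add: \<psi>0 \<sigma>0 s_def \<sigma>_def y0)
    finally show ?thesis .
  qed
  have s0: "0 < \<sigma> 0" using sp by (simp add: \<sigma>0 s_def)
  have \<sigma>10: "\<sigma>1 0 = - 2 * G p a e"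
    by (simp add: \<sigma>1_def Y1_def y0 pdX' pinner_L a_def)
  note lm = local_max_product[OF \<psi> \<psi>1 \<sigma> \<sigma>1 s0 d(1) local_max]
  have s2: "0 - 2 * (pinner (Y1 0) (Y1 0) + pinner (X x0 (y 0)) (pd e (pd e (X x0)) p + pd k (X x0) p)) = s2"
    by (simp add: Y1_def y0 pdX pdX' s2_def G_def)
  show "- 2 * pinner N0 \<nu>1 * s + N * w x0 p * (- 2 * G p a e) = 0"
    using lm(1) by (simp add: \<sigma>0 \<psi>0 \<sigma>10 \<psi>1_def u0 u10 N_def)
  have "- (2 * (pinner (u1 0) (u1 0) + pinner (u 0) \<nu>2)) * (\<sigma> 0)\<^sup>2 + 2 * N * \<psi>1 0 * \<sigma> 0 * \<sigma>1 0
      + N * \<psi> 0 * \<sigma> 0 * s2 + N * (N - 1) * \<psi> 0 * (\<sigma>1 0)\<^sup>2 \<le> 0"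
    using lm(2) unfolding s2 N_def .
  then show "- 2 * (pinner \<nu>1 \<nu>1 + pinner N0 \<nu>2) * s\<^sup>2 + 2 * N * (- 2 * pinner N0 \<nu>1) * s * (- 2 * G p a e)
      + N * w x0 p * s * s2 + N * (N - 1) * w x0 p * (- 2 * G p a e)\<^sup>2 \<le> 0"
    unfolding \<sigma>0 \<psi>0 \<sigma>10 u0 u10 \<psi>1_def by simp
qed

lemma f_strict_Lipschitz:
  assumes "x \<noteq> y"
  shows "norm (f x - f y) < norm (x - y)"
proof -
  define c where "c t = f (y + t *\<^sub>R (x - y))" for t
  have fd: "f differentiable (at u)" for u using smooth_on_differentiable[OF smooth_f] by simp
  have d: "(c has_derivative (\<lambda>h. pd (h *\<^sub>R (x - y)) f (y + t *\<^sub>R (x - y)))) (at t)" for t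
  proof -
    have "((\<lambda>t. y + t *\<^sub>R (x - y)) has_derivative (\<lambda>h. h *\<^sub>R (x - y))) (at t)"
      by (auto intro!: derivative_eq_intros)
    from has_derivative_compose[OF this differentiable_has_pd[OF fd]]
    show ?thesis unfolding c_def .
  qed
  have "\<exists>t\<in>{0<..<1}. norm (c 1 - c 0) \<le> norm (pd ((1 - 0) *\<^sub>R (x - y)) f (y + t *\<^sub>R (x - y)))"
  proof (rule mvt_general)
    show "continuous_on {0..1} c"
      using d by (intro continuous_at_imp_continuous_on) (auto intro: has_derivative_continuous)
  qed (use d in auto)
  then obtain t where "norm (c 1 - c 0) \<le> norm (pd (x - y) f (y + t *\<^sub>R (x - y)))" by auto
  also have "\<dots> < norm (x - y)" using assms by (intro pd_less) simp
  finally show ?thesis by (simp add: c_def)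
qed

lemma f_Lipschitz: "norm (f x - f y) \<le> norm (x - y)"
  using f_strict_Lipschitz[of x y] by (cases "x = y") auto

lemma z_alt: "z x0 x = (norm (x - x0))\<^sup>2 - (norm (f x - f x0))\<^sup>2"
  by (simp add: z_def X_def F_def pinner_def dot_square_norm)

lemma z_nonneg: "0 \<le> z x0 x"
  using power_mono[OF f_Lipschitz[of x x0], of 2] by (simp add: z_alt)

text \<open>On the unit sphere around \<open>x0\<close> the function \<open>f\<close> loses a definite amount \<open>\<delta>\<close> against the Lipschitz bound,
  and this loss persists further out.\<close>

lemma z_proper: "\<exists>\<delta>>0. \<forall>x. 1 \<le> norm (x - x0) \<longrightarrow> \<delta> * norm (x - x0) \<le> z x0 x"
proof -
  have c: "compact (sphere x0 1)" "sphere x0 1 \<noteq> {}" by auto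
  have "continuous_on (sphere x0 1) (\<lambda>y. norm (f y - f x0))"
    using continuous_on_subset[OF smooth_on_continuous[OF smooth_f]] by (intro continuous_intros) auto
  from continuous_attains_sup[OF c this] obtain y0 where y0: "y0 \<in> sphere x0 1"
    "\<And>y. y \<in> sphere x0 1 \<Longrightarrow> norm (f y - f x0) \<le> norm (f y0 - f x0)" by blast
  define \<delta> where "\<delta> = 1 - norm (f y0 - f x0)"
  have "y0 \<noteq> x0" using y0(1) by auto
  then have \<delta>: "0 < \<delta>"
    using f_strict_Lipschitz[of y0 x0] y0(1) by (simp add: \<delta>_def dist_norm norm_minus_commute)
  have "\<delta> * norm (x - x0) \<le> z x0 x" if x: "1 \<le> norm (x - x0)" for x
  proof -
    define r where "r = norm (x - x0)"
    define y where "y = x0 + (1 / r) *\<^sub>R (x - x0)"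
    have r: "1 \<le> r" using x by (simp add: r_def)
    have "x \<noteq> x0" using x by auto
    then have "y \<in> sphere x0 1" using r by (simp add: y_def dist_norm r_def)
    then have 1: "norm (f y - f x0) \<le> 1 - \<delta>" using y0(2) by (simp add: \<delta>_def)
    have "x - y = (1 - 1 / r) *\<^sub>R (x - x0)" by (simp add: y_def algebra_simps)
    then have "norm (x - y) = (1 - 1 / r) * r" using r by (simp add: r_def[symmetric])
    moreover have "(1 - 1 / r) * r = r - 1" using r by (simp add: left_diff_distrib)
    ultimately have 2: "norm (x - y) = r - 1" by simp
    have "norm (f x - f x0) \<le> norm (f x - f y) + norm (f y - f x0)"
      using norm_triangle_ineq[of "f x - f y" "f y - f x0"] by simp
    then have 3: "norm (f x - f x0) \<le> r - \<delta>" using 1 2 f_Lipschitz[of x y] by linarith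
    have "\<delta> * r \<le> (r - norm (f x - f x0)) * (r + norm (f x - f x0))"
      using 3 \<delta> r by (intro mult_mono) auto
    also have "\<dots> = z x0 x" by (simp add: z_alt r_def power2_eq_square algebra_simps)
    finally show ?thesis by (simp add: r_def)
  qed
  then show ?thesis using \<delta> by blast
qed

lemma z_sublevel_compact: "compact {x. z x0 x \<le> b}"
proof -
  obtain \<delta> where \<delta>: "0 < \<delta>" "\<And>x. 1 \<le> norm (x - x0) \<Longrightarrow> \<delta> * norm (x - x0) \<le> z x0 x"
    using z_proper[of x0] by blast
  have "norm (x - x0) \<le> max 1 (b / \<delta>)" if "z x0 x \<le> b" for x
  proof (cases "1 \<le> norm (x - x0)")
    case True
    then have "norm (x - x0) * \<delta> \<le> b" using \<delta>(2)[OF True] that by (simp add: mult.commute)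
    then have "norm (x - x0) \<le> b / \<delta>" using \<delta>(1) by (simp add: pos_le_divide_eq)
    then show ?thesis by simp
  qed simp
  then have "{x. z x0 x \<le> b} \<subseteq> cball x0 (max 1 (b / \<delta>))"
    by (auto simp: dist_norm norm_minus_commute)
  moreover have "closed {x. z x0 x \<le> b}"
    by (intro closed_Collect_le continuous_z continuous_on_const)
  ultimately show ?thesis using compact_eq_bounded_closed bounded_cball bounded_subset by blast
qed

text \<open>The choice \<open>k = - \<Gamma>(e, e)\<close> makes the acceleration of the parabola normal, and the choice of \<open>c\<close> gives the
  barrier field the same covariant derivative as the tangential part of \<open>X\<close>. With these the third derivatives
  of \<open>F\<close> enter only through the traced Codazzi equation. This is where the parallelism of the mean curvature
  enters beyond the boundedness of its length.\<close>

lemma bound_at_maximum: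
  fixes x0 p :: "real^'m"
  assumes par: "parallel_mean_curvature M" and b: "1 \<le> b" and sp: "z x0 p < b"
    and n: "Suc (Suc n) = 8 * CARD('m)"
    and max: "\<And>x. z x0 x < b \<Longrightarrow> w x0 x * (b - z x0 x) ^ Suc (Suc n) \<le> w x0 p * (b - z x0 p) ^ Suc (Suc n)"
    and q: "1 \<le> sqrt (w x0 p)"
  defines "h \<equiv> real CARD('m) * sqrt (- pinner (H p) (H p))"
  shows "sqrt (w x0 p) \<le> (6 * real CARD('m) + 2 * h + 1) * b"
proof -
  define m where "m = real CARD('m)"
  define N0 where "N0 = nor p (X x0 p)"
  define a where "a = T p (X x0 p)"
  define e where "e i = E i p" for i
  define s where "s = b - z x0 p"
  define B where "B u v = pinner (pd u (pd v F) p) N0" for u v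
  define \<Gamma> where "\<Gamma> u v = T p (pd u (pd v F) p)" for u v
  define \<alpha> where "\<alpha> i = G p a (e i)" for i
  define Sm where "Sm i j = B (e i) (e j)" for i j
  \<comment> \<open>The covariant derivative of the tangential part of \<open>X\<close> is \<open>e\<^sub>i + \<Sum>\<^sub>j S\<^sub>i\<^sub>j e\<^sub>j\<close>; the last term turns it into a coordinate derivative.\<close>
  define c where "c i = e i + (\<Sum>j\<in>UNIV. Sm i j *\<^sub>R e j) - \<Gamma> (e i) a" for i
  define k where "k i = - \<Gamma> (e i) (e i)" for i
  define \<beta> where "\<beta> i = - pinner (nor p (pd (e i) (pd a F) p)) (nor p (pd (e i) (pd a F) p))" for i
  define N where "N = real (Suc (Suc n))"
  have N: "N = 8 * m" using n by (simp add: N_def m_def)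
  have m: "1 \<le> m" by (simp add: m_def Suc_leI)
  have normN0: "normal p N0" unfolding N0_def by (rule normal_nor)
  have NL: "pinner N0 (pd v F p) = 0" for v using normN0 by (simp add: normal_def)
  have w: "0 < w x0 p" using q by (metis less_le_trans real_sqrt_gt_0_iff zero_less_one)
  have wN0: "pinner N0 N0 = - w x0 p" by (simp add: w_def N0_def)
  interpret P: bounded_bilinear "\<lambda>u v. pd u (pd v F) p" by (rule bounded_bilinear_pd_pd[OF smooth_F])
  have Psym: "pd u (pd v F) p = pd v (pd u F) p" for u v by (rule pd_commute[OF smooth_F])
  have Bsym: "B u v = B v u" for u v unfolding B_def using Psym by metis
  have oe: "pf.orthonormal p e" unfolding e_def by (rule orthonormal_E)
  have oe': "G p (e i) (e i) = 1" for i using oe by (simp add: pf.orthonormal_def)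
  have a_exp: "a = (\<Sum>j\<in>UNIV. \<alpha> j *\<^sub>R e j)" unfolding \<alpha>_def by (rule pf.orthonormal_expand[OF oe])
  have SB: "(\<Sum>j\<in>UNIV. Sm i j * \<alpha> j) = B (e i) a" for i
  proof -
    have "B (e i) a = B (e i) (\<Sum>j\<in>UNIV. \<alpha> j *\<^sub>R e j)" using a_exp by simp
    also have "\<dots> = (\<Sum>j\<in>UNIV. Sm i j * \<alpha> j)"
      unfolding B_def Sm_def P.sum_right P.scaleR_right by (simp add: pinner_simps mult.commute)
    finally show ?thesis by simp
  qed
  have nu1: "pd (e i) F p - pd (e i) (pd a F) p - pd (c i) F p
      = - nor p (pd (e i) (pd a F) p) - pd (\<Sum>j\<in>UNIV. Sm i j *\<^sub>R e j) F p" for i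
    by (simp add: c_def L.add L.diff nor_def \<Gamma>_def)
  have pnu1: "pinner N0 (pd (e i) F p - pd (e i) (pd a F) p - pd (c i) F p) = - B (e i) a" for i
    by (simp add: pinner_simps NL B_def pinner_commute)
  have S2: "G p (\<Sum>j\<in>UNIV. Sm i j *\<^sub>R e j) (\<Sum>j\<in>UNIV. Sm i j *\<^sub>R e j) = (\<Sum>j\<in>UNIV. (Sm i j)\<^sup>2)" for i
    using pf.parseval[OF oe, of "\<Sum>j\<in>UNIV. Sm i j *\<^sub>R e j" "\<Sum>j\<in>UNIV. Sm i j *\<^sub>R e j"]
    by (simp add: pf.orthonormal_comb[OF oe] power2_eq_square)
  have nu1nu1: "pinner (pd (e i) F p - pd (e i) (pd a F) p - pd (c i) F p)
      (pd (e i) F p - pd (e i) (pd a F) p - pd (c i) F p) = - \<beta> i + (\<Sum>j\<in>UNIV. (Sm i j)\<^sup>2)" for i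
  proof -
    have "pinner (nor p (pd (e i) (pd a F) p)) (pd v F p) = 0" for v
      using normal_nor by (simp add: normal_def)
    then show ?thesis
      unfolding nu1
      by (simp add: pinner_simps pinner_commute[of "pd _ F p" "nor _ _"] S2[unfolded G_def] \<beta>_def)
  qed
  define \<nu>2 where "\<nu>2 i = pd (e i) (pd (e i) F) p + pd (k i) F p - pd (e i) (pd (e i) (pd a F)) p
        - pd (k i) (pd a F) p - 2 *\<^sub>R pd (e i) (pd (c i) F) p" for i
  define C where "C i = pinner (pd a (pd (e i) (pd (e i) F)) p) N0" for i
  have CC: "pd (e i) (pd (e i) (pd a F)) p = pd a (pd (e i) (pd (e i) F)) p" for i
  proof -
    have "pd (e i) (pd a F) = pd a (pd (e i) F)" using pd_commute[OF smooth_F] by blast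
    then show ?thesis using pd_commute[OF smooth_on_pd[OF smooth_F]] by metis
  qed
  have pnu2: "pinner N0 (\<nu>2 i) = - Sm i i - C i + B (\<Gamma> (e i) (e i)) a - 2 * (\<Sum>j\<in>UNIV. (Sm i j)\<^sup>2)
      + 2 * B (\<Gamma> (e i) a) (e i)" for i
  proof -
    have "pinner N0 (pd (e i) (pd (c i) F) p) = B (e i) (c i)" by (simp add: B_def pinner_commute)
    also have "\<dots> = Sm i i + (\<Sum>j\<in>UNIV. (Sm i j)\<^sup>2) - B (e i) (\<Gamma> (e i) a)"
      unfolding c_def B_def P.add_right P.diff_right P.sum_right P.scaleR_right
      by (simp add: pinner_simps Sm_def B_def power2_eq_square)
    finally have 1: "pinner N0 (pd (e i) (pd (c i) F) p) = Sm i i + (\<Sum>j\<in>UNIV. (Sm i j)\<^sup>2) - B (e i) (\<Gamma> (e i) a)" .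
    have 2: "pinner N0 (pd (k i) (pd a F) p) = - B (\<Gamma> (e i) (e i)) a"
      unfolding k_def P.minus_left by (simp add: pinner_simps B_def pinner_commute)
    have 3: "pinner N0 (pd (e i) (pd (e i) F) p) = Sm i i" by (simp add: Sm_def B_def pinner_commute)
    have 4: "pinner N0 (pd (e i) (pd (e i) (pd a F)) p) = C i" unfolding CC C_def by (rule pinner_commute)
    show ?thesis unfolding \<nu>2_def by (simp add: pinner_simps 1 2 3 4 NL Bsym[of "\<Gamma> (e i) a"])
  qed
  have s2: "- 2 * (G p (e i) (e i) + pinner (X x0 p) (pd (e i) (pd (e i) F) p + pd (k i) F p)) = - 2 - 2 * Sm i i" for i
  proof -
    have "pd (e i) (pd (e i) F) p + pd (k i) F p = nor p (pd (e i) (pd (e i) F) p)"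
      by (simp add: k_def \<Gamma>_def nor_def L.neg)
    then have "pinner (X x0 p) (pd (e i) (pd (e i) F) p + pd (k i) F p) = pinner (pd (e i) (pd (e i) F) p) N0"
      unfolding N0_def using pinner_nor_left[OF normal_nor, of p "X x0 p" "pd (e i) (pd (e i) F) p"]
        pinner_nor_left[OF normal_nor, of p "pd (e i) (pd (e i) F) p" "X x0 p"]
      by (simp add: pinner_commute)
    then show ?thesis by (simp add: oe' Sm_def B_def)
  qed
  define \<psi> where "\<psi> i = - 2 * (- \<beta> i + (\<Sum>j\<in>UNIV. (Sm i j)\<^sup>2) + pinner N0 (\<nu>2 i))" for i
  note mv = maximum_variation[OF sp max, folded N_def a_def N0_def s_def]
  have crit: "2 * (\<Sum>j\<in>UNIV. Sm i j * \<alpha> j) * s + N * w x0 p * (- 2 * \<alpha> i) = 0" for i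
    using mv(1)[of "e i" "c i"] unfolding pnu1 SB \<alpha>_def[symmetric] by simp
  have second: "\<psi> i * s\<^sup>2 + 2 * N * (2 * (\<Sum>j\<in>UNIV. Sm i j * \<alpha> j)) * s * (- 2 * \<alpha> i)
        + N * w x0 p * s * (- 2 - 2 * Sm i i) + N * (N - 1) * w x0 p * (- 2 * \<alpha> i)\<^sup>2 \<le> 0" for i
    using mv(2)[of "e i" "c i" "k i", folded \<nu>2_def]
    unfolding pnu1 nu1nu1 s2 SB \<alpha>_def[symmetric] \<psi>_def by simp
  define tr where "tr = (\<Sum>i\<in>UNIV. Sm i i)"
  have cod: "(\<Sum>i\<in>UNIV. C i) = 2 * (\<Sum>i\<in>UNIV. B (\<Gamma> (e i) a) (e i)) + (\<Sum>i\<in>UNIV. B (\<Gamma> (e i) (e i)) a)"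
  proof -
    have TS: "T p (S p) = (\<Sum>i\<in>UNIV. \<Gamma> (e i) (e i))" by (simp add: S_def T.sum \<Gamma>_def e_def)
    have "pinner (pd a (pd (T p (S p)) F) p) N0 = (\<Sum>i\<in>UNIV. B (\<Gamma> (e i) (e i)) a)"
      unfolding TS P.sum_right using Psym[of a] by (simp add: pinner_simps B_def)
    moreover have "T p (pd a (pd (E i p) F) p) = \<Gamma> (e i) a" for i
      unfolding \<Gamma>_def e_def using Psym by metis
    ultimately show ?thesis
      using codazzi_trace[OF par normN0, of a] unfolding C_def e_def[symmetric] B_def by simp
  qed
  have psi_sum: "(\<Sum>i\<in>UNIV. \<psi> i) = 2 * (\<Sum>i\<in>UNIV. \<beta> i) + 2 * (\<Sum>i\<in>UNIV. \<Sum>j\<in>UNIV. (Sm i j)\<^sup>2) + 2 * tr"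
    unfolding \<psi>_def pnu2 using cod
    by (simp add: sum.distrib sum_subtractf sum_distrib_left[symmetric] sum_negf tr_def)
  have beta: "(\<Sum>j\<in>UNIV. Sm i j * \<alpha> j)\<^sup>2 \<le> \<beta> i * w x0 p" for i
    using normal_cauchy_schwarz[OF normal_nor[of p "pd (e i) (pd a F) p"] normN0]
    unfolding SB pinner_nor_left[OF normN0] by (simp add: \<beta>_def wN0 B_def)
  have A: "(\<Sum>i\<in>UNIV. (\<alpha> i)\<^sup>2) = z x0 p + w x0 p"
    using pf.parseval[OF oe, of a a] by (simp add: z_plus_w a_def[symmetric] \<alpha>_def power2_eq_square)
  have s: "0 < s" "s \<le> b" using sp z_nonneg[of x0 p] by (auto simp: s_def)
  have ineq: "2 / m * (tr - N * w x0 p / s)\<^sup>2 * s\<^sup>2 + 2 * tr * s\<^sup>2 - 2 * N\<^sup>2 * w x0 p * z x0 p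
      - 4 * N * w x0 p * (z x0 p + w x0 p) - 2 * N * w x0 p * s * (m + tr) \<le> 0"
    unfolding m_def tr_def
    by (rule summed_inequality[OF w s(1) z_nonneg A crit second psi_sum[unfolded tr_def] beta])
  have trN: "tr = m * pinner (H p) N0"
  proof -
    have "tr = pinner (S p) N0" by (simp add: tr_def Sm_def B_def S_def e_def pinner_simps)
    also have "\<dots> = pinner (nor p (S p)) N0" using pinner_nor_left[OF normN0] by simp
    finally show ?thesis using m by (simp add: H_def m_def pinner_simps)
  qed
  \<comment> \<open>The trace of \<open>S\<close> is the pairing of \<open>m H\<close> with the normal part of \<open>X\<close>, so that it grows at most like its length.\<close>
  define \<eta> where "\<eta> = - pinner (H p) (H p)"
  have "(pinner (H p) N0)\<^sup>2 \<le> \<eta> * w x0 p"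
    using normal_cauchy_schwarz[OF normal_H normN0] by (simp add: wN0 \<eta>_def)
  then have "\<bar>pinner (H p) N0\<bar> \<le> sqrt \<eta> * sqrt (w x0 p)"
    by (metis real_sqrt_abs real_sqrt_le_mono real_sqrt_mult)
  then have tr_le: "\<bar>tr\<bar> \<le> h * sqrt (w x0 p)"
    unfolding trN h_def using m by (simp add: abs_mult \<eta>_def m_def)
  have h: "0 \<le> h" using normal_nonpos[OF normal_H] by (simp add: h_def)
  show ?thesis
    unfolding m_def[symmetric]
  proof (rule inequality_gives_bound[OF m h q b s z_nonneg[of x0 p] _ tr_le])
    show "z x0 p \<le> b" using sp by simp
    show "2 / m * (tr - 8 * m * (sqrt (w x0 p))\<^sup>2 / s)\<^sup>2 * s\<^sup>2 + 2 * tr * s\<^sup>2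
        - 2 * (8 * m)\<^sup>2 * (sqrt (w x0 p))\<^sup>2 * z x0 p
        - 4 * (8 * m) * (sqrt (w x0 p))\<^sup>2 * (z x0 p + (sqrt (w x0 p))\<^sup>2)
        - 2 * (8 * m) * (sqrt (w x0 p))\<^sup>2 * s * (m + tr) \<le> 0"
      using ineq w by (simp add: N)
  qed
qed

end

section \<open>The gradient of the pseudo-distance\<close>

context spacelike_graph
begin

text \<open>Apply the bound at a maximum of \<open>w (b - z)\<^sup>N\<close> on the compact set \<open>z \<le> b\<close>, with \<open>b\<close> about twice the value of
  \<open>z\<close> at the given point, so that the weight there is comparable to \<open>b\<^sup>N\<close>.\<close>

lemma normal_part_bound:
  assumes par: "parallel_mean_curvature M"
  obtains C where "0 < C" "\<And>x. sqrt (w x0 x) \<le> C * (z x0 x + 1)"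
proof -
  define m where "m = real CARD('m)"
  define h where "h = m * sqrt (- pinner (H x0) (H x0))"
  define C1 where "C1 = 6 * m + 2 * h + 1"
  define n where "n = 8 * CARD('m) - 2"
  have n: "Suc (Suc n) = 8 * CARD('m)" using zero_less_card_finite[where 'a='m] unfolding n_def by linarith
  have h: "0 \<le> h" using normal_nonpos[OF normal_H] by (simp add: h_def m_def)
  have C1: "1 \<le> C1" using h by (simp add: C1_def m_def)
  define K :: real where "K = 2 ^ Suc (Suc n)"
  have K: "0 < K" by (simp add: K_def)
  have w_le: "w x0 x \<le> (C1\<^sup>2 * 4 * K) * (z x0 x + 1)\<^sup>2" for x
  proof (cases "w x0 x = 0")
    case True
    then show ?thesis using K by simp
  next
    case False
    then have wx: "0 < w x0 x" using w_nonneg[of x0 x] by simp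
    \<comment> \<open>This choice gives \<open>b - z = z + 1\<close> at \<open>x\<close>, which is at least \<open>b / 2\<close>.\<close>
    define b where "b = 2 * z x0 x + 1"
    have b: "1 \<le> b" and zx: "z x0 x < b" using z_nonneg[of x0 x] by (auto simp: b_def)
    define W where "W y = w x0 y * (b - z x0 y) ^ Suc (Suc n)" for y
    have "continuous_on {y. z x0 y \<le> b} W"
      unfolding W_def
      by (intro continuous_intros continuous_on_subset[OF continuous_w] continuous_on_subset[OF continuous_z]) auto
    moreover have "x \<in> {y. z x0 y \<le> b}" using zx by simp
    then have "{y. z x0 y \<le> b} \<noteq> {}" by blast
    ultimately obtain p where p: "z x0 p \<le> b" "\<And>y. z x0 y \<le> b \<Longrightarrow> W y \<le> W p"
      using continuous_attains_sup[OF z_sublevel_compact, of x0 b W] by auto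
    have "0 < W x" using wx zx by (simp add: W_def)
    then have Wp: "0 < W p" using p(2)[of x] zx by simp
    then have zp: "z x0 p < b" using p(1) by (cases "z x0 p = b") (auto simp: W_def)
    have "w x0 p \<le> (C1 * b)\<^sup>2"
    proof (cases "1 \<le> sqrt (w x0 p)")
      case True
      have "sqrt (w x0 p) \<le> (6 * real CARD('m) + 2 * (real CARD('m) * sqrt (- pinner (H p) (H p))) + 1) * b"
        by (rule bound_at_maximum[OF par b zp n _ True]) (use p(2) in \<open>auto simp: W_def\<close>)
      then have "sqrt (w x0 p) \<le> C1 * b"
        using norm_H_const[OF par, of p x0] by (simp add: C1_def h_def m_def)
      then have "(sqrt (w x0 p))\<^sup>2 \<le> (C1 * b)\<^sup>2" by (intro power_mono) (auto simp: w_nonneg)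
      then show ?thesis using w_nonneg[of x0 p] by simp
    next
      case False
      then have "w x0 p \<le> 1" by simp
      also have "\<dots> \<le> (C1 * b)\<^sup>2" using mult_mono[OF C1 b] C1 b by (simp add: one_le_power)
      finally show ?thesis .
    qed
    have "w x0 x * (z x0 x + 1) ^ Suc (Suc n) = W x" by (simp add: W_def b_def)
    also have "\<dots> \<le> W p" using p(2) zx by simp
    also have "\<dots> \<le> (C1 * b)\<^sup>2 * b ^ Suc (Suc n)"
      unfolding W_def using \<open>w x0 p \<le> (C1 * b)\<^sup>2\<close> zp z_nonneg[of x0 p]
      by (intro mult_mono power_mono) auto
    also have "\<dots> \<le> (C1 * (2 * (z x0 x + 1)))\<^sup>2 * (2 * (z x0 x + 1)) ^ Suc (Suc n)"
      using b C1 z_nonneg[of x0 x] by (intro mult_mono power_mono) (auto simp: b_def)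
    also have "\<dots> = ((C1\<^sup>2 * 4 * K) * (z x0 x + 1)\<^sup>2) * (z x0 x + 1) ^ Suc (Suc n)"
      unfolding power_mult_distrib K_def by (simp add: power2_eq_square)
    finally show ?thesis
      using z_nonneg[of x0 x] by (simp only: mult_le_cancel_right) (simp add: zero_less_power add_nonneg_pos)
  qed
  show ?thesis
  proof
    show "0 < sqrt (C1\<^sup>2 * 4 * K)" using C1 K by simp
    fix x
    have "sqrt (w x0 x) \<le> sqrt ((C1\<^sup>2 * 4 * K) * (z x0 x + 1)\<^sup>2)" using w_le by (rule real_sqrt_le_mono)
    then show "sqrt (w x0 x) \<le> sqrt (C1\<^sup>2 * 4 * K) * (z x0 x + 1)"
      using z_nonneg[of x0 x] by (simp add: real_sqrt_mult)
  qed
qed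

text \<open>The gradient of \<open>z\<close> is twice the tangential part of \<open>X\<close>, whose squared length is \<open>z + w\<close>.\<close>

lemma gradient_bound:
  assumes par: "parallel_mean_curvature M"
  obtains C where "0 < C" "\<And>x v. \<bar>pinner (X x0 x) (pd v F x)\<bar> \<le> C * (z x0 x + 1) * sqrt (G x v v)"
proof -
  obtain C where C: "0 < C" "\<And>x. sqrt (w x0 x) \<le> C * (z x0 x + 1)" using normal_part_bound[OF par] by blast
  have "\<bar>pinner (X x0 x) (pd v F x)\<bar> \<le> (C + 1) * (z x0 x + 1) * sqrt (G x v v)" for x v
  proof -
    let ?Z = "z x0 x + 1"
    have Z: "1 \<le> ?Z" using z_nonneg[of x0 x] by simp
    have "(sqrt (w x0 x))\<^sup>2 \<le> (C * ?Z)\<^sup>2" using C(2) w_nonneg by (intro power_mono) auto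
    then have "w x0 x \<le> C\<^sup>2 * ?Z\<^sup>2" using w_nonneg[of x0 x] by (simp add: power_mult_distrib)
    moreover have "z x0 x \<le> ?Z\<^sup>2" using z_nonneg[of x0 x] zero_le_power2[of "z x0 x"] by (simp add: power2_sum)
    moreover have "0 \<le> 2 * C * ?Z\<^sup>2" using C by simp
    moreover have sq: "((C + 1) * ?Z)\<^sup>2 = C\<^sup>2 * ?Z\<^sup>2 + 2 * C * ?Z\<^sup>2 + ?Z\<^sup>2"
      by (simp add: power2_eq_square algebra_simps)
    ultimately have A: "z x0 x + w x0 x \<le> ((C + 1) * ?Z)\<^sup>2"
      unfolding sq by linarith
    have "(pinner (X x0 x) (pd v F x))\<^sup>2 = (G x (T x (X x0 x)) v)\<^sup>2" by (simp add: pinner_L)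
    also have "\<dots> \<le> (z x0 x + w x0 x) * G x v v" unfolding z_plus_w by (rule pf.cauchy_schwarz)
    also have "\<dots> \<le> ((C + 1) * ?Z)\<^sup>2 * G x v v" by (intro mult_right_mono A pf.nonneg)
    finally have "sqrt ((pinner (X x0 x) (pd v F x))\<^sup>2) \<le> sqrt (((C + 1) * ?Z)\<^sup>2 * G x v v)" by (rule real_sqrt_le_mono)
    then show ?thesis using C Z by (simp add: real_sqrt_mult abs_mult)
  qed
  then show ?thesis using that[of "C + 1"] C by simp
qed

text \<open>The function \<open>ln (z + 1)\<close> has bounded gradient, so that its increments are controlled by length.
  The end points and the break points of the curve are discarded, since the velocity is arbitrary there.\<close>

lemma curve_length_lower_bound:
  assumes C: "\<And>x v. \<bar>pinner (X x0 x) (pd v F x)\<bar> \<le> C * (z x0 x + 1) * sqrt (G x v v)"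
    and L: "L \<in> curve_lengths M p q"
  shows "\<bar>ln (z x0 (fst q) + 1) - ln (z x0 (fst p) + 1)\<bar> \<le> 2 * C * L"
proof -
  from L obtain \<gamma> where \<gamma>: "valid_path \<gamma>" "path_image \<gamma> \<subseteq> M" "pathstart \<gamma> = p" "pathfinish \<gamma> = q"
    and int: "((\<lambda>t. sqrt (pinner (vector_derivative \<gamma> (at t)) (vector_derivative \<gamma> (at t)))) has_integral L) {0..1}"
    unfolding curve_lengths_def by blast
  obtain S where S: "continuous_on {0..1} \<gamma>" "finite S" "\<And>t. t \<in> {0..1} - S \<Longrightarrow> \<gamma> differentiable (at t)"
    using \<gamma>(1) unfolding valid_path_def piecewise_C1_differentiable_on_def C1_differentiable_on_eq by blast
  define c where "c t = fst (\<gamma> t)" for t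
  have \<gamma>c: "\<gamma> t = F (c t)" if "t \<in> {0..1}" for t
    unfolding c_def by (rule F_fst[symmetric]) (use \<gamma>(2) that in \<open>auto simp: path_image_def\<close>)
  define \<gamma>' where "\<gamma>' t = vector_derivative \<gamma> (at t)" for t
  define S' where "S' = insert 0 (insert 1 S)"
  have S': "finite S'" using S by (simp add: S'_def)
  have der: "(\<gamma> has_vector_derivative \<gamma>' t) (at t)" if "t \<in> {0..1} - S'" for t
    using S(3)[of t] that vector_derivative_works unfolding \<gamma>'_def S'_def by blast
  have dc: "(c has_vector_derivative fst (\<gamma>' t)) (at t)" if "t \<in> {0..1} - S'" for t
    using der[OF that] unfolding has_vector_derivative_def c_def by (auto dest: has_derivative_fst)
  have \<gamma>'_eq: "\<gamma>' t = pd (fst (\<gamma>' t)) F (c t)" if t: "t \<in> {0..1} - S'" for t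
  proof -
    have "((\<lambda>t. F (c t)) has_derivative (\<lambda>h. pd (h *\<^sub>R fst (\<gamma>' t)) F (c t))) (at t)"
      using has_derivative_compose[OF dc[OF t, unfolded has_vector_derivative_def] differentiable_has_pd[OF F_diff]] .
    then have "((\<lambda>t. F (c t)) has_vector_derivative pd (fst (\<gamma>' t)) F (c t)) (at t)"
      by (simp add: has_vector_derivative_def L.scaleR)
    then have "(\<gamma> has_vector_derivative pd (fst (\<gamma>' t)) F (c t)) (at t)"
      by (rule has_vector_derivative_transform_within_open[of _ _ _ "{0<..<1}"])
        (use t \<gamma>c in \<open>auto simp: S'_def\<close>)
    then show ?thesis using der[OF t] vector_derivative_unique_at by blast
  qed
  define \<phi> where "\<phi> t = ln (pinner (\<gamma> t - F x0) (\<gamma> t - F x0) + 1)" for t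
  define \<phi>' where "\<phi>' t = 2 * pinner (\<gamma> t - F x0) (\<gamma>' t) / (pinner (\<gamma> t - F x0) (\<gamma> t - F x0) + 1)" for t
  have zt: "pinner (\<gamma> t - F x0) (\<gamma> t - F x0) = z x0 (c t)" if "t \<in> {0..1}" for t
    using \<gamma>c[OF that] by (simp add: z_def X_def)
  have zpos: "0 < pinner (\<gamma> t - F x0) (\<gamma> t - F x0) + 1" if "t \<in> {0..1}" for t
    using zt[OF that] z_nonneg[of x0 "c t"] by simp
  have ftc: "(\<phi>' has_integral (\<phi> 1 - \<phi> 0)) {0..1}"
  proof (rule fundamental_theorem_of_calculus_interior_strong[OF S'])
    show "continuous_on {0..1} \<phi>"
      unfolding \<phi>_def
    proof (intro continuous_on_ln continuous_on_add continuous_on_const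
        bounded_bilinear.continuous_on[OF bounded_bilinear_pinner] continuous_on_diff S(1) ballI)
      show "pinner (\<gamma> t - F x0) (\<gamma> t - F x0) + 1 \<noteq> 0" if "t \<in> {0..1}" for t
        using zpos[OF that] by simp
    qed
    fix t assume "t \<in> {0<..<1} - S'"
    then have t: "t \<in> {0..1} - S'" by auto
    have d1: "((\<lambda>t. \<gamma> t - F x0) has_vector_derivative \<gamma>' t) (at t)"
      using has_vector_derivative_diff[OF der[OF t] has_vector_derivative_const] by simp
    have "((\<lambda>t. pinner (\<gamma> t - F x0) (\<gamma> t - F x0)) has_real_derivative
        pinner (\<gamma> t - F x0) (\<gamma>' t) + pinner (\<gamma>' t) (\<gamma> t - F x0)) (at t)"
      using pinner.has_vector_derivative[OF d1 d1] by (simp add: has_real_derivative_iff_has_vector_derivative)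
    then have d2: "((\<lambda>t. pinner (\<gamma> t - F x0) (\<gamma> t - F x0) + 1) has_real_derivative 2 * pinner (\<gamma> t - F x0) (\<gamma>' t)) (at t)"
      by (auto intro!: derivative_eq_intros simp: pinner_commute)
    have t01: "t \<in> {0..1}" using t by simp
    from DERIV_chain2[OF DERIV_ln_divide[OF zpos[OF t01]] d2]
    have "(\<phi> has_real_derivative \<phi>' t) (at t)" unfolding \<phi>_def \<phi>'_def by simp
    then show "(\<phi> has_vector_derivative \<phi>' t) (at t)" by (simp add: has_real_derivative_iff_has_vector_derivative)
  qed simp
  define sp where "sp t = sqrt (pinner (\<gamma>' t) (\<gamma>' t))" for t
  have le: "\<bar>\<phi>' t\<bar> \<le> 2 * C * sp t" if t: "t \<in> {0..1} - S'" for t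
  proof -
    define v where "v = fst (\<gamma>' t)"
    have t01: "t \<in> {0..1}" using t by simp
    have g: "\<gamma>' t = pd v F (c t)" using \<gamma>'_eq[OF t] by (simp add: v_def)
    have "\<bar>pinner (\<gamma> t - F x0) (\<gamma>' t)\<bar> \<le> C * (z x0 (c t) + 1) * sp t"
      using C[of "c t" v] \<gamma>c[OF t01] g by (simp add: X_def sp_def G_def)
    moreover have "0 < z x0 (c t) + 1" using z_nonneg[of x0 "c t"] by simp
    ultimately show ?thesis
      unfolding \<phi>'_def zt[OF t01] by (simp add: abs_mult field_simps)
  qed
  have i1: "((\<lambda>t. if t \<in> S' then 0 else \<phi>' t) has_integral (\<phi> 1 - \<phi> 0)) {0..1}"
    by (rule has_integral_spike_finite[OF S' _ ftc]) auto
  have "((\<lambda>t. 2 * C * sp t) has_integral 2 * C * L) {0..1}"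
    using has_integral_mult_right[OF int] by (simp add: sp_def \<gamma>'_def)
  then have i2: "((\<lambda>t. if t \<in> S' then 0 else 2 * C * sp t) has_integral 2 * C * L) {0..1}"
    by (rule has_integral_spike_finite[OF S', rotated]) auto
  have "\<phi> 1 - \<phi> 0 \<le> 2 * C * L"
    by (rule has_integral_le[OF i1 i2]) (use le in \<open>auto simp: abs_le_iff\<close>)
  moreover have "- (\<phi> 1 - \<phi> 0) \<le> 2 * C * L"
    by (rule has_integral_le[OF has_integral_neg[OF i1] i2]) (use le in \<open>auto simp: abs_le_iff\<close>)
  moreover have "\<phi> 1 = ln (z x0 (fst q) + 1)" "\<phi> 0 = ln (z x0 (fst p) + 1)"
    using zt[of 0] zt[of 1] \<gamma>(3,4) by (auto simp: \<phi>_def c_def pathstart_def pathfinish_def)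
  ultimately show ?thesis by (simp add: abs_le_iff)
qed

text \<open>The metric induced by the ambient form is at most the Euclidean metric of the base.\<close>

lemma segment_length: "\<exists>L. L \<in> curve_lengths M (F x) (F y) \<and> L \<le> norm (y - x)"
proof -
  define v where "v = y - x"
  define \<gamma> where "\<gamma> t = F (x + t *\<^sub>R v)" for t :: real
  have der: "(\<gamma> has_vector_derivative pd v F (x + t *\<^sub>R v)) (at t)" for t
  proof -
    have "((\<lambda>t. x + t *\<^sub>R v) has_derivative (\<lambda>h. h *\<^sub>R v)) (at t)"
      by (auto intro!: derivative_eq_intros)
    from has_derivative_compose[OF this differentiable_has_pd[OF F_diff]]
    show ?thesis by (simp add: has_vector_derivative_def L.scaleR \<gamma>_def[abs_def])
  qed
  have cont: "continuous_on A (\<lambda>t. pd v F (x + t *\<^sub>R v))" for A :: "real set"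
  proof -
    have 1: "continuous_on UNIV (pd v F)" by (rule smooth_on_continuous[OF smooth_on_pd[OF smooth_F]])
    have 2: "continuous_on A (\<lambda>t. x + t *\<^sub>R v)" by (intro continuous_intros)
    show ?thesis by (rule continuous_on_compose2[OF 1 2 subset_UNIV])
  qed
  have "\<gamma> C1_differentiable_on {0..1}"
    unfolding C1_differentiable_on_def
    by (intro exI[of _ "\<lambda>t. pd v F (x + t *\<^sub>R v)"] conjI ballI der cont)
  then have vp: "valid_path \<gamma>" by (simp add: valid_path_def C1_differentiable_imp_piecewise)
  have vd: "vector_derivative \<gamma> (at t) = pd v F (x + t *\<^sub>R v)" for t
    by (rule vector_derivative_at[OF der])
  have "continuous_on {0..1} (\<lambda>t. sqrt (pinner (pd v F (x + t *\<^sub>R v)) (pd v F (x + t *\<^sub>R v))))"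
    by (intro continuous_intros bounded_bilinear.continuous_on[OF bounded_bilinear_pinner] cont)
  then obtain L where L: "((\<lambda>t. sqrt (pinner (pd v F (x + t *\<^sub>R v)) (pd v F (x + t *\<^sub>R v)))) has_integral L) {0..1}"
    using integrable_continuous_real integrable_on_def by blast
  have "L \<in> curve_lengths M (F x) (F y)"
    unfolding curve_lengths_def using vp L
    by (intro CollectI exI[of _ \<gamma>]) (auto simp: vd path_image_def pathstart_def pathfinish_def \<gamma>_def v_def)
  moreover have "L \<le> norm v"
  proof -
    have "((\<lambda>t. norm v) has_integral norm v) {0..1::real}"
      using has_integral_const_real[of "norm v" 0 1] by simp
    from has_integral_le[OF L this] show ?thesis
      using G_le[of _ v] by (simp add: G_def[symmetric] real_le_lsqrt pf.nonneg)
  qed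
  ultimately show ?thesis by (auto simp: v_def)
qed

end

section \<open>Completeness\<close>

lemma curve_lengths_reverse:
  assumes "L \<in> curve_lengths M p q"
  shows "L \<in> curve_lengths M q p"
proof -
  from assms obtain \<gamma> where \<gamma>: "valid_path \<gamma>" "path_image \<gamma> \<subseteq> M" "pathstart \<gamma> = p" "pathfinish \<gamma> = q"
    and int: "((\<lambda>t. sqrt (pinner (vector_derivative \<gamma> (at t)) (vector_derivative \<gamma> (at t)))) has_integral L) {0..1}"
    unfolding curve_lengths_def by blast
  obtain S where S: "finite S" "\<And>t. t \<in> {0..1} - S \<Longrightarrow> \<gamma> differentiable (at t)"
    using \<gamma>(1) unfolding valid_path_def piecewise_C1_differentiable_on_def C1_differentiable_on_eq by blast
  have vd: "vector_derivative (reversepath \<gamma>) (at t) = - vector_derivative \<gamma> (at (1 - t))"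
    if t: "t \<in> {0..1} - (\<lambda>t. 1 - t) ` S" for t
  proof (rule vector_derivative_at)
    have "1 - t \<notin> S" using t by (metis DiffD2 diff_diff_eq2 add_diff_cancel_left' image_eqI)
    then have "(\<gamma> has_vector_derivative vector_derivative \<gamma> (at (1 - t))) (at (1 - t))"
      using S(2)[of "1 - t"] t vector_derivative_works by auto
    moreover have "((\<lambda>t. 1 - t) has_vector_derivative - 1) (at t)"
      by (auto intro!: derivative_eq_intros)
    ultimately have "(\<gamma> \<circ> (\<lambda>t. 1 - t) has_vector_derivative (- 1) *\<^sub>R vector_derivative \<gamma> (at (1 - t))) (at t)"
      by (intro vector_diff_chain_at)
    then show "(reversepath \<gamma> has_vector_derivative - vector_derivative \<gamma> (at (1 - t))) (at t)"
      by (simp add: reversepath_def o_def)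
  qed
  have "((\<lambda>t. sqrt (pinner (vector_derivative \<gamma> (at (1 - t))) (vector_derivative \<gamma> (at (1 - t))))) has_integral L) {0..1}"
    using has_integral_affinity01[where m="-1" and c=1, OF int] by simp
  then have "((\<lambda>t. sqrt (pinner (vector_derivative (reversepath \<gamma>) (at t)) (vector_derivative (reversepath \<gamma>) (at t))))
      has_integral L) {0..1}"
    by (rule has_integral_spike_finite[rotated 2, of _ _ _ "(\<lambda>t. 1 - t) ` S"])
      (use S(1) vd in \<open>auto simp: pinner_simps\<close>)
  then show ?thesis
    unfolding curve_lengths_def using \<gamma>
    by (intro CollectI exI[of _ "reversepath \<gamma>"]) auto
qed

lemma curve_lengths_join:
  assumes "L1 \<in> curve_lengths M p q" "L2 \<in> curve_lengths M q r"
  shows "L1 + L2 \<in> curve_lengths M p r"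
proof -
  let ?sp = "\<lambda>\<gamma> t. sqrt (pinner (vector_derivative \<gamma> (at t)) (vector_derivative \<gamma> (at t)))"
  from assms obtain g1 g2 where g1: "valid_path g1" "path_image g1 \<subseteq> M" "pathstart g1 = p" "pathfinish g1 = q"
      "(?sp g1 has_integral L1) {0..1}"
    and g2: "valid_path g2" "path_image g2 \<subseteq> M" "pathstart g2 = q" "pathfinish g2 = r"
      "(?sp g2 has_integral L2) {0..1}"
    unfolding curve_lengths_def by blast
  obtain s1 where s1: "finite s1" "\<And>t. t \<in> {0..1} - s1 \<Longrightarrow> g1 differentiable (at t)"
    using g1(1) unfolding valid_path_def piecewise_C1_differentiable_on_def C1_differentiable_on_eq by blast
  obtain s2 where s2: "finite s2" "\<And>t. t \<in> {0..1} - s2 \<Longrightarrow> g2 differentiable (at t)"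
    using g2(1) unfolding valid_path_def piecewise_C1_differentiable_on_def C1_differentiable_on_eq by blast
  have sp2: "sqrt (pinner (2 *\<^sub>R u) (2 *\<^sub>R u)) = 2 * sqrt (pinner u u)" for u :: "('a, 'b) pseudo"
    using real_sqrt_mult[of "2 * 2" "pinner u u"] by (simp add: pinner_simps real_sqrt_mult)
  have i1: "((\<lambda>t. 2 * ?sp g1 (2 * t)) has_integral L1) {0..1/2}"
   and i2: "((\<lambda>t. 2 * ?sp g2 (2 * t - 1)) has_integral L2) {1/2..1}"
    using has_integral_affinity01 [OF g1(5), where m= 2 and c=0, THEN has_integral_cmul [where c=2]]
          has_integral_affinity01 [OF g2(5), where m= 2 and c="-1", THEN has_integral_cmul [where c=2]]
    by (simp_all only: image_affinity_atLeastAtMost_div_diff, simp_all)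
  have d1: "vector_derivative (g1 +++ g2) (at t) = 2 *\<^sub>R vector_derivative g1 (at (2 * t))"
    if t: "t \<in> {0..1/2} - insert (1/2) ((*) 2 -` s1)" for t
  proof (rule vector_derivative_at)
    have "(g1 has_vector_derivative vector_derivative g1 (at (2 * t))) (at (2 * t))"
      using s1(2)[of "2 * t"] t vector_derivative_works by auto
    moreover have "((*) 2 has_vector_derivative 2) (at t)"
      by (auto intro!: derivative_eq_intros)
    ultimately have "(g1 \<circ> (*) 2 has_vector_derivative 2 *\<^sub>R vector_derivative g1 (at (2 * t))) (at t)"
      by (intro vector_diff_chain_at)
    then show "(g1 +++ g2 has_vector_derivative 2 *\<^sub>R vector_derivative g1 (at (2 * t))) (at t)"
      by (rule has_vector_derivative_transform_within_open[of _ _ _ "{..<1/2}"])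
        (use t in \<open>auto simp: joinpaths_def\<close>)
  qed
  have d2: "vector_derivative (g1 +++ g2) (at t) = 2 *\<^sub>R vector_derivative g2 (at (2 * t - 1))"
    if t: "t \<in> {1/2..1} - insert (1/2) ((\<lambda>t. 2 * t - 1) -` s2)" for t
  proof (rule vector_derivative_at)
    have "(g2 has_vector_derivative vector_derivative g2 (at (2 * t - 1))) (at (2 * t - 1))"
      using s2(2)[of "2 * t - 1"] t vector_derivative_works by auto
    moreover have "((\<lambda>t. 2 * t - 1) has_vector_derivative 2) (at t)"
      by (auto intro!: derivative_eq_intros)
    ultimately have "(g2 \<circ> (\<lambda>t. 2 * t - 1) has_vector_derivative 2 *\<^sub>R vector_derivative g2 (at (2 * t - 1))) (at t)"
      by (intro vector_diff_chain_at)
    then show "(g1 +++ g2 has_vector_derivative 2 *\<^sub>R vector_derivative g2 (at (2 * t - 1))) (at t)"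
      by (rule has_vector_derivative_transform_within_open[of _ _ _ "{1/2<..}"])
        (use t in \<open>auto simp: joinpaths_def\<close>)
  qed
  have "(?sp (g1 +++ g2) has_integral L1) {0..1/2}"
  proof (rule has_integral_spike_finite[OF _ _ i1])
    show "finite (insert (1/2) ((*) 2 -` s1))"
      using s1 by (force intro: finite_vimageI inj_onI)
  qed (simp only: d1 sp2)
  moreover have "(?sp (g1 +++ g2) has_integral L2) {1/2..1}"
  proof (rule has_integral_spike_finite[OF _ _ i2])
    show "finite (insert (1/2) ((\<lambda>t. 2 * t - 1) -` s2))"
      using s2 by (force intro: finite_vimageI[where h = "\<lambda>t. 2 * t - 1"] inj_onI)
  qed (simp only: d2 sp2)
  ultimately have "(?sp (g1 +++ g2) has_integral (L1 + L2)) {0..1}"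
    by (intro has_integral_combine[where c="1/2"]) auto
  then show ?thesis
    unfolding curve_lengths_def using g1 g2
    by (intro CollectI exI[of _ "g1 +++ g2"]) (auto intro: valid_path_join simp: path_image_join)
qed

context spacelike_graph
begin

text \<open>Bounded sets have bounded \<open>ln (z + 1)\<close>, hence are relatively compact in the coordinates. Together with the
  domination of the distance by the Euclidean one this yields convergent subsequences. The same lower bound of
  the length, with the base point at an end of the curve, shows that distinct points have positive distance.\<close>

theorem riemannian_complete_graph:
  assumes par: "parallel_mean_curvature M"
  shows "riemannian_complete M"
proof -
  let ?d = "riemannian_dist M"
  define D where "D x y = Inf (curve_lengths M (F x) (F y))" for x y
  have dD: "?d (F x) (F y) = D x y" for x y by (simp add: riemannian_dist_def D_def)
  have "\<forall>x0. \<exists>C>0. \<forall>x v. \<bar>pinner (X x0 x) (pd v F x)\<bar> \<le> C * (z x0 x + 1) * sqrt (G x v v)"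
    using gradient_bound[OF par] by metis
  then obtain C where C: "\<And>x0. 0 < C x0"
    "\<And>x0 x v. \<bar>pinner (X x0 x) (pd v F x)\<bar> \<le> C x0 * (z x0 x + 1) * sqrt (G x v v)" by metis
  have z0: "z x x = 0" for x by (simp add: z_def X_def pinner_simps)
  have low: "\<bar>ln (z x y + 1)\<bar> \<le> 2 * C x * L" if "L \<in> curve_lengths M (F x) (F y)" for x y L
    using curve_length_lower_bound[OF C(2) that, of x] by (simp add: z0)
  have Lnn: "0 \<le> L" if "L \<in> curve_lengths M (F x) (F y)" for x y L
  proof -
    have "0 \<le> 2 * C x * L" using low[OF that] by (rule order_trans[OF abs_ge_zero])
    then show ?thesis using C(1)[of x] by (simp add: zero_le_mult_iff)
  qed
  have ne: "curve_lengths M (F x) (F y) \<noteq> {}" for x y using segment_length by blast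
  have bdd: "bdd_below (curve_lengths M (F x) (F y))" for x y using Lnn by (meson bdd_belowI)
  have Dle: "D x y \<le> L" if "L \<in> curve_lengths M (F x) (F y)" for x y L
    unfolding D_def by (rule cInf_lower[OF that bdd])
  have Dnn: "0 \<le> D x y" for x y
    unfolding D_def by (rule cInf_greatest[OF ne Lnn])
  have Dnorm: "D x y \<le> norm (y - x)" for x y
    using segment_length[of x y] Dle by force
  have Dlow: "\<bar>ln (z x y + 1)\<bar> \<le> 2 * C x * D x y" for x y
  proof -
    have "\<bar>ln (z x y + 1)\<bar> / (2 * C x) \<le> D x y"
      unfolding D_def by (rule cInf_greatest[OF ne]) (use low C(1)[of x] in \<open>simp add: field_simps\<close>)
    then show ?thesis using C(1)[of x] by (simp add: field_simps)
  qed
  have Dtri: "D x u \<le> D x y + D y u" for x y u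
  proof -
    have "D x u - L1 \<le> D y u" if "L1 \<in> curve_lengths M (F x) (F y)" for L1
      unfolding D_def[of y]
    proof (rule cInf_greatest[OF ne])
      fix L2 assume "L2 \<in> curve_lengths M (F y) (F u)"
      from Dle[OF curve_lengths_join[OF that this]] show "D x u - L1 \<le> L2" by simp
    qed
    then have "D x u - D y u \<le> D x y"
      unfolding D_def[of x y] by (intro cInf_greatest[OF ne]) force
    then show ?thesis by simp
  qed
  have Dsym: "D x y = D y x" for x y
  proof -
    have "curve_lengths M (F x) (F y) = curve_lengths M (F y) (F x)"
      using curve_lengths_reverse by blast
    then show ?thesis by (simp add: D_def)
  qed
  have D0: "D x y = 0 \<longleftrightarrow> x = y" for x y
  proof
    assume "D x y = 0"
    then have "ln (z x y + 1) = 0" using Dlow[of x y] by simp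
    then have "z x y = 0" using z_nonneg[of x y] by (simp add: ln_eq_zero_iff)
    then have "(norm (y - x))\<^sup>2 = (norm (f y - f x))\<^sup>2" by (simp add: z_alt)
    then have "norm (y - x) = norm (f y - f x)" by simp
    then show "x = y" using f_strict_Lipschitz[of y x] by fastforce
  next
    assume "x = y"
    then show "D x y = 0" using Dnorm[of x y] Dnn[of x y] by simp
  qed
  have Finj: "F x = F y \<longleftrightarrow> x = y" for x y by (auto simp: F_def)
  have ms: "Metric_space M ?d"
  proof
    show "0 \<le> ?d p q" for p q using Dnn by (auto simp: riemannian_dist_def D_def)
    show "?d p q = ?d q p" for p q using Dsym by (auto simp: riemannian_dist_def D_def)
    show "(?d p q = 0) = (p = q)" if "p \<in> M" "q \<in> M" for p q
      using that by (auto simp: dD D0 Finj)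
    show "?d p r \<le> ?d p q + ?d q r" if "p \<in> M" "q \<in> M" "r \<in> M" for p q r
      using that Dtri by (auto simp: dD)
  qed
  interpret Metric_space M ?d by (rule ms)
  have "\<exists>l. limitin mtopology \<sigma> l sequentially" if \<sigma>: "MCauchy \<sigma>" for \<sigma>
  proof -
    have "range \<sigma> \<subseteq> M" using \<sigma> by (simp add: MCauchy_def)
    then have \<sigma>F: "\<sigma> i = F (fst (\<sigma> i))" for i by (intro F_fst[symmetric]) blast
    define c where "c i = fst (\<sigma> i)" for i
    have \<sigma>c: "\<sigma> = (\<lambda>i. F (c i))" using \<sigma>F unfolding c_def by blast
    obtain K where K: "\<And>i j. K \<le> i \<Longrightarrow> K \<le> j \<Longrightarrow> ?d (\<sigma> i) (\<sigma> j) < 1"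
      using \<sigma> unfolding MCauchy_def by (metis zero_less_one)
    have zb: "c (K + i) \<in> {y. z (c K) y \<le> exp (2 * C (c K))}" for i
    proof -
      have "D (c K) (c (K + i)) < 1" using K[of K "K + i"] by (simp add: \<sigma>c dD)
      then have "2 * C (c K) * D (c K) (c (K + i)) \<le> 2 * C (c K)" using C(1)[of "c K"] by simp
      then have "ln (z (c K) (c (K + i)) + 1) \<le> 2 * C (c K)"
        using Dlow[of "c K" "c (K + i)"] by linarith
      then have "exp (ln (z (c K) (c (K + i)) + 1)) \<le> exp (2 * C (c K))" by simp
      then show ?thesis using z_nonneg[of "c K" "c (K + i)"] by simp
    qed
    have "seq_compact {y. z (c K) y \<le> exp (2 * C (c K))}"
      using z_sublevel_compact compact_imp_seq_compact by blast
    then obtain l r where r: "strict_mono r" and l: "((\<lambda>i. c (K + i)) \<circ> r) \<longlonglongrightarrow> l"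
      using zb unfolding seq_compact_def by (metis (no_types, lifting))
    define r' where "r' i = K + r i" for i
    have r': "strict_mono r'" using r by (simp add: r'_def strict_mono_def)
    have "limitin mtopology (\<sigma> \<circ> r') (F l) sequentially"
      unfolding limitin_metric
    proof (intro conjI allI impI)
      fix \<epsilon> :: real assume "0 < \<epsilon>"
      then have "\<forall>\<^sub>F i in sequentially. dist (((\<lambda>i. c (K + i)) \<circ> r) i) l < \<epsilon>"
        using l tendstoD by blast
      then show "\<forall>\<^sub>F i in sequentially. (\<sigma> \<circ> r') i \<in> M \<and> ?d ((\<sigma> \<circ> r') i) (F l) < \<epsilon>"
      proof (rule eventually_mono)
        fix i assume "dist (((\<lambda>i. c (K + i)) \<circ> r) i) l < \<epsilon>"
        then have "D (c (r' i)) l < \<epsilon>"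
          using Dnorm[of "c (r' i)" l] by (simp add: r'_def dist_norm norm_minus_commute)
        then show "(\<sigma> \<circ> r') i \<in> M \<and> ?d ((\<sigma> \<circ> r') i) (F l) < \<epsilon>" by (simp add: \<sigma>c dD)
      qed
    qed simp
    then show ?thesis using MCauchy_convergent_subsequence[OF \<sigma> r'] by blast
  qed
  then have "mcomplete" by (simp add: mcomplete_def)
  then show ?thesis using ms by (simp add: riemannian_complete_def)
qed

end

theorem theorem3p3:
  fixes M :: "((real ^ 'm::finite) \<times> (real ^ 'n::finite)) set"
  assumes "smooth_submanifold M"
    and "spacelike M"
    and "connected M"
    and "closed M"
    and "parallel_mean_curvature M"
  shows "riemannian_complete M"
proof (cases "M = {}")
  case True
  interpret Metric_space "{} :: ('m, 'n) pseudo set" "riemannian_dist {}"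
    by standard (auto simp: riemannian_dist_def)
  show ?thesis
    unfolding riemannian_complete_def True using Metric_space_axioms mcomplete_empty by blast
next
  case False
  interpret spacelike_submanifold M by standard (use assms in auto)
  obtain f where f: "smooth_on UNIV f" "M = range (\<lambda>x. (x, f x))"
    "\<And>x v. v \<noteq> 0 \<Longrightarrow> norm (pd v f x) < norm v"
    using global_graph[OF assms(4,3) False] by metis
  interpret g: spacelike_graph f by standard (use f in auto)
  have "M = range g.F" using f(2) by (simp add: g.F_def[abs_def])
  then show ?thesis using g.riemannian_complete_graph assms(5) by simp
qed

end
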